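(* Let $(X,Y)$ and $(V,W)$ be two Banach couples with $\operatorname{Int}(X,Y)=\operatorname{Int}(V,W)$. Then $(X,Y)\simeq(V,W)$, i.e. either ($X\simeq V$ and $Y\simeq W$) or ($X\simeq W$ and $Y\simeq V$).
   Context: All Banach spaces are over the same scalar field ($\mathbb{R}$ or $\mathbb{C}$). $E\hookrightarrow F$ means that the Banach space $E$ is a linear subspace of the Banach space $F$ and the inclusion is continuous. $E\simeq F$ means that $E$ and $F$ coincide as linear spaces and their norms are equivalent. A Banach couple $(X,Y)$ is a pair of Banach spaces, both linearly and continuously embedded (as linear subspaces) in some Hausdorff topological vector space. $X\cap Y$ is a Banach space with norm $\|z\|_{X\cap Y}=\max\{\|z\|_X,\|z\|_Y\}$, and $X+Y$ is a Banach space with norm $\|z\|_{X+Y}=\inf\{\|x\|_X+\|y\|_Y: x\in X,\ y\in Y,\ z=x+y\}$. $\operatorname{I}(X,Y)$ is the collection of intermediate spaces, i.e. Banach spaces $Z$ with $X\cap Y\hookrightarrow Z\hookrightarrow X+Y$. $L((X,Y))$ is the set of linear operators $T$ in $X+Y$ that map $X$ into $X$ and $Y$ into $Y$ boundedly. $\operatorname{Int}(X,Y)$ (interpolation spaces) is the collection of all $Z\in\operatorname{I}(X,Y)$ such that $T(Z)\subset Z$ for every $T\in L((X,Y))$. *)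

theory Defs
  imports "HOL-Analysis.Analysis"
begin

(* Scalar fields isometrically isomorphic to the reals or to the complex numbers. *)
class real_or_complex = real_normed_field +
  assumes real_or_complex:
    "\<exists>\<phi> :: 'a \<Rightarrow> complex. inj \<phi> \<and> (range \<phi> = \<real> \<or> range \<phi> = UNIV) \<and>
       (\<forall>a b. \<phi> (a + b) = \<phi> a + \<phi> b) \<and> (\<forall>a b. \<phi> (a * b) = \<phi> a * \<phi> b) \<and>
       (\<forall>a. norm (\<phi> a) = norm a)"

instance real :: real_or_complex
proof (standard, intro exI conjI)
  show "inj complex_of_real" by (rule inj_of_real)
  show "range complex_of_real = \<real> \<or> range complex_of_real = UNIV" by (simp add: Reals_def)
qed simp_all

instance complex :: real_or_complex
proof (standard, intro exI conjI)
  show "inj (\<lambda>z::complex. z)" by simp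
  show "range (\<lambda>z::complex. z) = \<real> \<or> range (\<lambda>z::complex. z) = UNIV" by simp
qed simp_all

(* All spaces are linear subspaces of an ambient vector space: a type 'a with a scalar
   multiplication smul. Only its linear structure is fixed, not a topology. *)
record 'a nspace =
  cset :: "'a set"
  nrm :: "'a \<Rightarrow> real"

abbreviation ndist :: "'a::ab_group_add nspace \<Rightarrow> 'a \<Rightarrow> 'a \<Rightarrow> real" where
  "ndist E \<equiv> (\<lambda>x y. nrm E (x - y))"

abbreviation ntop :: "'a::ab_group_add nspace \<Rightarrow> 'a topology" where
  "ntop E \<equiv> Metric_space.mtopology (cset E) (ndist E)"

(* The norm is a total function, required to be 0 off the carrier. Hence a space is determined
   by its carrier and the norm on it (so equality of collections of spaces is meaningful), and
   ndist satisfies the Metric_space axioms that are not relativised to the carrier. *)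
definition banach_space ::
  "('k::real_or_complex \<Rightarrow> 'a::ab_group_add \<Rightarrow> 'a) \<Rightarrow> 'a nspace \<Rightarrow> bool" where
  "banach_space smul E \<longleftrightarrow>
     module.subspace smul (cset E) \<and>
     (\<forall>x\<in>cset E. 0 \<le> nrm E x) \<and>
     (\<forall>x\<in>cset E. nrm E x = 0 \<longleftrightarrow> x = 0) \<and>
     (\<forall>c. \<forall>x\<in>cset E. nrm E (smul c x) = norm c * nrm E x) \<and>
     (\<forall>x\<in>cset E. \<forall>y\<in>cset E. nrm E (x + y) \<le> nrm E x + nrm E y) \<and>
     (\<forall>x. x \<notin> cset E \<longrightarrow> nrm E x = 0) \<and>
     Metric_space.mcomplete (cset E) (ndist E)"

definition embeds :: "'a::ab_group_add nspace \<Rightarrow> 'a nspace \<Rightarrow> bool" (infix "\<hookrightarrow>" 50) where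
  "E \<hookrightarrow> F \<longleftrightarrow> cset E \<subseteq> cset F \<and> continuous_map (ntop E) (ntop F) (\<lambda>x. x)"

definition equiv_spaces :: "'a nspace \<Rightarrow> 'a nspace \<Rightarrow> bool" (infix "\<simeq>" 50) where
  "E \<simeq> F \<longleftrightarrow> cset E = cset F \<and>
     (\<exists>c>0. \<exists>C>0. \<forall>x\<in>cset E. c * nrm E x \<le> nrm F x \<and> nrm F x \<le> C * nrm E x)"

(* A Hausdorff topological vector space carried by a linear subspace of the ambient space. *)
definition hausdorff_tvs ::
  "('k::real_or_complex \<Rightarrow> 'a::ab_group_add \<Rightarrow> 'a) \<Rightarrow> 'a topology \<Rightarrow> bool" where
  "hausdorff_tvs smul U \<longleftrightarrow>
     module.subspace smul (topspace U) \<and> Hausdorff_space U \<and>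
     continuous_map (prod_topology U U) U (\<lambda>(x, y). x + y) \<and>
     continuous_map (prod_topology euclidean U) U (\<lambda>(c, x). smul c x)"

(* continuous_map entails that the carriers lie in topspace U. *)
definition banach_couple ::
  "('k::real_or_complex \<Rightarrow> 'a::ab_group_add \<Rightarrow> 'a) \<Rightarrow> 'a nspace \<Rightarrow> 'a nspace \<Rightarrow> bool" where
  "banach_couple smul X Y \<longleftrightarrow> banach_space smul X \<and> banach_space smul Y \<and>
     (\<exists>U. hausdorff_tvs smul U \<and>
          continuous_map (ntop X) U (\<lambda>x. x) \<and> continuous_map (ntop Y) U (\<lambda>x. x))"

definition inter_space :: "'a nspace \<Rightarrow> 'a nspace \<Rightarrow> 'a nspace" where
  "inter_space X Y =
     \<lparr> cset = cset X \<inter> cset Y,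
       nrm = (\<lambda>z. if z \<in> cset X \<inter> cset Y then max (nrm X z) (nrm Y z) else 0) \<rparr>"

definition sum_space :: "'a::ab_group_add nspace \<Rightarrow> 'a nspace \<Rightarrow> 'a nspace" where
  "sum_space X Y =
     (let S = {x + y |x y. x \<in> cset X \<and> y \<in> cset Y} in
     \<lparr> cset = S,
       nrm = (\<lambda>z. if z \<in> S
                  then Inf {nrm X x + nrm Y y |x y. x \<in> cset X \<and> y \<in> cset Y \<and> z = x + y}
                  else 0) \<rparr>)"

definition intermediate_spaces ::
  "('k::real_or_complex \<Rightarrow> 'a::ab_group_add \<Rightarrow> 'a) \<Rightarrow> 'a nspace \<Rightarrow> 'a nspace \<Rightarrow> 'a nspace set" where
  "intermediate_spaces smul X Y =
     {Z. banach_space smul Z \<and> inter_space X Y \<hookrightarrow> Z \<and> Z \<hookrightarrow> sum_space X Y}"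

definition bounded_on :: "'a nspace \<Rightarrow> ('a \<Rightarrow> 'a) \<Rightarrow> bool" where
  "bounded_on E T \<longleftrightarrow> T ` cset E \<subseteq> cset E \<and> (\<exists>C. \<forall>x\<in>cset E. nrm E (T x) \<le> C * nrm E x)"

(* Operators in X + Y are functions on the ambient type, of which only the values on X + Y matter. *)
definition couple_operators ::
  "('k::real_or_complex \<Rightarrow> 'a::ab_group_add \<Rightarrow> 'a) \<Rightarrow> 'a nspace \<Rightarrow> 'a nspace \<Rightarrow> ('a \<Rightarrow> 'a) set" where
  "couple_operators smul X Y =
     {T. T ` cset (sum_space X Y) \<subseteq> cset (sum_space X Y) \<and>
         (\<forall>x\<in>cset (sum_space X Y). \<forall>y\<in>cset (sum_space X Y). T (x + y) = T x + T y) \<and>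
         (\<forall>c. \<forall>x\<in>cset (sum_space X Y). T (smul c x) = smul c (T x)) \<and>
         bounded_on X T \<and> bounded_on Y T}"

definition interpolation_spaces ::
  "('k::real_or_complex \<Rightarrow> 'a::ab_group_add \<Rightarrow> 'a) \<Rightarrow> 'a nspace \<Rightarrow> 'a nspace \<Rightarrow> 'a nspace set" where
  "interpolation_spaces smul X Y =
     {Z \<in> intermediate_spaces smul X Y. \<forall>T\<in>couple_operators smul X Y. T ` cset Z \<subseteq> cset Z}"

end

theory Submission
  imports Defs
begin

text \<open>
Each component of a couple is an interpolation space of that couple. So if \<open>(X, Y)\<close> and
\<open>(V, W)\<close> have the same interpolation spaces, then \<open>V\<close> and \<open>W\<close> are
interpolation spaces of \<open>(X, Y)\<close>, and \<open>X\<close> and \<open>Y\<close> are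
interpolation spaces of \<open>(V, W)\<close>. This relation, called \<open>linked\<close> below, carries
the whole argument. It gives \<open>X \<inter> Y = V \<inter> W\<close> and \<open>X + Y = V + W\<close>,
and by the closed graph theorem two of the four spaces have equivalent norms as soon as they have
the same elements. What remains is to recognise the sets \<open>X\<close> and \<open>Y\<close>, and
the tests are rank one operators \<open>s \<mapsto> f(s) z\<close>.

If \<open>f\<close> vanishes on \<open>Y\<close>, then \<open>z\<close> may be any element of
\<open>X\<close>. Therefore an interpolation space of \<open>(X, Y)\<close> contains \<open>X\<close>
or lies in the closure of \<open>Y\<close> in \<open>X + Y\<close>
(\<open>interpolation_dichotomy\<close>). When one of the four spaces is not in the closure of its
partner, these alternatives and the modular law determine which spaces coincide
(\<open>nondense_component\<close>).

If \<open>f\<close> is bounded on \<open>X + Y\<close> and \<open>z \<in> X \<inter> Y\<close>, the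
operator has norms \<open>\<parallel>f\<parallel> \<parallel>z\<parallel>\<close> in the four spaces, with the
dual norm of \<open>f\<close> taken in the space concerned. A couple operator is bounded on every
interpolation space by a fixed multiple of the larger of its norms on the components
(\<open>interpolation_bound\<close>). Hence the maximum of its norms on \<open>X\<close> and
\<open>Y\<close> and the maximum of its norms on \<open>V\<close> and \<open>W\<close> agree up to a
constant. In logarithms, a matrix \<open>max (a i + c j) (b i + d j)\<close>, with rows
\<open>z\<close> and columns \<open>f\<close>, is known up to a bounded error. If neither of
\<open>X\<close>, \<open>Y\<close> contains the other and \<open>X \<inter> Y\<close> is dense in both, then
\<open>a - b\<close> and \<open>d - c\<close> are unbounded in both directions, the second by the
Hahn-Banach theorem, and such a matrix determines \<open>a\<close> and \<open>b\<close> up to bounded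
errors and the order of the two (\<open>tropical_rigidity\<close>). So on \<open>X \<inter> Y\<close> the
norms of \<open>X\<close> and \<open>Y\<close> are equivalent to those of \<open>V\<close> and
\<open>W\<close> in one of the two orders, and density carries this over to the spaces.
\<close>

section \<open>Normed spaces inside an ambient vector space\<close>

definition normed_space ::
  "('k::real_or_complex \<Rightarrow> 'a::ab_group_add \<Rightarrow> 'a) \<Rightarrow> 'a nspace \<Rightarrow> bool" where
  "normed_space smul E \<longleftrightarrow>
     module.subspace smul (cset E) \<and>
     (\<forall>x\<in>cset E. 0 \<le> nrm E x) \<and>
     (\<forall>x\<in>cset E. nrm E x = 0 \<longleftrightarrow> x = 0) \<and>
     (\<forall>c. \<forall>x\<in>cset E. nrm E (smul c x) = norm c * nrm E x) \<and>
     (\<forall>x\<in>cset E. \<forall>y\<in>cset E. nrm E (x + y) \<le> nrm E x + nrm E y) \<and>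
     (\<forall>x. x \<notin> cset E \<longrightarrow> nrm E x = 0)"

lemma banach_space_iff:
  "banach_space smul E \<longleftrightarrow>
     normed_space smul E \<and> Metric_space.mcomplete (cset E) (ndist E)"
  by (auto simp: banach_space_def normed_space_def)

lemma banach_imp_normed: "banach_space smul E \<Longrightarrow> normed_space smul E"
  by (simp add: banach_space_iff)

text \<open>
Membership of the terms is part of convergence: the norm is 0 off the carrier, so small values of it say
nothing about elements outside.
\<close>

definition nlim :: "'a::ab_group_add nspace \<Rightarrow> (nat \<Rightarrow> 'a) \<Rightarrow> 'a \<Rightarrow> bool" where
  "nlim E g l \<longleftrightarrow> range g \<subseteq> cset E \<and> l \<in> cset E \<and> (\<lambda>n. nrm E (g n - l)) \<longlonglongrightarrow> 0"

abbreviation nsums :: "'a::ab_group_add nspace \<Rightarrow> (nat \<Rightarrow> 'a) \<Rightarrow> 'a \<Rightarrow> bool" where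
  "nsums E g l \<equiv> nlim E (\<lambda>N. \<Sum>n<N. g n) l"

definition bounded_inclusion :: "'a nspace \<Rightarrow> 'a nspace \<Rightarrow> bool" where
  "bounded_inclusion E F \<longleftrightarrow>
     cset E \<subseteq> cset F \<and> (\<exists>C\<ge>0. \<forall>x\<in>cset E. nrm F x \<le> C * nrm E x)"

locale scalar_space = vector_space smul
  for smul :: "'k::real_or_complex \<Rightarrow> 'a::ab_group_add \<Rightarrow> 'a"
begin

abbreviation rscale :: "real \<Rightarrow> 'a \<Rightarrow> 'a" where
  "rscale r \<equiv> smul (of_real r)"

lemma normed_zero: "normed_space smul E \<Longrightarrow> 0 \<in> cset E"
  and normed_add: "normed_space smul E \<Longrightarrow> x \<in> cset E \<Longrightarrow> y \<in> cset E \<Longrightarrow> x + y \<in> cset E"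
  and normed_diff: "normed_space smul E \<Longrightarrow> x \<in> cset E \<Longrightarrow> y \<in> cset E \<Longrightarrow> x - y \<in> cset E"
  and normed_neg: "normed_space smul E \<Longrightarrow> x \<in> cset E \<Longrightarrow> - x \<in> cset E"
  and normed_scale: "normed_space smul E \<Longrightarrow> x \<in> cset E \<Longrightarrow> smul c x \<in> cset E"
  and normed_sum: "normed_space smul E \<Longrightarrow> (\<And>i. i \<in> A \<Longrightarrow> g i \<in> cset E) \<Longrightarrow> sum g A \<in> cset E"
  by (auto simp: normed_space_def intro: subspace_0 subspace_add subspace_diff subspace_neg
      subspace_scale subspace_sum)

lemma nrm_nonneg: "normed_space smul E \<Longrightarrow> 0 \<le> nrm E x"
  by (cases "x \<in> cset E") (auto simp: normed_space_def)

lemma nrm_zero: "normed_space smul E \<Longrightarrow> nrm E 0 = 0"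
  using normed_zero[of E] by (auto simp: normed_space_def)

lemma nrm_eq_0: "normed_space smul E \<Longrightarrow> x \<in> cset E \<Longrightarrow> nrm E x = 0 \<longleftrightarrow> x = 0"
  by (auto simp: normed_space_def)

lemma nrm_pos: "normed_space smul E \<Longrightarrow> x \<in> cset E \<Longrightarrow> x \<noteq> 0 \<Longrightarrow> 0 < nrm E x"
  using nrm_eq_0[of E x] nrm_nonneg[of E x] by linarith

lemma nrm_scale: "normed_space smul E \<Longrightarrow> x \<in> cset E \<Longrightarrow> nrm E (smul c x) = norm c * nrm E x"
  by (auto simp: normed_space_def)

lemma nrm_triangle: "normed_space smul E \<Longrightarrow> x \<in> cset E \<Longrightarrow> y \<in> cset E \<Longrightarrow>
    nrm E (x + y) \<le> nrm E x + nrm E y"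
  by (auto simp: normed_space_def)

lemma nrm_neg: "normed_space smul E \<Longrightarrow> nrm E (- x) = nrm E x"
proof (cases "x \<in> cset E")
  case True
  assume E: "normed_space smul E"
  show ?thesis using nrm_scale[OF E True, of "-1"] by simp
next
  case False
  assume E: "normed_space smul E"
  have "- x \<notin> cset E" using False normed_neg[OF E, of "-x"] by auto
  then show ?thesis using E False by (auto simp: normed_space_def)
qed

lemma nrm_minus_commute: "normed_space smul E \<Longrightarrow> nrm E (x - y) = nrm E (y - x)"
  using nrm_neg[of E "x - y"] by simp

lemma nrm_triangle_diff: "normed_space smul E \<Longrightarrow> x \<in> cset E \<Longrightarrow> y \<in> cset E \<Longrightarrow>
    nrm E (x - y) \<le> nrm E x + nrm E y"
  using nrm_triangle[of E x "- y"] normed_neg[of E y] nrm_neg[of E y] by simp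

lemma nrm_sum_le:
  assumes E: "normed_space smul E" and "\<And>i. i \<in> A \<Longrightarrow> g i \<in> cset E"
  shows "nrm E (sum g A) \<le> (\<Sum>i\<in>A. nrm E (g i))"
  using assms(2)
proof (induction A rule: infinite_finite_induct)
  case (insert a A)
  then have "nrm E (g a + sum g A) \<le> nrm E (g a) + nrm E (sum g A)"
    by (intro nrm_triangle[OF E] normed_sum[OF E]) auto
  with insert show ?case by fastforce
qed (simp_all add: nrm_zero[OF E])

lemma Metric_space_normed: "normed_space smul E \<Longrightarrow> Metric_space (cset E) (ndist E)"
proof
  assume E: "normed_space smul E"
  show "0 \<le> nrm E (x - y)" for x y by (rule nrm_nonneg[OF E])
  show "nrm E (x - y) = nrm E (y - x)" for x y by (rule nrm_minus_commute[OF E])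
  show "(nrm E (x - y) = 0) = (x = y)" if "x \<in> cset E" "y \<in> cset E" for x y
    using nrm_eq_0[OF E normed_diff[OF E that]] by simp
  show "nrm E (x - z) \<le> nrm E (x - y) + nrm E (y - z)"
    if "x \<in> cset E" "y \<in> cset E" "z \<in> cset E" for x y z
    using nrm_triangle[OF E normed_diff[OF E that(1,2)] normed_diff[OF E that(2,3)]] by simp
qed

lemma nlim_iff_limitin:
  assumes E: "normed_space smul E" and g: "range g \<subseteq> cset E"
  shows "nlim E g l \<longleftrightarrow> limitin (ntop E) g l sequentially"
proof -
  interpret Metric_space "cset E" "ndist E" by (rule Metric_space_normed[OF E])
  show ?thesis
    using g by (auto simp: nlim_def limitin_metric_dist_null image_subset_iff intro!: always_eventually)
qed

text \<open>
Continuity at the origin bounds the second norm by 1 on a ball of the first, and scaling turns this into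
a constant.
\<close>

lemma embeds_iff_bounded_inclusion:
  assumes E: "normed_space smul E" and F: "normed_space smul F"
  shows "E \<hookrightarrow> F \<longleftrightarrow> bounded_inclusion E F"
proof (cases "cset E \<subseteq> cset F")
  case True
  interpret ME: Metric_space "cset E" "ndist E" by (rule Metric_space_normed[OF E])
  have eq: "continuous_map (ntop E) (ntop F) (\<lambda>x. x) \<longleftrightarrow>
     (\<forall>a\<in>cset E. \<forall>\<epsilon>>0. \<exists>\<delta>>0. \<forall>x. x \<in> cset E \<and> nrm E (a - x) < \<delta> \<longrightarrow> nrm F (a - x) < \<epsilon>)"
    using True by (simp add: ME.metric_continuous_map[OF Metric_space_normed[OF F]] image_subset_iff
      subset_iff)
  have "(\<exists>C\<ge>0. \<forall>x\<in>cset E. nrm F x \<le> C * nrm E x)"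
    if c: "continuous_map (ntop E) (ntop F) (\<lambda>x. x)"
  proof -
    obtain d where d: "d > 0" "\<And>x. x \<in> cset E \<Longrightarrow> nrm E (0 - x) < d \<Longrightarrow> nrm F (0 - x) < 1"
      using c normed_zero[OF E] zero_less_one unfolding eq by blast
    have "nrm F x \<le> 2 / d * nrm E x" if x: "x \<in> cset E" for x
    proof (cases "x = 0")
      case False
      define r where "r = d / (2 * nrm E x)"
      have r: "r > 0" using d nrm_pos[OF E x False] by (simp add: r_def)
      have "nrm E (0 - rscale r x) < d"
        using d nrm_pos[OF E x False] r
        by (simp add: nrm_neg[OF E] nrm_scale[OF E x] norm_of_real del: of_real_divide of_real_mult)
          (simp add: r_def)
      then have "nrm F (0 - rscale r x) < 1" using d normed_scale[OF E x] by blast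
      then have "r * nrm F x < 1" using r x True by (simp add: nrm_neg[OF F] nrm_scale[OF F] subset_iff)
      then show ?thesis using nrm_pos[OF E x False] d(1) by (simp add: r_def field_simps)
    qed (simp add: nrm_zero[OF E] nrm_zero[OF F])
    then show ?thesis using d by (intro exI[of _ "2 / d"]) auto
  qed
  moreover have "continuous_map (ntop E) (ntop F) (\<lambda>x. x)"
    if C: "C \<ge> 0" "\<And>x. x\<in>cset E \<Longrightarrow> nrm F x \<le> C * nrm E x" for C
    unfolding eq
  proof (intro ballI allI impI)
    fix a \<epsilon> :: _ assume a: "a \<in> cset E" "\<epsilon> > (0::real)"
    show "\<exists>\<delta>>0. \<forall>x. x \<in> cset E \<and> nrm E (a - x) < \<delta> \<longrightarrow> nrm F (a - x) < \<epsilon>"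
    proof (intro exI[of _ "\<epsilon> / (C + 1)"] conjI allI impI)
      show "0 < \<epsilon> / (C + 1)" using C a by simp
      fix x assume x: "x \<in> cset E \<and> nrm E (a - x) < \<epsilon> / (C + 1)"
      have "nrm F (a - x) \<le> C * nrm E (a - x)" using C normed_diff[OF E a(1)] x by auto
      also have "\<dots> \<le> (C + 1) * nrm E (a - x)" using nrm_nonneg[OF E, of "a - x"] by (simp add: algebra_simps)
      also have "\<dots> < \<epsilon>" using x C by (simp add: field_simps)
      finally show "nrm F (a - x) < \<epsilon>" .
    qed
  qed
  ultimately show ?thesis using True unfolding embeds_def bounded_inclusion_def by blast
qed (auto simp: embeds_def bounded_inclusion_def)

lemma nlim_mono:
  assumes E: "normed_space smul E" and F: "normed_space smul F"
    and EF: "bounded_inclusion E F" and g: "nlim E g l"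
  shows "nlim F g l"
proof -
  obtain C where C: "C \<ge> 0" "\<And>x. x \<in> cset E \<Longrightarrow> nrm F x \<le> C * nrm E x"
    using EF unfolding bounded_inclusion_def by blast
  have "(\<lambda>n. nrm F (g n - l)) \<longlonglongrightarrow> 0"
  proof (rule tendsto_sandwich[where f="\<lambda>_. 0" and h="\<lambda>n. C * nrm E (g n - l)"])
    show "\<forall>\<^sub>F n in sequentially. nrm F (g n - l) \<le> C * nrm E (g n - l)"
      using g by (intro always_eventually allI C normed_diff[OF E]) (auto simp: nlim_def)
    show "(\<lambda>n. C * nrm E (g n - l)) \<longlonglongrightarrow> 0"
      using g by (auto simp: nlim_def intro: tendsto_mult_right_zero)
  qed (auto simp: nrm_nonneg[OF F])
  then show ?thesis using g EF by (auto simp: nlim_def bounded_inclusion_def)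
qed

lemma nlim_unique:
  assumes E: "normed_space smul E" and "nlim E g l" "nlim E g m"
  shows "l = m"
proof -
  interpret Metric_space "cset E" "ndist E" by (rule Metric_space_normed[OF E])
  have "range g \<subseteq> cset E" using assms by (simp add: nlim_def)
  from assms(2,3)[unfolded nlim_iff_limitin[OF E this]] show ?thesis
    by (rule limitin_metric_unique) simp
qed

lemma nlim_add:
  assumes E: "normed_space smul E" and g: "nlim E g l" and h: "nlim E h m"
  shows "nlim E (\<lambda>n. g n + h n) (l + m)"
proof -
  have "(\<lambda>n. nrm E (g n + h n - (l + m))) \<longlonglongrightarrow> 0"
  proof (rule tendsto_sandwich[where f="\<lambda>_. 0" and h="\<lambda>n. nrm E (g n - l) + nrm E (h n - m)"])
    have "nrm E (g n + h n - (l + m)) \<le> nrm E (g n - l) + nrm E (h n - m)" for n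
      using nrm_triangle[OF E, of "g n - l" "h n - m"] g h normed_diff[OF E]
      by (auto simp: nlim_def algebra_simps image_subset_iff)
    then show "\<forall>\<^sub>F n in sequentially. nrm E (g n + h n - (l + m)) \<le> nrm E (g n - l) + nrm E (h n - m)"
      by simp
    show "(\<lambda>n. nrm E (g n - l) + nrm E (h n - m)) \<longlonglongrightarrow> 0"
      using g h by (auto simp: nlim_def intro: tendsto_add_zero)
  qed (auto simp: nrm_nonneg[OF E])
  then show ?thesis using g h normed_add[OF E] by (auto simp: nlim_def image_subset_iff)
qed

lemma nlim_scale:
  assumes E: "normed_space smul E" and g: "nlim E g l"
  shows "nlim E (\<lambda>n. smul c (g n)) (smul c l)"
proof -
  have "nrm E (smul c (g n) - smul c l) = norm c * nrm E (g n - l)" for n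
    using nrm_scale[OF E normed_diff[OF E, of "g n" l], of c] g
    by (auto simp: nlim_def scale_right_diff_distrib)
  then have "(\<lambda>n. nrm E (smul c (g n) - smul c l)) \<longlonglongrightarrow> 0"
    using g by (auto simp: nlim_def intro: tendsto_mult_right_zero)
  then show ?thesis using g normed_scale[OF E] by (auto simp: nlim_def image_subset_iff)
qed

lemma nlim_nrm_le:
  assumes E: "normed_space smul E" and g: "nlim E g l" and b: "\<And>n. nrm E (g n) \<le> B"
  shows "nrm E l \<le> B"
proof (rule field_le_epsilon)
  fix e :: real assume e: "e > 0"
  obtain n where n: "nrm E (g n - l) < e"
    using g e order_tendstoD(2)[of "\<lambda>n. nrm E (g n - l)" 0 sequentially e] eventually_happens'[OF sequentially_bot]
    unfolding nlim_def by blast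
  have "nrm E l \<le> nrm E (g n) + nrm E (g n - l)"
    using nrm_triangle_diff[OF E, of "g n" "g n - l"] g normed_diff[OF E]
    by (auto simp: nlim_def image_subset_iff)
  with n b[of n] show "nrm E l \<le> B + e" by linarith
qed

lemma banach_nsums:
  assumes B: "banach_space smul E" and g: "\<And>n. g n \<in> cset E"
    and s: "summable (\<lambda>n. nrm E (g n))"
  shows "\<exists>l. nsums E g l \<and> nrm E l \<le> (\<Sum>n. nrm E (g n))"
proof -
  have E: "normed_space smul E" using B by (rule banach_imp_normed)
  interpret Metric_space "cset E" "ndist E" by (rule Metric_space_normed[OF E])
  define G where "G = (\<lambda>N. \<Sum>n<N. g n)"
  have G: "range G \<subseteq> cset E" using g by (auto simp: G_def intro: normed_sum[OF E])
  have diff: "nrm E (G n - G m) \<le> norm (\<Sum>i=m..<n. nrm E (g i))" if "m \<le> n" for m n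
  proof -
    have "G n - G m = (\<Sum>i=m..<n. g i)"
      using that by (simp add: G_def lessThan_atLeast0 sum_diff_nat_ivl)
    then show ?thesis using nrm_sum_le[OF E, of "{m..<n}" g] g
      by (simp add: sum_nonneg nrm_nonneg[OF E])
  qed
  have "MCauchy G"
    unfolding MCauchy_def
  proof (intro conjI G allI impI)
    fix \<epsilon> :: real assume "\<epsilon> > 0"
    then obtain N where N: "\<And>m n. m \<ge> N \<Longrightarrow> norm (\<Sum>i=m..<n. nrm E (g i)) < \<epsilon>"
      using s unfolding summable_Cauchy by blast
    have "nrm E (G n - G n') < \<epsilon>" if "N \<le> n" "N \<le> n'" for n n'
    proof (cases "n \<le> n'")
      case True
      then show ?thesis using diff[OF True] N[OF that(1), of n'] nrm_minus_commute[OF E, of "G n" "G n'"]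
        by simp
    next
      case False
      then show ?thesis using diff[of n' n] N[OF that(2), of n] by simp
    qed
    then show "\<exists>N. \<forall>n n'. N \<le> n \<longrightarrow> N \<le> n' \<longrightarrow> nrm E (G n - G n') < \<epsilon>" by blast
  qed
  then obtain l where l: "nlim E G l"
    using B nlim_iff_limitin[OF E G] unfolding banach_space_iff mcomplete_def by blast
  have "nrm E (G n) \<le> (\<Sum>n. nrm E (g n))" for n
  proof -
    have "nrm E (G n) \<le> (\<Sum>i<n. nrm E (g i))" unfolding G_def using g by (intro nrm_sum_le[OF E])
    also have "\<dots> \<le> (\<Sum>n. nrm E (g n))"
      using s by (intro sum_le_suminf) (auto simp: nrm_nonneg[OF E])
    finally show ?thesis .
  qed
  from nlim_nrm_le[OF E l this] l show ?thesis unfolding G_def by blast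
qed

end

section \<open>Countably subadditive seminorms and the closed graph theorem\<close>

context scalar_space
begin

text \<open>
Each correction halves the remaining error. The relation \<open>Q\<close> keeps track of what else is
known about the corrections, such as a bound on their size in another norm.
\<close>

lemma successive_approximation:
  assumes E: "normed_space smul E" and y: "y \<in> cset E"
    and step: "\<And>r. r \<in> cset E \<Longrightarrow> \<exists>x. Q x r \<and> r - x \<in> cset E \<and> nrm E (r - x) \<le> nrm E r / 2"
  shows "\<exists>x r. \<forall>n. Q (x n) (r n) \<and> r n \<in> cset E \<and> nrm E (r n) \<le> nrm E y * (1/2) ^ n \<and>
    (\<Sum>k<n. x k) = y - r n"
proof -
  define X where "X r = (SOME x. Q x r \<and> r - x \<in> cset E \<and> nrm E (r - x) \<le> nrm E r / 2)" for r
  have X: "Q (X r) r \<and> r - X r \<in> cset E \<and> nrm E (r - X r) \<le> nrm E r / 2" if "r \<in> cset E" for r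
    unfolding X_def by (rule someI_ex[OF step[OF that]])
  define r where "r = rec_nat y (\<lambda>_ s. s - X s)"
  have r0: "r 0 = y" and rS: "\<And>n. r (Suc n) = r n - X (r n)" by (simp_all add: r_def)
  have rE: "r n \<in> cset E" for n
  proof (induction n)
    case (Suc n)
    then show ?case using X[OF Suc] by (simp only: rS)
  qed (simp add: r0 y)
  have bound: "nrm E (r n) \<le> nrm E y * (1/2) ^ n" for n
  proof (induction n)
    case (Suc n)
    have "nrm E (r (Suc n)) \<le> nrm E (r n) / 2" using X[OF rE[of n]] by (simp only: rS)
    with Suc show ?case by simp
  qed (simp add: r0)
  have sum: "(\<Sum>k<n. X (r k)) = y - r n" for n
  proof (induction n)
    case (Suc n)
    then show ?case by (simp add: rS)
  qed (simp add: r0)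
  show ?thesis
    by (intro exI[of _ "\<lambda>n. X (r n)"] exI[of _ r] allI conjI rE bound sum conjunct1[OF X[OF rE]])
qed

lemma geometric_remainder_nlim:
  assumes E: "normed_space smul E" and y: "y \<in> cset E" and r: "\<And>n. r n \<in> cset E"
    "\<And>n. nrm E (r n) \<le> c * (1/2) ^ n"
  shows "nlim E (\<lambda>n. y - r n) y"
proof -
  have "(\<lambda>n. nrm E (r n)) \<longlonglongrightarrow> 0"
  proof (rule tendsto_sandwich[where f="\<lambda>_. 0" and h="\<lambda>n. c * (1/2) ^ n"])
    show "(\<lambda>n. c * (1 / 2) ^ n) \<longlonglongrightarrow> 0"
      by (intro tendsto_mult_right_zero LIMSEQ_realpow_zero) auto
  qed (auto simp: nrm_nonneg[OF E] r)
  then show ?thesis using y r normed_diff[OF E] by (auto simp: nlim_def nrm_neg[OF E])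
qed

lemma summable_geometric_bound:
  assumes "\<And>n. 0 \<le> a n" "\<And>n. a n \<le> c * (1/2::real) ^ n"
  shows "summable a" "suminf a \<le> 2 * c"
proof -
  have s: "(\<lambda>n. c * (1/2::real) ^ n) sums (c * (1 / (1 - 1/2)))"
    by (intro sums_mult geometric_sums) auto
  show "summable a" using assms s by (intro summable_comparison_test'[OF sums_summable[OF s]]) auto
  then have "suminf a \<le> (\<Sum>n. c * (1/2::real) ^ n)"
    using assms s by (intro suminf_le) (auto simp: sums_iff)
  then show "suminf a \<le> 2 * c" using s by (simp add: sums_iff)
qed

text \<open>
The iteration behind the open mapping theorem. The corrections form an absolutely convergent series in
\<open>E\<close>, the errors tend to 0 in \<open>F\<close>, and the two limits agree because both can be
taken in \<open>S\<close>.
\<close>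

lemma absorption:
  assumes BE: "banach_space smul E" and F: "normed_space smul F" and S: "normed_space smul S"
    and ES: "bounded_inclusion E S" and FS: "bounded_inclusion F S" and C: "C \<ge> 0"
    and step: "\<And>y. y \<in> cset F \<Longrightarrow>
      \<exists>x\<in>cset E. nrm E x \<le> C * nrm F y \<and> y - x \<in> cset F \<and> nrm F (y - x) \<le> nrm F y / 2"
  shows "cset F \<subseteq> cset E"
proof
  fix y assume y: "y \<in> cset F"
  have E: "normed_space smul E" using BE by (rule banach_imp_normed)
  obtain x r where x: "\<And>n. x n \<in> cset E \<and> nrm E (x n) \<le> C * nrm F (r n)"
    and r: "\<And>n. r n \<in> cset F" "\<And>n. nrm F (r n) \<le> nrm F y * (1/2) ^ n"
    and sum: "\<And>n. (\<Sum>k<n. x k) = y - r n"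
    using successive_approximation[OF F y, of "\<lambda>x r. x \<in> cset E \<and> nrm E x \<le> C * nrm F r"]
      step[unfolded Bex_def] unfolding conj_assoc by blast
  have "nrm E (x n) \<le> (C * nrm F y) * (1/2) ^ n" for n
    using x[of n] mult_left_mono[OF r(2)[of n] C] by (simp add: mult.assoc)
  then have "summable (\<lambda>n. nrm E (x n))"
    by (intro summable_geometric_bound(1)) (auto simp: nrm_nonneg[OF E])
  then obtain l where l: "nsums E x l" using banach_nsums[OF BE] x by blast
  have "nlim F (\<lambda>n. y - r n) y" by (rule geometric_remainder_nlim[OF F y r])
  then have "nsums S x y" using nlim_mono[OF F S FS] by (simp add: sum)
  moreover have "nsums S x l" using nlim_mono[OF E S ES l] .
  ultimately have "y = l" using nlim_unique[OF S] by blast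
  then show "y \<in> cset E" using l by (simp add: nlim_def)
qed

text \<open>
Zabreiko's lemma. By Baire's theorem some set on which \<open>p\<close> is bounded is dense in a ball,
and by symmetry and convexity also in a ball around the origin. Successive approximation then writes
every vector as a series along which \<open>p\<close> decays geometrically. With the norm of an image as
\<open>p\<close> this gives the closed graph theorem, with a supremum of norms the uniform boundedness
principle.
\<close>

lemma zabreiko:
  assumes B: "banach_space smul E"
    and nonneg: "\<And>x. x \<in> cset E \<Longrightarrow> 0 \<le> p x"
    and tri: "\<And>x y. x \<in> cset E \<Longrightarrow> y \<in> cset E \<Longrightarrow> p (x + y) \<le> p x + p y"
    and hom: "\<And>r x. x \<in> cset E \<Longrightarrow> p (rscale r x) = \<bar>r\<bar> * p x"
    and sub: "\<And>g l. (\<And>n. g n \<in> cset E) \<Longrightarrow> nsums E g l \<Longrightarrow> summable (\<lambda>n. p (g n)) \<Longrightarrow>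
      p l \<le> (\<Sum>n. p (g n))"
  shows "\<exists>C\<ge>0. \<forall>x\<in>cset E. p x \<le> C * nrm E x"
proof -
  have E: "normed_space smul E" using B by (rule banach_imp_normed)
  interpret Metric_space "cset E" "ndist E" by (rule Metric_space_normed[OF E])
  have complete: mcomplete using B by (simp add: banach_space_iff)
  define A where "A = (\<lambda>n::nat. {x \<in> cset E. p x \<le> n})"
  have "\<exists>n. mtopology interior_of (mtopology closure_of A n) \<noteq> {}"
  proof (rule ccontr)
    assume "\<not> ?thesis"
    then have "mtopology interior_of \<Union>(range (\<lambda>n. mtopology closure_of A n)) = {}"
      by (intro metric_Baire_category_alt[OF complete]) auto
    moreover have "\<Union>(range (\<lambda>n. mtopology closure_of A n)) = cset E"
    proof
      show "\<Union>(range (\<lambda>n. mtopology closure_of A n)) \<subseteq> cset E"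
        using closure_of_subset_topspace by fastforce
      have "x \<in> (\<Union>n. mtopology closure_of A n)" if "x \<in> cset E" for x
      proof -
        obtain n where "p x \<le> real n" using real_arch_simple by blast
        then have "x \<in> A n" using that by (simp add: A_def)
        moreover have "A n \<subseteq> mtopology closure_of A n"
          by (rule closure_of_subset) (auto simp: A_def)
        ultimately show ?thesis by blast
      qed
      then show "cset E \<subseteq> \<Union>(range (\<lambda>n. mtopology closure_of A n))" by blast
    qed
    moreover have "mtopology interior_of (cset E) = cset E"
      using interior_of_topspace[of mtopology] by simp
    ultimately show False using normed_zero[OF E] by auto
  qed
  then obtain n x0 e where e: "e > 0" and x0: "x0 \<in> cset E"
    and ball: "mball x0 e \<subseteq> mtopology closure_of A n"
    by (auto simp: in_interior_of_mball)
  have near: "\<exists>a\<in>cset E. p a \<le> n \<and> nrm E (y - a) < d"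
    if y: "y \<in> cset E" "nrm E y < e" and d: "d > 0" for y d
  proof -
    have ap: "\<exists>a\<in>cset E. p a \<le> n \<and> nrm E (x0 + z - a) < d" if z: "z \<in> cset E" "nrm E z < e" for z
    proof -
      have "x0 + z \<in> mball x0 e" using z x0 normed_add[OF E x0 z(1)] by (simp add: nrm_neg[OF E])
      then have "x0 + z \<in> mtopology closure_of A n" using ball by blast
      then show ?thesis using d unfolding metric_closure_of A_def by auto
    qed
    obtain a where a: "a \<in> cset E" "p a \<le> n" "nrm E (x0 + y - a) < d" using ap[OF y] by blast
    obtain b where b: "b \<in> cset E" "p b \<le> n" "nrm E (x0 + (- y) - b) < d"
      using ap[of "- y"] y normed_neg[OF E] by (auto simp: nrm_neg[OF E])
    have nb: "- b \<in> cset E" using b normed_neg[OF E] by blast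
    have "- b = rscale (-1) b" by simp
    then have pb: "p (- b) = p b" using hom[OF b(1), of "-1"] by simp
    have ab: "a - b \<in> cset E" using a b normed_diff[OF E] by blast
    \<comment> \<open>\<open>y\<close> is the midpoint of \<open>x0 + y\<close> and \<open>- (x0 - y)\<close>, so half of \<open>a - b\<close> approximates it.\<close>
    have half: "p (rscale (1/2) (a - b)) \<le> n"
      using hom[OF ab, of "1/2"] tri[OF a(1) nb] pb a(2) b(2) by simp
    have "y - rscale (1/2) (a - b) = rscale (1/2) ((x0 + y - a) - (x0 + (- y) - b))"
    proof -
      have "(x0 + y - a) - (x0 + (- y) - b) = (y + y) - (a - b)" by (simp add: algebra_simps)
      also have "rscale (1/2) \<dots> = rscale (1/2) (y + y) - rscale (1/2) (a - b)"
        by (rule scale_right_diff_distrib)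
      also have "rscale (1/2) (y + y) = smul (of_real (1/2) + of_real (1/2)) y"
        by (simp only: scale_right_distrib scale_left_distrib)
      also have "\<dots> = y" by (simp flip: of_real_add)
      finally show ?thesis by simp
    qed
    moreover have c1: "x0 + y - a \<in> cset E" and c2: "x0 + (- y) - b \<in> cset E"
      using a b y x0 by (auto intro!: normed_diff[OF E] normed_add[OF E] normed_neg[OF E] simp del: add_uminus_conv_diff)
    moreover have "nrm E ((x0 + y - a) - (x0 + (- y) - b)) < 2 * d"
      using nrm_triangle_diff[OF E c1 c2] a(3) b(3) by linarith
    ultimately have "nrm E (y - rscale (1/2) (a - b)) < d"
      using nrm_scale[OF E normed_diff[OF E c1 c2], of "of_real (1/2)"] by (simp only: norm_of_real)
    then show ?thesis using half normed_scale[OF E ab] by blast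
  qed
  \<comment> \<open>Vectors are scaled to length \<open>e / 2\<close>, inside the ball where \<open>p \<le> n\<close> can be reached.\<close>
  define C where "C = 2 * n / e"
  have C: "C \<ge> 0" using e by (simp add: C_def)
  have step: "\<exists>x. (x \<in> cset E \<and> p x \<le> C * nrm E r) \<and> r - x \<in> cset E \<and> nrm E (r - x) \<le> nrm E r / 2"
    if r: "r \<in> cset E" for r
  proof (cases "r = 0")
    case True
    have "rscale 0 0 = 0" by simp
    then have "p 0 = 0" using hom[OF normed_zero[OF E], of 0] by simp
    then show ?thesis using True normed_zero[OF E] by (intro exI[of _ 0]) (auto simp: nrm_zero[OF E])
  next
    case False
    have pos: "nrm E r > 0" by (rule nrm_pos[OF E r False])
    define t where "t = e / (2 * nrm E r)"
    have t: "t > 0" using pos e by (simp add: t_def)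
    have "nrm E (rscale t r) = e / 2"
      using t pos e nrm_scale[OF E r, of "of_real t"] by (simp add: norm_of_real) (simp add: t_def)
    then have "nrm E (rscale t r) < e" using e by simp
    then obtain a where a: "a \<in> cset E" "p a \<le> n" "nrm E (rscale t r - a) < e / 4"
      using near[OF normed_scale[OF E r], of "of_real t" "e / 4"] e by auto
    have p: "p (rscale (1/t) a) \<le> C * nrm E r"
    proof -
      have "p (rscale (1/t) a) = p a / t" using hom[OF a(1), of "1/t"] t by simp
      also have "\<dots> \<le> n / t" using a t by (simp add: divide_right_mono)
      also have "\<dots> = C * nrm E r" using pos e by (simp add: t_def C_def field_simps)
      finally show ?thesis .
    qed
    have "r - rscale (1/t) a = rscale (1/t) (rscale t r - a)"
      using t by (simp add: scale_right_diff_distrib flip: of_real_mult)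
    moreover have "rscale t r - a \<in> cset E" using a r normed_diff[OF E] normed_scale[OF E] by blast
    ultimately have "nrm E (r - rscale (1/t) a) = nrm E (rscale t r - a) / t"
      using t by (simp add: nrm_scale[OF E] norm_divide)
    also have "\<dots> \<le> (e / 4) / t" using a t by (intro divide_right_mono) auto
    also have "\<dots> = nrm E r / 2" using pos e by (simp add: t_def)
    finally show ?thesis using p normed_scale[OF E a(1), of "of_real (1/t)"] normed_diff[OF E r] by blast
  qed
  have "p y \<le> (2 * C) * nrm E y" if y: "y \<in> cset E" for y
  proof -
    obtain x r where x: "\<And>n. x n \<in> cset E \<and> p (x n) \<le> C * nrm E (r n)"
      and r: "\<And>n. r n \<in> cset E" "\<And>n. nrm E (r n) \<le> nrm E y * (1/2) ^ n"
      and sum: "\<And>n. (\<Sum>k<n. x k) = y - r n"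
      using successive_approximation[OF E y, of "\<lambda>x r. x \<in> cset E \<and> p x \<le> C * nrm E r", OF step] by blast
    have "p (x n) \<le> (C * nrm E y) * (1/2) ^ n" for n
      using x[of n] mult_left_mono[OF r(2)[of n] C] by (simp add: mult.assoc)
    then have s: "summable (\<lambda>n. p (x n))" "(\<Sum>n. p (x n)) \<le> 2 * (C * nrm E y)"
      using summable_geometric_bound[of "\<lambda>n. p (x n)", OF assms(2)] x by blast+
    have "nsums E x y" unfolding sum by (rule geometric_remainder_nlim[OF E y r])
    then have "p y \<le> (\<Sum>n. p (x n))" using sub x s by blast
    with s show ?thesis by simp
  qed
  then show ?thesis using C by (intro exI[of _ "2 * C"]) auto
qed

end

text \<open>
The graph of \<open>A\<close> is closed because \<open>A\<close> is continuous into the coarser space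
\<open>S\<close>. This makes the norm of \<open>A x\<close> countably subadditive: the images of a
convergent series, once absolutely summable in \<open>F\<close>, converge there, and comparison in
\<open>S\<close> identifies their sum. The two scalar fields may differ, so that a real space of
coefficient sequences can be mapped into a complex space.
\<close>

lemma closed_graph:
  fixes smulE :: "'k::real_or_complex \<Rightarrow> 'a::ab_group_add \<Rightarrow> 'a"
    and smulF :: "'l::real_or_complex \<Rightarrow> 'b::ab_group_add \<Rightarrow> 'b"
  assumes "vector_space smulE" and "vector_space smulF"
    and BE: "banach_space smulE E" and BF: "banach_space smulF F" and S: "normed_space smulF S"
    and FS: "bounded_inclusion F S"
    and A: "\<And>x. x \<in> cset E \<Longrightarrow> A x \<in> cset F"
    and add: "\<And>x y. x \<in> cset E \<Longrightarrow> y \<in> cset E \<Longrightarrow> A (x + y) = A x + A y"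
    and hom: "\<And>r x. x \<in> cset E \<Longrightarrow> A (smulE (of_real r) x) = smulF (of_real r) (A x)"
    and cont: "\<And>x. x \<in> cset E \<Longrightarrow> nrm S (A x) \<le> D * nrm E x"
  shows "\<exists>C\<ge>0. \<forall>x\<in>cset E. nrm F (A x) \<le> C * nrm E x"
proof -
  interpret E: scalar_space smulE by (rule scalar_space.intro) (rule assms(1))
  interpret F: scalar_space smulF by (rule scalar_space.intro) (rule assms(2))
  have nE: "normed_space smulE E" and nF: "normed_space smulF F"
    using BE BF by (auto intro: banach_imp_normed)
  show ?thesis
  proof (rule E.zabreiko[OF BE, where p="\<lambda>x. nrm F (A x)"])
    fix g l assume g: "\<And>n. g n \<in> cset E" and l: "nsums E g l"
      and s: "summable (\<lambda>n. nrm F (A (g n)))"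
    obtain m where m: "nsums F (\<lambda>n. A (g n)) m" "nrm F m \<le> (\<Sum>n. nrm F (A (g n)))"
      using F.banach_nsums[OF BF A[OF g] s] by blast
    have A0: "A 0 = 0" using add[OF E.normed_zero[OF nE] E.normed_zero[OF nE]] by simp
    have sumE: "(\<Sum>n<N. g n) \<in> cset E" for N by (rule E.normed_sum[OF nE g])
    have Asum: "A (\<Sum>n<N. g n) = (\<Sum>n<N. A (g n))" for N
      by (induction N) (auto simp: A0 add sumE g)
    have lE: "l \<in> cset E" using l by (simp add: nlim_def)
    have diff: "A (x - l) = A x - A l" if "x \<in> cset E" for x
      using add[OF E.normed_diff[OF nE that lE] lE] unfolding eq_diff_eq diff_add_cancel by (rule sym)
    have "nlim S (\<lambda>N. \<Sum>n<N. A (g n)) (A l)"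
      unfolding nlim_def
    proof (intro conjI)
      show "range (\<lambda>N. \<Sum>n<N. A (g n)) \<subseteq> cset S" "A l \<in> cset S"
        using A[OF sumE, unfolded Asum] A[OF lE] FS unfolding bounded_inclusion_def by blast+
      show "(\<lambda>N. nrm S ((\<Sum>n<N. A (g n)) - A l)) \<longlonglongrightarrow> 0"
      proof (rule tendsto_sandwich[where f="\<lambda>_. 0" and h="\<lambda>N. D * nrm E ((\<Sum>n<N. g n) - l)"])
        show "\<forall>\<^sub>F N in sequentially. nrm S ((\<Sum>n<N. A (g n)) - A l) \<le> D * nrm E ((\<Sum>n<N. g n) - l)"
          using cont[OF E.normed_diff[OF nE sumE lE]] by (simp add: diff[OF sumE] Asum)
        show "(\<lambda>N. D * nrm E ((\<Sum>n<N. g n) - l)) \<longlonglongrightarrow> 0"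
          using l by (auto simp: nlim_def intro: tendsto_mult_right_zero)
      qed (auto simp: F.nrm_nonneg[OF S])
    qed
    moreover have "nlim S (\<lambda>N. \<Sum>n<N. A (g n)) m" using F.nlim_mono[OF nF S FS m(1)] .
    ultimately have "A l = m" using F.nlim_unique[OF S] by blast
    then show "nrm F (A l) \<le> (\<Sum>n. nrm F (A (g n)))" using m by simp
  next
    show "nrm F (A (x + y)) \<le> nrm F (A x) + nrm F (A y)" if "x \<in> cset E" "y \<in> cset E" for x y
      using F.nrm_triangle[OF nF A[OF that(1)] A[OF that(2)]] by (simp add: add[OF that])
    show "nrm F (A (E.rscale r x)) = \<bar>r\<bar> * nrm F (A x)" if "x \<in> cset E" for r x
      using F.nrm_scale[OF nF A[OF that], of "of_real r"] by (simp add: hom[OF that])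
  qed (rule F.nrm_nonneg[OF nF])
qed

context scalar_space
begin

lemma subset_imp_bounded_inclusion:
  assumes "banach_space smul E" "banach_space smul F" "normed_space smul S"
    and ES: "bounded_inclusion E S" and FS: "bounded_inclusion F S" and sub: "cset E \<subseteq> cset F"
  shows "bounded_inclusion E F"
proof -
  obtain D where D: "\<forall>x\<in>cset E. nrm S x \<le> D * nrm E x" using ES by (auto simp: bounded_inclusion_def)
  have "\<exists>C\<ge>0. \<forall>x\<in>cset E. nrm F x \<le> C * nrm E x"
    by (rule closed_graph[OF vector_space_axioms vector_space_axioms assms(1-3) FS, where D=D])
      (use sub D in auto)
  then show ?thesis using sub by (auto simp: bounded_inclusion_def)
qed

end

section \<open>The Hahn-Banach theorem\<close>

text \<open>
An isometric embedding of the scalars into the complex numbers fixes the rational numbers, and by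
isometry and density it fixes the real numbers. What remains is to name a square root of -1 when the
embedding is onto.
\<close>

lemma scalar_dichotomy:
  "(\<forall>c::'k::real_or_complex. \<exists>r. c = of_real r) \<or>
   (\<exists>i::'k. i * i = -1 \<and> (\<forall>c. \<exists>r s. c = of_real r + of_real s * i) \<and>
      (\<forall>r s. \<bar>r\<bar> \<le> norm (of_real r + of_real s * i)))"
proof -
  obtain \<phi> :: "'k \<Rightarrow> complex" where inj: "inj \<phi>" and ran: "range \<phi> = \<real> \<or> range \<phi> = UNIV"
    and add: "\<And>a b. \<phi> (a + b) = \<phi> a + \<phi> b" and mult: "\<And>a b. \<phi> (a * b) = \<phi> a * \<phi> b"
    and nrm: "\<And>a. norm (\<phi> a) = norm a"
    using real_or_complex[where 'a='k] by blast
  have zero: "\<phi> 0 = 0" using nrm[of 0] by simp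
  have neg: "\<phi> (- a) = - \<phi> a" for a using add[of "-a" a] zero by (simp add: eq_neg_iff_add_eq_0)
  have diff: "\<phi> (a - b) = \<phi> a - \<phi> b" for a b using add[of a "-b"] neg[of b] by simp
  have one: "\<phi> 1 = 1"
  proof -
    have "\<phi> 1 \<noteq> 0" using nrm[of 1] by auto
    then show ?thesis using mult[of 1 1] by simp
  qed
  have nat: "\<phi> (of_nat n) = of_nat n" for n by (induction n) (auto simp: zero one add)
  have int: "\<phi> (of_int n) = of_int n" for n
    by (cases n rule: int_cases2) (auto simp: nat neg)
  have quot: "\<phi> (of_real (of_int a / of_int b)) = of_real (of_int a / of_int b)" if "b \<noteq> 0" for a b
  proof -
    have "\<phi> (of_real (of_int a / of_int b)) * \<phi> (of_int b) = \<phi> (of_int a)"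
      using that by (simp flip: mult)
    then show ?thesis using that by (simp add: int field_simps)
  qed
  have of_real: "\<phi> (of_real r) = of_real r" for r
  proof (rule ccontr)
    assume ne: "\<phi> (of_real r) \<noteq> of_real r"
    define e where "e = norm (\<phi> (of_real r) - of_real r) / 2"
    have e: "e > 0" using ne by (simp add: e_def)
    obtain q where q: "q \<in> \<rat>" "r < q" "q < r + e" using Rats_dense_in_real[of r "r + e"] e by auto
    obtain a b where ab: "b \<noteq> 0" "q = of_int a / of_int b"
      using q(1) by (metis Rats_cases' less_numeral_extra(3))
    have "\<phi> (of_real r) - of_real r = \<phi> (of_real (r - q)) - of_real (r - q)"
      using quot[OF ab(1)] by (simp add: diff ab)
    then have "norm (\<phi> (of_real r) - of_real r) \<le> norm (of_real (r - q) :: 'k) + norm (of_real (r - q) :: complex)"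
      by (metis norm_triangle_ineq4 nrm)
    also have "\<dots> < 2 * e" using q by (simp only: norm_of_real)
    finally show False by (simp add: e_def)
  qed
  show ?thesis
  proof (cases "range \<phi> = \<real>")
    case True
    have "\<exists>r. c = of_real r" for c :: 'k
    proof -
      have "\<phi> c \<in> \<real>" using True by blast
      then obtain r where "\<phi> c = of_real r" by (auto elim: Reals_cases)
      then show ?thesis using inj of_real[of r] by (metis injD)
    qed
    then show ?thesis by blast
  next
    case False
    then have surj: "range \<phi> = UNIV" using ran by blast
    then obtain i where i: "\<phi> i = \<i>" by (metis surj_def)
    have "\<phi> (i * i) = \<phi> (-1)" by (simp add: mult i neg one)
    then have "i * i = -1" using inj by (metis injD)
    moreover have val: "\<phi> (of_real r + of_real s * i) = Complex r s" for r s
      by (simp add: add mult of_real i complex_eq_iff)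
    moreover have "\<exists>r s. c = of_real r + of_real s * i" for c :: 'k
    proof -
      have "\<phi> c = \<phi> (of_real (Re (\<phi> c)) + of_real (Im (\<phi> c)) * i)" by (simp add: val)
      then show ?thesis using inj by (metis injD)
    qed
    moreover have "\<bar>r\<bar> \<le> norm (of_real r + of_real s * i)" for r s
      using abs_Re_le_cmod[of "Complex r s"] nrm[of "of_real r + of_real s * i"] by (simp add: val)
    ultimately show ?thesis by blast
  qed
qed

context scalar_space
begin

text \<open>
The value 0 outside \<open>S\<close> makes the pointwise order antisymmetric, as required for Zorn's
lemma.
\<close>

definition sublinear :: "'a set \<Rightarrow> ('a \<Rightarrow> real) \<Rightarrow> bool" where
  "sublinear S q \<longleftrightarrow> (\<forall>x\<in>S. \<forall>y\<in>S. q (x + y) \<le> q x + q y) \<and>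
     (\<forall>x\<in>S. \<forall>r\<ge>0. q (rscale r x) = r * q x) \<and> (\<forall>x. x \<notin> S \<longrightarrow> q x = 0)"

lemma sublinear_add: "sublinear S q \<Longrightarrow> x \<in> S \<Longrightarrow> y \<in> S \<Longrightarrow> q (x + y) \<le> q x + q y"
  and sublinear_scale: "sublinear S q \<Longrightarrow> x \<in> S \<Longrightarrow> r \<ge> 0 \<Longrightarrow> q (rscale r x) = r * q x"
  and sublinear_outside: "sublinear S q \<Longrightarrow> x \<notin> S \<Longrightarrow> q x = 0"
  by (auto simp: sublinear_def)

lemma sublinear_zero: "subspace S \<Longrightarrow> sublinear S q \<Longrightarrow> q 0 = 0"
  using sublinear_scale[of S q 0 0] by (simp add: subspace_0)

lemma sublinear_neg: "subspace S \<Longrightarrow> sublinear S q \<Longrightarrow> x \<in> S \<Longrightarrow> - q (- x) \<le> q x"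
  using sublinear_add[of S q x "- x"] sublinear_zero[of S q] subspace_neg[of S x] by simp

text \<open>
The functional is the infimum of \<open>q (x + t y) - t q(y)\<close> over
\<open>t \<ge> 0\<close>. At \<open>x = - y\<close> and \<open>t = 1\<close> the bound reads
\<open>q'(- y) \<le> - q(y)\<close>: a sublinear functional that cannot be lowered further is odd,
and \<open>t = 1\<close> also makes it superadditive.
\<close>

lemma sublinear_descent:
  assumes S: "subspace S" and q: "sublinear S q" and y: "y \<in> S"
  shows "\<exists>q'. sublinear S q' \<and> (\<forall>x\<in>S. \<forall>t\<ge>0. q' x \<le> q (x + rscale t y) - t * q y)"
proof -
  define V where "V x t = q (x + rscale t y) - t * q y" for x t
  define q' where "q' x = (if x \<in> S then INF t\<in>{0..}. V x t else 0)" for x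
  have ty: "rscale t y \<in> S" for t using S y by (rule subspace_scale)
  have lower: "- q (- x) \<le> V x t" if x: "x \<in> S" and t: "t \<ge> 0" for x t
  proof -
    have "t * q y = q ((x + rscale t y) + (- x))" using sublinear_scale[OF q y t] by simp
    also have "\<dots> \<le> q (x + rscale t y) + q (- x)"
      using S x ty by (intro sublinear_add[OF q] subspace_add subspace_neg)
    finally show ?thesis by (simp add: V_def)
  qed
  have bdd: "bdd_below (V x ` {0..})" if "x \<in> S" for x
    using lower[OF that] by (intro bdd_belowI[of _ "- q (- x)"]) auto
  have le: "q' x \<le> V x t" if "x \<in> S" "t \<ge> 0" for x t
    using bdd[OF that(1)] that by (auto simp: q'_def intro: cINF_lower)
  have greatest: "m \<le> q' x" if "x \<in> S" "\<And>t. t \<ge> 0 \<Longrightarrow> m \<le> V x t" for x m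
    using that by (auto simp: q'_def intro!: cINF_greatest)
  have add: "q' (x + z) \<le> q' x + q' z" if x: "x \<in> S" and z: "z \<in> S" for x z
  proof -
    have xz: "x + z \<in> S" using S x z by (rule subspace_add)
    have VV: "q' (x + z) - V z t \<le> V x s" if s: "s \<ge> 0" and t: "t \<ge> 0" for s t
    proof -
      have "q' (x + z) \<le> V (x + z) (s + t)" using xz s t by (intro le) auto
      also have "(x + z) + rscale (s + t) y = (x + rscale s y) + (z + rscale t y)"
        by (simp add: scale_left_distrib)
      then have "V (x + z) (s + t) \<le> V x s + V z t"
        using sublinear_add[OF q subspace_add[OF S x ty] subspace_add[OF S z ty], of s t]
        by (simp add: V_def algebra_simps)
      finally show ?thesis by simp
    qed
    have "q' (x + z) - q' x \<le> V z t" if t: "t \<ge> 0" for t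
      using greatest[OF x VV[OF _ t]] by linarith
    from greatest[OF z this] show ?thesis by linarith
  qed
  have scale_le: "q' (rscale r x) \<le> r * q' x" if x: "x \<in> S" and r: "r > 0" for x r
  proof -
    have rx: "rscale r x \<in> S" using S x by (rule subspace_scale)
    have "q' (rscale r x) / r \<le> V x t" if t: "t \<ge> 0" for t
    proof -
      have "q' (rscale r x) \<le> V (rscale r x) (r * t)" using rx r t by (intro le) auto
      also have "rscale r x + rscale (r * t) y = rscale r (x + rscale t y)"
        by (simp add: scale_right_distrib)
      then have "V (rscale r x) (r * t) = r * V x t"
        using sublinear_scale[OF q subspace_add[OF S x ty], of r t] r
        by (simp add: V_def algebra_simps)
      finally show ?thesis using r by (simp add: field_simps)
    qed
    from greatest[OF x this] show ?thesis using r by (simp add: field_simps)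
  qed
  have scale: "q' (rscale r x) = r * q' x" if x: "x \<in> S" and r: "r \<ge> 0" for x r
  proof (cases "r = 0")
    case True
    have "q' 0 = 0"
    proof (rule antisym)
      show "q' 0 \<le> 0" using le[OF subspace_0[OF S], of 0] sublinear_zero[OF S q] by (simp add: V_def)
      show "0 \<le> q' 0"
        using sublinear_scale[OF q y] by (intro greatest subspace_0[OF S]) (simp add: V_def)
    qed
    then show ?thesis using True by simp
  next
    case False
    then have r: "r > 0" using r by simp
    have "q' x = q' (rscale (1/r) (rscale r x))" using r by (simp flip: of_real_mult)
    also have "\<dots> \<le> (1/r) * q' (rscale r x)" using r S x by (intro scale_le subspace_scale) auto
    finally show ?thesis using scale_le[OF x r] r by (simp add: field_simps)
  qed
  have "sublinear S q'" using add scale by (auto simp: sublinear_def q'_def)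
  then show ?thesis using le unfolding V_def by blast
qed

text \<open>
A chain of sublinear functionals below \<open>p\<close> has a pointwise infimum, since all of them are
at least \<open>- p (- x)\<close> at \<open>x\<close>.
\<close>

lemma sublinear_minimal:
  assumes S: "subspace S" and p: "sublinear S p"
  shows "\<exists>q. sublinear S q \<and> (\<forall>x. q x \<le> p x) \<and>
    (\<forall>q'. sublinear S q' \<and> (\<forall>x. q' x \<le> q x) \<longrightarrow> q' = q)"
proof -
  define A where "A = {q. sublinear S q \<and> (\<forall>x. q x \<le> p x)}"
  define P where "P = (\<lambda>q q' :: 'a \<Rightarrow> real. \<forall>x. q' x \<le> q x)"
  have "\<exists>m\<in>A. \<forall>a\<in>A. P m a \<longrightarrow> a = m"
  proof (rule predicate_Zorn)
    have "refl_on A (relation_of P A)" "trans (relation_of P A)" "antisym (relation_of P A)"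
      by (auto simp: refl_on_def trans_def antisym_def relation_of_def P_def intro!: ext intro: order_trans antisym)
    then show "partial_order_on A (relation_of P A)"
      by (auto simp: partial_order_on_def preorder_on_def relation_of_def)
  next
    fix C assume C: "C \<in> Chains (relation_of P A)"
    show "\<exists>u\<in>A. \<forall>a\<in>C. P a u"
    proof (cases "C = {}")
      case True
      then show ?thesis using p by (auto simp: A_def)
    next
      case False
      have CA: "C \<subseteq> A" using C by (auto simp: Chains_def relation_of_def)
      have cmp: "P q q' \<or> P q' q" if "q \<in> C" "q' \<in> C" for q q'
        using C that by (auto simp: Chains_def relation_of_def)
      have sub: "sublinear S q" "q x \<le> p x" if "q \<in> C" for q x using CA that by (auto simp: A_def)
      define u where "u x = (INF q\<in>C. q x)" for x
      have bdd: "bdd_below ((\<lambda>q. q x) ` C)" for x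
      proof (cases "x \<in> S")
        case True
        have "- p (- x) \<le> q x" if "q \<in> C" for q
          using sublinear_neg[OF S sub(1)[OF that] True] sub(2)[OF that, of "- x"] by linarith
        then show ?thesis by (intro bdd_belowI[of _ "- p (- x)"]) auto
      next
        case False
        then show ?thesis using sub(1) sublinear_outside by (intro bdd_belowI[of _ 0]) fastforce
      qed
      have le: "u x \<le> q x" if "q \<in> C" for q x
        unfolding u_def by (rule cINF_lower[OF bdd that])
      have greatest: "m \<le> u x" if "\<And>q. q \<in> C \<Longrightarrow> m \<le> q x" for m x
        unfolding u_def by (rule cINF_greatest[OF False that])
      have "sublinear S u"
        unfolding sublinear_def
      proof (intro conjI ballI allI impI)
        fix x y assume x: "x \<in> S" and y: "y \<in> S"
        have *: "u (x + y) - q2 y \<le> q1 x" if q: "q1 \<in> C" "q2 \<in> C" for q1 q2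
        proof -
          obtain q where q: "q \<in> C" "q x \<le> q1 x" "q y \<le> q2 y"
            using cmp[OF q] q unfolding P_def by blast
          have "u (x + y) \<le> q x + q y" using le[OF q(1), of "x + y"] sublinear_add[OF sub(1)[OF q(1)] x y] by linarith
          then show ?thesis using q by linarith
        qed
        have "u (x + y) - u x \<le> q2 y" if q: "q2 \<in> C" for q2
          using greatest[of "u (x + y) - q2 y" x] *[OF _ q] by fastforce
        then show "u (x + y) \<le> u x + u y" using greatest[of "u (x + y) - u x" y] by fastforce
      next
        fix x r assume x: "x \<in> S" and r: "r \<ge> (0::real)"
        have sc: "q (rscale r x) = r * q x" if "q \<in> C" for q
          using sublinear_scale[OF sub(1)[OF that] x r] .
        show "u (rscale r x) = r * u x"
        proof (cases "r = 0")
          case True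
          have "u 0 = 0"
            using le greatest False sublinear_zero[OF S sub(1)] by (metis antisym ex_in_conv order_refl)
          then show ?thesis using True by simp
        next
          case False
          then have r: "r > 0" using r by simp
          have "u (rscale r x) / r \<le> q x" if "q \<in> C" for q
            using le[OF that, of "rscale r x"] sc[OF that] r by (simp add: field_simps)
          then have "u (rscale r x) / r \<le> u x" by (rule greatest)
          moreover have "r * u x \<le> q (rscale r x)" if "q \<in> C" for q
            using le[OF that, of x] sc[OF that] r by simp
          then have "r * u x \<le> u (rscale r x)" by (rule greatest)
          ultimately show ?thesis using r by (simp add: field_simps)
        qed
      next
        fix x assume "x \<notin> S"
        then show "u x = 0"
          using le greatest False sublinear_outside[OF sub(1)] by (metis antisym ex_in_conv order_refl)
      qed
      moreover have "u x \<le> p x" for x using False le sub(2) order_trans by blast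
      ultimately show ?thesis using le by (auto simp: A_def P_def)
    qed
  qed
  then obtain m where "m \<in> A" "\<And>a. a \<in> A \<Longrightarrow> P m a \<Longrightarrow> a = m" by blast
  then show ?thesis unfolding A_def P_def by (intro exI[of _ m]) (auto intro: order_trans)
qed

text \<open>
A minimal sublinear functional is linear. Descending once in the direction \<open>a\<close> before
minimising gives the value at most \<open>- p a\<close> at \<open>- a\<close>, hence
\<open>p a\<close> at \<open>a\<close>.
\<close>

lemma real_hahn_banach:
  assumes S: "subspace S" and a: "a \<in> S"
    and add: "\<And>x y. x \<in> S \<Longrightarrow> y \<in> S \<Longrightarrow> p (x + y) \<le> p x + p y"
    and hom: "\<And>r x. x \<in> S \<Longrightarrow> r \<ge> 0 \<Longrightarrow> p (rscale r x) = r * p x"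
  shows "\<exists>u. (\<forall>x\<in>S. \<forall>y\<in>S. u (x + y) = u x + u y) \<and>
    (\<forall>r. \<forall>x\<in>S. u (rscale r x) = r * u x) \<and> (\<forall>x\<in>S. u x \<le> p x) \<and> u a = p a"
proof -
  define p' where "p' x = (if x \<in> S then p x else 0)" for x
  have p': "sublinear S p'"
    using add hom S by (auto simp: sublinear_def p'_def subspace_add subspace_scale)
  obtain p1 where p1: "sublinear S p1"
    and p1_le: "\<And>x t. x \<in> S \<Longrightarrow> t \<ge> 0 \<Longrightarrow> p1 x \<le> p' (x + rscale t a) - t * p' a"
    using sublinear_descent[OF S p' a] by blast
  obtain u where u: "sublinear S u" and u_le: "\<And>x. u x \<le> p1 x"
    and minimal: "\<And>q. sublinear S q \<Longrightarrow> (\<And>x. q x \<le> u x) \<Longrightarrow> q = u"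
    using sublinear_minimal[OF S p1] by blast
  have super: "u x + u y \<le> u (x + y) \<and> u (- y) \<le> - u y" if x: "x \<in> S" and y: "y \<in> S" for x y
  proof -
    obtain q where q: "sublinear S q"
      and q_le: "\<And>x t. x \<in> S \<Longrightarrow> t \<ge> 0 \<Longrightarrow> q x \<le> u (x + rscale t y) - t * u y"
      using sublinear_descent[OF S u y] by blast
    have "q z \<le> u z" for z
      using q_le[of z 0] sublinear_outside[OF q, of z] sublinear_outside[OF u, of z] by (cases "z \<in> S") auto
    then have "q = u" by (rule minimal[OF q])
    then show ?thesis
      using q_le[OF x, of 1] q_le[OF subspace_neg[OF S y], of 1] sublinear_zero[OF S u] by simp
  qed
  have uadd: "u (x + y) = u x + u y" if "x \<in> S" "y \<in> S" for x y
    using super[OF that] sublinear_add[OF u that] by linarith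
  have neg: "u (- y) = - u y" if "y \<in> S" for y
    using super[OF that that] sublinear_neg[OF S u that] by linarith
  have uhom: "u (rscale r x) = r * u x" if x: "x \<in> S" for r x
  proof (cases "r \<ge> 0")
    case True
    then show ?thesis using sublinear_scale[OF u x] by blast
  next
    case False
    then have "u (rscale (- r) x) = (- r) * u x" using sublinear_scale[OF u x, of "- r"] by simp
    then show ?thesis using neg[OF subspace_scale[OF S x, of "of_real r"]] by simp
  qed
  have le: "u x \<le> p x" if "x \<in> S" for x
    using u_le[of x] p1_le[OF that, of 0] that by (simp add: p'_def)
  have "u (- a) \<le> - p a"
    using u_le[of "- a"] p1_le[OF subspace_neg[OF S a], of 1] sublinear_zero[OF S p'] a by (simp add: p'_def)
  then have "u a = p a" using neg[OF a] le[OF a] by linarith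
  then show ?thesis using uadd uhom le by blast
qed

definition functional :: "'a set \<Rightarrow> ('a \<Rightarrow> 'k) \<Rightarrow> bool" where
  "functional S f \<longleftrightarrow> (\<forall>x\<in>S. \<forall>y\<in>S. f (x + y) = f x + f y) \<and> (\<forall>c. \<forall>x\<in>S. f (smul c x) = c * f x)"

text \<open>
Over the complex numbers the functional is \<open>f(x) = u(x) - i u(i x)\<close>, where
\<open>u\<close> is its real part. Rotating \<open>x\<close> so that \<open>f(x)\<close> becomes a
nonnegative real number transfers the bound from \<open>u\<close> to \<open>f\<close>.
\<close>

lemma hahn_banach:
  assumes S: "subspace S" and a: "a \<in> S"
    and add: "\<And>x y. x \<in> S \<Longrightarrow> y \<in> S \<Longrightarrow> p (x + y) \<le> p x + p y"
    and hom: "\<And>c x. x \<in> S \<Longrightarrow> p (smul c x) = norm c * p x"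
  shows "\<exists>f. functional S f \<and> (\<forall>x\<in>S. norm (f x) \<le> p x) \<and> p a \<le> norm (f a)"
proof -
  obtain u where uadd: "\<And>x y. x \<in> S \<Longrightarrow> y \<in> S \<Longrightarrow> u (x + y) = u x + u y"
    and uhom: "\<And>r x. x \<in> S \<Longrightarrow> u (rscale r x) = r * u x"
    and ule: "\<And>x. x \<in> S \<Longrightarrow> u x \<le> p x" and ua: "u a = p a"
    using real_hahn_banach[OF S a add, of] hom by (smt (verit) norm_of_real abs_of_nonneg)
  have sc: "smul c x \<in> S" if "x \<in> S" for c x using S that by (rule subspace_scale)
  from scalar_dichotomy[where 'k='k] show ?thesis
  proof (elim disjE exE conjE)
    assume r: "\<forall>c::'k. \<exists>r. c = of_real r"
    have "functional S (\<lambda>x. of_real (u x))"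
      unfolding functional_def
    proof (intro conjI ballI allI)
      fix c :: 'k and x assume x: "x \<in> S"
      obtain r where "c = of_real r" using r by blast
      then show "of_real (u (smul c x)) = c * of_real (u x)" using uhom[OF x] by simp
    qed (simp add: uadd)
    moreover have "norm (of_real (u x) :: 'k) \<le> p x" if x: "x \<in> S" for x
      using ule[OF x] ule[OF sc[OF x, of "-1"]] hom[OF x, of "-1"] uhom[OF x, of "-1"] by simp
    ultimately show ?thesis using ua by (intro exI[of _ "\<lambda>x. of_real (u x)"]) auto
  next
    fix i :: 'k
    assume ii: "i * i = -1" and dec: "\<forall>c. \<exists>r s. c = of_real r + of_real s * i"
      and re: "\<forall>r s. \<bar>r\<bar> \<le> norm (of_real r + of_real s * i)"
    define f where "f x = of_real (u x) - of_real (u (smul i x)) * i" for x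
    have fadd: "f (x + y) = f x + f y" if "x \<in> S" "y \<in> S" for x y
      using uadd[OF that] uadd[OF sc[OF that(1)] sc[OF that(2)]]
      by (simp add: f_def scale_right_distrib algebra_simps)
    have freal: "f (rscale r x) = of_real r * f x" if x: "x \<in> S" for r x
    proof -
      have "smul i (rscale r x) = rscale r (smul i x)" by (simp add: mult.commute)
      then show ?thesis using uhom[OF x] uhom[OF sc[OF x]] by (simp add: f_def algebra_simps)
    qed
    have fi: "f (smul i x) = i * f x" if x: "x \<in> S" for x
    proof -
      have "smul i (smul i x) = rscale (-1) x" by (simp add: ii)
      then have "f (smul i x) = of_real (u (smul i x)) + of_real (u x) * i"
        using uhom[OF x, of "-1"] by (simp add: f_def)
      also have "\<dots> = i * f x"
        using ii by (simp add: f_def algebra_simps) (simp add: mult.assoc[symmetric])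
      finally show ?thesis .
    qed
    have fhom: "f (smul c x) = c * f x" if x: "x \<in> S" for c x
    proof -
      obtain r s where c: "c = of_real r + of_real s * i" using dec by blast
      have "smul c x = rscale r x + rscale s (smul i x)" by (simp add: c scale_left_distrib)
      then have "f (smul c x) = of_real r * f x + of_real s * (i * f x)"
        using fadd[OF sc[OF x] sc[OF sc[OF x]]] freal[OF x] freal[OF sc[OF x]] fi[OF x] by simp
      then show ?thesis by (simp add: c algebra_simps)
    qed
    have "norm (f x) \<le> p x" if x: "x \<in> S" for x
    proof (cases "f x = 0")
      case True
      then show ?thesis using ule[OF x] ule[OF sc[OF x, of "-1"]] hom[OF x, of "-1"] uhom[OF x, of "-1"] by simp
    next
      case False
      define c where "c = of_real (norm (f x)) / f x"
      have nc: "norm c = 1" using False by (simp add: c_def norm_divide)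
      have "f (smul c x) = of_real (norm (f x))" using False by (simp add: fhom[OF x] c_def)
      then have "of_real (u (smul c x)) - of_real (u (smul i (smul c x))) * i = of_real (norm (f x))"
        by (simp only: f_def[of "smul c x"])
      then have "of_real (norm (f x) - u (smul c x)) + of_real (u (smul i (smul c x))) * i = 0"
        unfolding of_real_diff by (simp only: diff_eq_eq) (simp only: add_diff_cancel_left' diff_add_eq diff_self)
      then have "\<bar>norm (f x) - u (smul c x)\<bar> \<le> 0" using re by (metis norm_zero)
      then show ?thesis using ule[OF sc[OF x, of c]] hom[OF x, of c] nc by simp
    qed
    moreover have "p a \<le> norm (f a)"
      using re[rule_format, of "u a" "- u (smul i a)"] ua by (simp add: f_def)
    ultimately show ?thesis using fadd fhom unfolding functional_def by blast
  qed
qed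

end

section \<open>Sums of two spaces and their functionals\<close>

text \<open>
With weights 1 and 1 this is the norm of \<open>X + Y\<close>, and with general weights it is Peetre's
K-functional up to scaling. Weights 1 and 0 give the distance to \<open>X \<inter> Y\<close> in the
norm of \<open>X\<close>, for elements of \<open>X\<close>.
\<close>

definition split_norm :: "'a::ab_group_add nspace \<Rightarrow> 'a nspace \<Rightarrow> real \<Rightarrow> real \<Rightarrow> 'a \<Rightarrow> real" where
  "split_norm X Y s t z =
     Inf {s * nrm X x + t * nrm Y y |x y. x \<in> cset X \<and> y \<in> cset Y \<and> z = x + y}"

lemma cset_sum_space: "cset (sum_space X Y) = {x + y |x y. x \<in> cset X \<and> y \<in> cset Y}"
  by (simp add: sum_space_def Let_def)

lemma nrm_sum_space: "z \<in> cset (sum_space X Y) \<Longrightarrow> nrm (sum_space X Y) z = split_norm X Y 1 1 z"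
  by (auto simp: sum_space_def Let_def split_norm_def)

lemma nrm_sum_space_outside: "z \<notin> cset (sum_space X Y) \<Longrightarrow> nrm (sum_space X Y) z = 0"
  by (auto simp: sum_space_def Let_def)

lemma sum_space_commute: "sum_space X Y = sum_space Y X"
proof -
  have carrier: "cset (sum_space X Y) = cset (sum_space Y X)"
    unfolding cset_sum_space by (intro Collect_cong, subst ex_comm) (simp add: ac_simps)
  have "split_norm X Y 1 1 z = split_norm Y X 1 1 z" for z
    unfolding split_norm_def by (intro arg_cong[of _ _ Inf] Collect_cong, subst ex_comm) (simp add: ac_simps)
  then have "nrm (sum_space X Y) z = nrm (sum_space Y X) z" for z
    using carrier nrm_sum_space[of z] nrm_sum_space_outside[of z] by (cases "z \<in> cset (sum_space X Y)") auto
  then show ?thesis using carrier by (intro nspace.equality ext) auto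
qed

lemma inter_space_commute: "inter_space X Y = inter_space Y X"
  by (auto simp: inter_space_def fun_eq_iff max.commute Int_commute)

lemma sum_spaceI: "x \<in> cset X \<Longrightarrow> y \<in> cset Y \<Longrightarrow> x + y \<in> cset (sum_space X Y)"
  by (auto simp: cset_sum_space)

lemma sum_spaceE:
  assumes "z \<in> cset (sum_space X Y)"
  obtains x y where "x \<in> cset X" "y \<in> cset Y" "z = x + y"
  using assms by (auto simp: cset_sum_space)

definition bounded_functional :: "'a nspace \<Rightarrow> ('a \<Rightarrow> 'k::real_normed_vector) \<Rightarrow> bool" where
  "bounded_functional E f \<longleftrightarrow> (\<exists>C\<ge>0. \<forall>x\<in>cset E. norm (f x) \<le> C * nrm E x)"

definition dual_norm :: "'a nspace \<Rightarrow> ('a \<Rightarrow> 'k::real_normed_vector) \<Rightarrow> real" where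
  "dual_norm E f = (SUP x\<in>{x \<in> cset E. nrm E x \<le> 1}. norm (f x))"

context scalar_space
begin

context
  fixes X Y :: "'a nspace"
  assumes X: "normed_space smul X" and Y: "normed_space smul Y"
begin

lemma subset_sum_space: "cset X \<subseteq> cset (sum_space X Y)" "cset Y \<subseteq> cset (sum_space X Y)"
  using sum_spaceI[of _ X 0 Y] sum_spaceI[of 0 X _ Y] normed_zero[OF X] normed_zero[OF Y] by auto

lemma subspace_sum_space: "subspace (cset (sum_space X Y))"
  unfolding cset_sum_space using X Y by (intro subspace_sums) (auto simp: normed_space_def)

lemma split_norm_le:
  assumes st: "s \<ge> 0" "t \<ge> 0" and xy: "x \<in> cset X" "y \<in> cset Y"
  shows "split_norm X Y s t (x + y) \<le> s * nrm X x + t * nrm Y y"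
  unfolding split_norm_def
proof (rule cInf_lower)
  show "bdd_below {s * nrm X x' + t * nrm Y y' |x' y'. x' \<in> cset X \<and> y' \<in> cset Y \<and> x + y = x' + y'}"
    using st nrm_nonneg[OF X] nrm_nonneg[OF Y] by (intro bdd_belowI[of _ 0]) auto
qed (use xy in blast)

lemma split_norm_greatest:
  assumes z: "z \<in> cset (sum_space X Y)"
    and m: "\<And>x y. x \<in> cset X \<Longrightarrow> y \<in> cset Y \<Longrightarrow> z = x + y \<Longrightarrow> m \<le> s * nrm X x + t * nrm Y y"
  shows "m \<le> split_norm X Y s t z"
  unfolding split_norm_def using z m by (intro cInf_greatest) (auto simp: cset_sum_space)

lemma split_norm_nonneg:
  assumes st: "s \<ge> 0" "t \<ge> 0" and z: "z \<in> cset (sum_space X Y)"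
  shows "0 \<le> split_norm X Y s t z"
  using st nrm_nonneg[OF X] nrm_nonneg[OF Y] by (intro split_norm_greatest[OF z]) auto

lemma split_norm_triangle:
  assumes st: "s \<ge> 0" "t \<ge> 0" and z: "z \<in> cset (sum_space X Y)" and w: "w \<in> cset (sum_space X Y)"
  shows "split_norm X Y s t (z + w) \<le> split_norm X Y s t z + split_norm X Y s t w"
proof -
  have *: "split_norm X Y s t (z + w) - (s * nrm X x' + t * nrm Y y') \<le> s * nrm X x + t * nrm Y y"
    if xy: "x \<in> cset X" "y \<in> cset Y" "z = x + y" and xy': "x' \<in> cset X" "y' \<in> cset Y" "w = x' + y'"
    for x y x' y'
  proof -
    have "z + w = (x + x') + (y + y')" using xy xy' by (simp add: algebra_simps)
    then have "split_norm X Y s t (z + w) \<le> s * nrm X (x + x') + t * nrm Y (y + y')"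
      using split_norm_le[OF st normed_add[OF X xy(1) xy'(1)] normed_add[OF Y xy(2) xy'(2)]] by simp
    moreover have "s * nrm X (x + x') \<le> s * (nrm X x + nrm X x')"
      using st nrm_triangle[OF X xy(1) xy'(1)] by (intro mult_left_mono)
    moreover have "t * nrm Y (y + y') \<le> t * (nrm Y y + nrm Y y')"
      using st nrm_triangle[OF Y xy(2) xy'(2)] by (intro mult_left_mono)
    ultimately show ?thesis by (simp add: algebra_simps)
  qed
  have "split_norm X Y s t (z + w) - split_norm X Y s t z \<le> s * nrm X x' + t * nrm Y y'"
    if xy': "x' \<in> cset X" "y' \<in> cset Y" "w = x' + y'" for x' y'
    using split_norm_greatest[OF z *[OF _ _ _ xy']] by linarith
  from split_norm_greatest[OF w this] show ?thesis by linarith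
qed

lemma split_norm_scale:
  assumes st: "s \<ge> 0" "t \<ge> 0" and z: "z \<in> cset (sum_space X Y)"
  shows "split_norm X Y s t (smul c z) = norm c * split_norm X Y s t z"
proof -
  have le: "split_norm X Y s t (smul c z) \<le> norm c * split_norm X Y s t z"
    if z: "z \<in> cset (sum_space X Y)" and c: "c \<noteq> 0" for c z
  proof -
    have "split_norm X Y s t (smul c z) / norm c \<le> s * nrm X x + t * nrm Y y"
      if xy: "x \<in> cset X" "y \<in> cset Y" "z = x + y" for x y
    proof -
      have "split_norm X Y s t (smul c z) \<le> s * nrm X (smul c x) + t * nrm Y (smul c y)"
        using split_norm_le[OF st normed_scale[OF X xy(1), of c] normed_scale[OF Y xy(2), of c]]
        by (simp add: xy(3) scale_right_distrib)
      then show ?thesis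
        using c xy by (simp add: nrm_scale[OF X] nrm_scale[OF Y] field_simps)
    qed
    then have "split_norm X Y s t (smul c z) / norm c \<le> split_norm X Y s t z"
      by (rule split_norm_greatest[OF z])
    then show ?thesis
      using c by (simp add: pos_divide_le_eq mult.commute)
  qed
  show ?thesis
  proof (cases "c = 0")
    case True
    have "split_norm X Y s t 0 = 0"
      using split_norm_le[OF st normed_zero[OF X] normed_zero[OF Y]] nrm_zero[OF X] nrm_zero[OF Y]
        split_norm_nonneg[OF st subspace_0[OF subspace_sum_space]] by simp
    then show ?thesis using True by simp
  next
    case False
    have "split_norm X Y s t z = split_norm X Y s t (smul (inverse c) (smul c z))" using False by simp
    also have "\<dots> \<le> norm (inverse c) * split_norm X Y s t (smul c z)"
      using False by (intro le subspace_scale[OF subspace_sum_space z]) simp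
    finally have "split_norm X Y s t z \<le> norm (inverse c) * split_norm X Y s t (smul c z)" .
    from mult_left_mono[OF this norm_ge_zero[of c]]
    have "norm c * split_norm X Y s t z \<le> split_norm X Y s t (smul c z)"
      using False by (simp only: norm_inverse norm_eq_zero not_False_eq_True mult.assoc[symmetric] right_inverse mult_1_left)
    then show ?thesis using le[OF z False] by linarith
  qed
qed

lemma split_functional:
  assumes st: "s \<ge> 0" "t \<ge> 0" and a: "a \<in> cset (sum_space X Y)"
  shows "\<exists>f. functional (cset (sum_space X Y)) f \<and> (\<forall>x\<in>cset X. norm (f x) \<le> s * nrm X x) \<and>
    (\<forall>y\<in>cset Y. norm (f y) \<le> t * nrm Y y) \<and> split_norm X Y s t a \<le> norm (f a)"
proof -
  obtain f where f: "functional (cset (sum_space X Y)) f"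
    "\<forall>x\<in>cset (sum_space X Y). norm (f x) \<le> split_norm X Y s t x"
    "split_norm X Y s t a \<le> norm (f a)"
    using hahn_banach[OF subspace_sum_space a, of "split_norm X Y s t"]
      split_norm_triangle[OF st] split_norm_scale[OF st] by blast
  have "norm (f x) \<le> s * nrm X x" if "x \<in> cset X" for x
    using f(2) split_norm_le[OF st that normed_zero[OF Y]] subset_sum_space that
    by (fastforce simp: nrm_zero[OF Y])
  moreover have "norm (f y) \<le> t * nrm Y y" if "y \<in> cset Y" for y
    using f(2) split_norm_le[OF st normed_zero[OF X] that] subset_sum_space that
    by (fastforce simp: nrm_zero[OF X])
  ultimately show ?thesis using f by blast
qed

end

text \<open>
Definiteness uses the Hausdorff topology behind the couple. A vector \<open>z\<close> of norm 0 is a sum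
\<open>x n + y n\<close> with \<open>x n\<close> and \<open>y n\<close> tending to 0 in
\<open>X\<close> and \<open>Y\<close>, hence in the common topology, so the constant sequence
\<open>z\<close> tends to 0 there.
\<close>

lemma sum_space_normed:
  assumes XY: "banach_couple smul X Y"
  shows "normed_space smul (sum_space X Y)"
proof -
  let ?S = "sum_space X Y"
  have X: "normed_space smul X" and Y: "normed_space smul Y"
    using XY by (auto simp: banach_couple_def intro: banach_imp_normed)
  obtain U where U: "hausdorff_tvs smul U"
    and XU: "continuous_map (ntop X) U (\<lambda>x. x)" and YU: "continuous_map (ntop Y) U (\<lambda>x. x)"
    using XY by (auto simp: banach_couple_def)
  have definite: "z = 0" if z: "z \<in> cset ?S" and 0: "split_norm X Y 1 1 z = 0" for z
  proof -
    have "\<exists>x y. x \<in> cset X \<and> y \<in> cset Y \<and> z = x + y \<and> nrm X x + nrm Y y < inverse (real (Suc n))" for n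
    proof (rule ccontr)
      assume n: "\<not> ?thesis"
      then have "inverse (real (Suc n)) \<le> split_norm X Y 1 1 z"
        by (intro split_norm_greatest[OF X Y z]) force
      then show False using 0 by simp
    qed
    then obtain x y where x: "\<And>n. x n \<in> cset X" and y: "\<And>n. y n \<in> cset Y" and xy: "\<And>n. z = x n + y n"
      and small: "\<And>n. nrm X (x n) + nrm Y (y n) < inverse (real (Suc n))" by metis
    have "nrm X (x n) \<le> inverse (real (Suc n))" "nrm Y (y n) \<le> inverse (real (Suc n))" for n
      using small[of n] nrm_nonneg[OF X, of "x n"] nrm_nonneg[OF Y, of "y n"] by linarith+
    then have "(\<lambda>n. nrm X (x n)) \<longlonglongrightarrow> 0" "(\<lambda>n. nrm Y (y n)) \<longlonglongrightarrow> 0"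
      by (auto intro!: tendsto_sandwich[OF _ _ tendsto_const LIMSEQ_inverse_real_of_nat]
        simp: nrm_nonneg[OF X] nrm_nonneg[OF Y])
    then have "nlim X x 0" "nlim Y y 0"
      using x y normed_zero[OF X] normed_zero[OF Y] by (auto simp: nlim_def)
    then have "limitin (ntop X) x 0 sequentially" "limitin (ntop Y) y 0 sequentially"
      using nlim_iff_limitin[OF X, of x 0] nlim_iff_limitin[OF Y, of y 0] by (simp_all add: nlim_def)
    then have "limitin U x 0 sequentially" "limitin U y 0 sequentially"
      using continuous_map_limit[OF XU] continuous_map_limit[OF YU] by (auto simp: o_def)
    then have "limitin (prod_topology U U) (\<lambda>n. (x n, y n)) (0, 0) sequentially"
      by (simp add: limitin_pairwise o_def)
    moreover have "continuous_map (prod_topology U U) U (\<lambda>(x, y). x + y)"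
      using U by (simp add: hausdorff_tvs_def)
    ultimately have "limitin U ((\<lambda>(x, y). x + y) \<circ> (\<lambda>n. (x n, y n))) ((\<lambda>(x, y). x + y) (0, 0)) sequentially"
      by (rule continuous_map_limit[rotated])
    then have lim0: "limitin U (\<lambda>n. z) 0 sequentially"
      using xy by (simp add: o_def)
    have "subspace (topspace U)" using U by (simp add: hausdorff_tvs_def)
    moreover have "x 0 \<in> topspace U" "y 0 \<in> topspace U"
      using XU YU x y Metric_space.topspace_mtopology[OF Metric_space_normed[OF X]]
        Metric_space.topspace_mtopology[OF Metric_space_normed[OF Y]]
      by (auto simp: continuous_map_def Pi_iff)
    ultimately have "z \<in> topspace U" using xy[of 0] by (auto intro: subspace_add)
    then have "limitin U (\<lambda>n. z) z sequentially" by simp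
    then show ?thesis
      using lim0 U limitin_Hausdorff_unique[of U "\<lambda>n. z" z sequentially 0] by (simp add: hausdorff_tvs_def)
  qed
  have sub: "subspace (cset ?S)" by (rule subspace_sum_space[OF X Y])
  show ?thesis
    unfolding normed_space_def
  proof (intro conjI ballI allI impI)
    show "0 \<le> nrm ?S z" if "z \<in> cset ?S" for z
      using split_norm_nonneg[OF X Y _ _ that, of 1 1] by (simp add: nrm_sum_space[OF that])
    show "nrm ?S z = 0 \<longleftrightarrow> z = 0" if z: "z \<in> cset ?S" for z
      using definite[OF z] split_norm_scale[OF X Y _ _ z, of 1 1 0]
      by (auto simp: nrm_sum_space[OF z])
    show "nrm ?S (smul c z) = norm c * nrm ?S z" if z: "z \<in> cset ?S" for c z
      using split_norm_scale[OF X Y _ _ z, of 1 1 c]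
      by (simp add: nrm_sum_space[OF z] nrm_sum_space[OF subspace_scale[OF sub z]])
    show "nrm ?S (z + w) \<le> nrm ?S z + nrm ?S w" if z: "z \<in> cset ?S" and w: "w \<in> cset ?S" for z w
      using split_norm_triangle[OF X Y _ _ z w, of 1 1]
      by (simp add: nrm_sum_space[OF z] nrm_sum_space[OF w] nrm_sum_space[OF subspace_add[OF sub z w]])
    show "nrm ?S z = 0" if "z \<notin> cset ?S" for z by (rule nrm_sum_space_outside[OF that])
  qed (rule sub)
qed

lemma sum_space_inclusion:
  assumes X: "normed_space smul X" and Y: "normed_space smul Y"
  shows "bounded_inclusion X (sum_space X Y)" "bounded_inclusion Y (sum_space X Y)"
proof -
  have "nrm (sum_space X Y) x \<le> 1 * nrm X x" if "x \<in> cset X" for x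
    using split_norm_le[OF X Y _ _ that normed_zero[OF Y], of 1 1] nrm_sum_space[of x X Y]
      subset_sum_space(1)[OF X Y] that by (auto simp: nrm_zero[OF Y])
  then show "bounded_inclusion X (sum_space X Y)"
    using subset_sum_space(1)[OF X Y] unfolding bounded_inclusion_def by (metis zero_le_one)
  have "nrm (sum_space X Y) y \<le> 1 * nrm Y y" if "y \<in> cset Y" for y
    using split_norm_le[OF X Y _ _ normed_zero[OF X] that, of 1 1] nrm_sum_space[of y X Y]
      subset_sum_space(2)[OF X Y] that by (auto simp: nrm_zero[OF X])
  then show "bounded_inclusion Y (sum_space X Y)"
    using subset_sum_space(2)[OF X Y] unfolding bounded_inclusion_def by (metis zero_le_one)
qed

lemma dual_norm_properties:
  assumes E: "normed_space smul E" and f: "functional S f" and ES: "cset E \<subseteq> S"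
    and b: "bounded_functional E f"
  shows dual_norm_bound: "\<And>x. x \<in> cset E \<Longrightarrow> norm (f x) \<le> dual_norm E f * nrm E x"
    and dual_norm_nonneg: "0 \<le> dual_norm E f"
proof -
  obtain C where C: "C \<ge> 0" "\<And>x. x \<in> cset E \<Longrightarrow> norm (f x) \<le> C * nrm E x"
    using b by (auto simp: bounded_functional_def)
  have bdd: "bdd_above ((\<lambda>x. norm (f x)) ` {x \<in> cset E. nrm E x \<le> 1})"
  proof (rule bdd_aboveI[of _ C])
    fix r assume "r \<in> (\<lambda>x. norm (f x)) ` {x \<in> cset E. nrm E x \<le> 1}"
    then obtain x where x: "x \<in> cset E" "nrm E x \<le> 1" "r = norm (f x)" by blast
    have "C * nrm E x \<le> C * 1" using C(1) x(2) by (intro mult_left_mono)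
    then show "r \<le> C" using C(2)[OF x(1)] x(3) by linarith
  qed
  have up: "norm (f x) \<le> dual_norm E f" if "x \<in> cset E" "nrm E x \<le> 1" for x
    unfolding dual_norm_def using that by (intro cSUP_upper[OF _ bdd]) auto
  show "0 \<le> dual_norm E f"
    using order_trans[OF norm_ge_zero up[OF normed_zero[OF E]]] by (simp add: nrm_zero[OF E])
  show "norm (f x) \<le> dual_norm E f * nrm E x" if x: "x \<in> cset E" for x
  proof (cases "x = 0")
    case True
    then show ?thesis using C(2)[OF x] by (simp add: nrm_zero[OF E])
  next
    case False
    have pos: "nrm E x > 0" by (rule nrm_pos[OF E x False])
    have "nrm E (rscale (1 / nrm E x) x) = 1"
      using pos nrm_scale[OF E x, of "of_real (1 / nrm E x)"] by (simp only: norm_of_real) simp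
    then have "norm (f (rscale (1 / nrm E x) x)) \<le> dual_norm E f"
      using up[OF normed_scale[OF E x]] by simp
    moreover have "f (rscale (1 / nrm E x) x) = of_real (1 / nrm E x) * f x"
      using f x ES by (auto simp: functional_def)
    ultimately have "norm (f x) / nrm E x \<le> dual_norm E f"
      using pos by (simp add: norm_mult norm_divide)
    then show ?thesis using pos by (simp add: field_simps)
  qed
qed

lemma dual_norm_le:
  assumes E: "normed_space smul E" and C: "C \<ge> 0" "\<And>x. x \<in> cset E \<Longrightarrow> norm (f x) \<le> C * nrm E x"
  shows "dual_norm E f \<le> C"
  unfolding dual_norm_def
proof (rule cSUP_least)
  show "{x \<in> cset E. nrm E x \<le> 1} \<noteq> {}" using normed_zero[OF E] by (auto simp: nrm_zero[OF E] intro!: exI[of _ 0])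
  fix x assume x: "x \<in> {x \<in> cset E. nrm E x \<le> 1}"
  have "C * nrm E x \<le> C * 1" using C(1) x by (intro mult_left_mono) auto
  then show "norm (f x) \<le> C" using C(2)[of x] x by auto
qed

text \<open>
The bounded functionals on \<open>X + Y\<close>: a functional is bounded there exactly if it is
bounded on both components.
\<close>

definition dual :: "'a nspace \<Rightarrow> 'a nspace \<Rightarrow> ('a \<Rightarrow> 'k) \<Rightarrow> bool" where
  "dual X Y f \<longleftrightarrow> functional (cset (sum_space X Y)) f \<and> bounded_functional X f \<and> bounded_functional Y f"

lemma dual_bounded:
  assumes X: "normed_space smul X" and Y: "normed_space smul Y" and f: "dual X Y f"
    and ES: "bounded_inclusion E (sum_space X Y)"
  shows "bounded_functional E f"
proof -
  let ?S = "sum_space X Y"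
  obtain A where A: "A \<ge> 0" "\<And>x. x \<in> cset X \<Longrightarrow> norm (f x) \<le> A * nrm X x"
    using f unfolding dual_def bounded_functional_def by blast
  obtain B where B: "B \<ge> 0" "\<And>x. x \<in> cset Y \<Longrightarrow> norm (f x) \<le> B * nrm Y x"
    using f unfolding dual_def bounded_functional_def by blast
  obtain D where D: "D \<ge> 0" "\<And>x. x \<in> cset E \<Longrightarrow> nrm ?S x \<le> D * nrm E x"
    using ES unfolding bounded_inclusion_def by blast
  have S: "norm (f z) \<le> (A + B) * nrm ?S z" if z: "z \<in> cset ?S" for z
  proof (cases "A + B = 0")
    case True
    obtain x y where xy: "x \<in> cset X" "y \<in> cset Y" "z = x + y" using z by (rule sum_spaceE)
    have "f z = f x + f y" using f xy subset_sum_space[OF X Y] by (auto simp: dual_def functional_def)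
    moreover have "A = 0" "B = 0" using True A(1) B(1) by linarith+
    ultimately show ?thesis using A(2)[OF xy(1)] B(2)[OF xy(2)] by simp
  next
    case False
    then have AB: "A + B > 0" using A(1) B(1) by linarith
    have "norm (f z) / (A + B) \<le> split_norm X Y 1 1 z"
    proof (rule split_norm_greatest[OF X Y z])
      fix x y assume xy: "x \<in> cset X" "y \<in> cset Y" "z = x + y"
      have "f z = f x + f y" using f xy subset_sum_space[OF X Y] by (auto simp: dual_def functional_def)
      then have "norm (f z) \<le> A * nrm X x + B * nrm Y y"
        using A(2)[OF xy(1)] B(2)[OF xy(2)] norm_triangle_ineq[of "f x" "f y"] by simp
      also have "\<dots> \<le> (A + B) * nrm X x + (A + B) * nrm Y y"
        using A B nrm_nonneg[OF X] nrm_nonneg[OF Y] by (intro add_mono mult_right_mono) auto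
      finally show "norm (f z) / (A + B) \<le> 1 * nrm X x + 1 * nrm Y y"
        using AB by (simp add: field_simps)
    qed
    then show ?thesis using AB by (simp add: nrm_sum_space[OF z] field_simps)
  qed
  have "norm (f x) \<le> ((A + B) * D) * nrm E x" if x: "x \<in> cset E" for x
  proof -
    have "norm (f x) \<le> (A + B) * nrm ?S x" using S ES x by (auto simp: bounded_inclusion_def)
    also have "\<dots> \<le> (A + B) * (D * nrm E x)" using D(2)[OF x] A B by (intro mult_left_mono) auto
    finally show ?thesis by (simp add: mult.assoc)
  qed
  then show ?thesis using A B D unfolding bounded_functional_def
    by (intro exI[of _ "(A + B) * D"]) auto
qed

lemma banach_couple_commute: "banach_couple smul X Y \<Longrightarrow> banach_couple smul Y X"
  by (auto simp: banach_couple_def)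

lemma couple_operators_commute: "couple_operators smul X Y = couple_operators smul Y X"
  by (auto simp: couple_operators_def sum_space_commute[of X Y])

lemma interpolation_spaces_commute: "interpolation_spaces smul X Y = interpolation_spaces smul Y X"
  by (auto simp: interpolation_spaces_def intermediate_spaces_def couple_operators_commute[of X Y]
      sum_space_commute[of X Y] inter_space_commute[of X Y])

lemma dual_commute: "dual X Y f \<longleftrightarrow> dual Y X f"
  by (auto simp: dual_def sum_space_commute[of X Y])

lemma inter_space_normed:
  assumes X: "normed_space smul X" and Y: "normed_space smul Y"
  shows "normed_space smul (inter_space X Y)"
  unfolding normed_space_def
proof (intro conjI ballI allI impI)
  show "subspace (cset (inter_space X Y))"
    using X Y by (auto simp: inter_space_def normed_space_def intro: subspace_inter)
  show "nrm (inter_space X Y) (x + y) \<le> nrm (inter_space X Y) x + nrm (inter_space X Y) y"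
    if "x \<in> cset (inter_space X Y)" "y \<in> cset (inter_space X Y)" for x y
    using that nrm_triangle[OF X, of x y] nrm_triangle[OF Y, of x y] normed_add[OF X, of x y] normed_add[OF Y, of x y]
    by (auto simp: inter_space_def)
  show "nrm (inter_space X Y) (smul c x) = norm c * nrm (inter_space X Y) x"
    if "x \<in> cset (inter_space X Y)" for c x
    using that normed_scale[OF X] normed_scale[OF Y]
    by (auto simp: inter_space_def nrm_scale[OF X] nrm_scale[OF Y] max_mult_distrib_left)
  show "0 \<le> nrm (inter_space X Y) x" for x
    using nrm_nonneg[OF X] by (auto simp: inter_space_def le_max_iff_disj)
  show "nrm (inter_space X Y) x = 0 \<longleftrightarrow> x = 0" if "x \<in> cset (inter_space X Y)" for x
    using that nrm_eq_0[OF X, of x] nrm_eq_0[OF Y, of x] nrm_nonneg[OF X, of x] nrm_nonneg[OF Y, of x]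
    by (auto simp: inter_space_def max_def)
qed (auto simp: inter_space_def)

lemma couple_endpoint_interpolation:
  assumes XY: "banach_couple smul X Y"
  shows "X \<in> interpolation_spaces smul X Y"
proof -
  have BX: "banach_space smul X" and X: "normed_space smul X" and Y: "normed_space smul Y"
    using XY by (auto simp: banach_couple_def intro: banach_imp_normed)
  have "bounded_inclusion (inter_space X Y) X"
    unfolding bounded_inclusion_def by (intro conjI exI[of _ 1]) (auto simp: inter_space_def)
  then have "inter_space X Y \<hookrightarrow> X" "X \<hookrightarrow> sum_space X Y"
    using sum_space_inclusion[OF X Y] sum_space_normed[OF XY] inter_space_normed[OF X Y] X
    by (simp_all add: embeds_iff_bounded_inclusion)
  then show ?thesis
    using BX by (auto simp: interpolation_spaces_def intermediate_spaces_def couple_operators_def bounded_on_def)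
qed

end

section \<open>Series of couple operators\<close>

text \<open>
Evaluation at the natural numbers turns this Banach space into a source of bounded real coefficient
sequences, which include the unit sequences because of bump functions.
\<close>

definition bcont_space :: "(real \<Rightarrow>\<^sub>C real) nspace" where
  "bcont_space = \<lparr> cset = UNIV, nrm = norm \<rparr>"

lemma banach_bcont: "banach_space scaleR bcont_space"
proof -
  have "Met_TC.mcomplete TYPE(real \<Rightarrow>\<^sub>C real)" unfolding mcomplete_iff_complete by (rule complete_UNIV)
  then have "Metric_space.mcomplete UNIV (\<lambda>x y :: real \<Rightarrow>\<^sub>C real. norm (x - y))"
    by (simp flip: dist_norm)
  moreover have "module.subspace scaleR (UNIV :: (real \<Rightarrow>\<^sub>C real) set)"
    by (simp add: module.subspace_def[OF real_vector.module_axioms])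
  ultimately show ?thesis
    by (simp add: banach_space_def bcont_space_def norm_triangle_ineq)
qed

abbreviation at_nat :: "(real \<Rightarrow>\<^sub>C real) \<Rightarrow> nat \<Rightarrow> real" where
  "at_nat b n \<equiv> apply_bcontfun b (real n)"

lemma bump_function:
  "\<exists>b :: real \<Rightarrow>\<^sub>C real. norm b \<le> 1 \<and> (\<forall>m. apply_bcontfun b (real m) = (if m = n then 1 else 0))"
proof -
  define g where "g x = max 0 (1 - \<bar>x - real n\<bar>)" for x :: real
  have g01: "0 \<le> g x" "g x \<le> 1" for x by (auto simp: g_def)
  have "continuous_on UNIV g" unfolding g_def by (intro continuous_intros)
  moreover have "bounded (range g)" using g01 by (intro boundedI[of _ 1]) auto
  ultimately have "g \<in> bcontfun" by (simp add: bcontfun_def)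
  then obtain b :: "real \<Rightarrow>\<^sub>C real" where b: "g = apply_bcontfun b" by (rule bcontfunE)
  have "norm b \<le> 1" using g01 by (intro norm_bound) (simp flip: b)
  moreover have "g (real m) = (if m = n then 1 else 0)" for m by (auto simp: g_def)
  ultimately show ?thesis by (auto simp flip: b)
qed

context scalar_space
begin

context
  fixes X Y S :: "'a nspace" and \<tau> :: "nat \<Rightarrow> 'a \<Rightarrow> 'a"
  assumes XY: "banach_couple smul X Y" and S_def: "S = sum_space X Y"
    and \<tau>_add: "\<And>n x y. x \<in> cset S \<Longrightarrow> y \<in> cset S \<Longrightarrow> \<tau> n (x + y) = \<tau> n x + \<tau> n y"
    and \<tau>_scale: "\<And>n c x. x \<in> cset S \<Longrightarrow> \<tau> n (smul c x) = smul c (\<tau> n x)"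
    and \<tau>_X: "\<And>n x. x \<in> cset X \<Longrightarrow> \<tau> n x \<in> cset X \<and> nrm X (\<tau> n x) \<le> (1/2) ^ n * nrm X x"
    and \<tau>_Y: "\<And>n y. y \<in> cset Y \<Longrightarrow> \<tau> n y \<in> cset Y \<and> nrm Y (\<tau> n y) \<le> (1/2) ^ n * nrm Y y"
begin

definition weighted_series :: "(nat \<Rightarrow> real) \<Rightarrow> 'a \<Rightarrow> 'a" where
  "weighted_series l s = (THE t. nsums S (\<lambda>n. rscale (l n) (\<tau> n s)) t)"

lemma couple_normed: "normed_space smul X" "normed_space smul Y" "normed_space smul S"
  using XY sum_space_normed[OF XY] by (auto simp: banach_couple_def S_def intro: banach_imp_normed)

lemma weighted_series_eq: "nsums S (\<lambda>n. rscale (l n) (\<tau> n s)) t \<Longrightarrow> weighted_series l s = t"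
  unfolding weighted_series_def using nlim_unique[OF couple_normed(3)] by blast

text \<open>
The terms decay geometrically in \<open>E\<close>, so the series converges in \<open>E\<close>, and its
sum there is also its sum in \<open>S\<close>.
\<close>

lemma component_series:
  assumes B: "banach_space smul E" and ES: "bounded_inclusion E S"
    and \<tau>E: "\<And>n. \<tau> n x \<in> cset E \<and> nrm E (\<tau> n x) \<le> (1/2) ^ n * nrm E x"
    and l: "\<forall>n. \<bar>l n\<bar> \<le> b"
  shows "nsums S (\<lambda>n. rscale (l n) (\<tau> n x)) (weighted_series l x)"
    and "weighted_series l x \<in> cset E" and "nrm E (weighted_series l x) \<le> 2 * b * nrm E x"
proof -
  have E: "normed_space smul E" using B by (rule banach_imp_normed)
  have mem: "rscale (l n) (\<tau> n x) \<in> cset E" for n using \<tau>E normed_scale[OF E] by blast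
  have b: "b \<ge> 0" using l[rule_format, of 0] by linarith
  have bound: "nrm E (rscale (l n) (\<tau> n x)) \<le> (b * nrm E x) * (1/2) ^ n" for n
  proof -
    have "nrm E (rscale (l n) (\<tau> n x)) = \<bar>l n\<bar> * nrm E (\<tau> n x)"
      using nrm_scale[OF E] \<tau>E by simp
    also have "\<dots> \<le> b * ((1/2) ^ n * nrm E x)"
      using l \<tau>E b by (intro mult_mono nrm_nonneg[OF E]) auto
    finally show ?thesis by (simp add: mult_ac)
  qed
  note geo = summable_geometric_bound[of "\<lambda>n. nrm E (rscale (l n) (\<tau> n x))", OF nrm_nonneg[OF E] bound]
  obtain t where t: "nsums E (\<lambda>n. rscale (l n) (\<tau> n x)) t"
    "nrm E t \<le> (\<Sum>n. nrm E (rscale (l n) (\<tau> n x)))"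
    using banach_nsums[of E "\<lambda>n. rscale (l n) (\<tau> n x)", OF B mem geo(1)] by blast
  have S: "nsums S (\<lambda>n. rscale (l n) (\<tau> n x)) t"
    using nlim_mono[OF E couple_normed(3) ES t(1)] .
  then have eq: "weighted_series l x = t" by (rule weighted_series_eq)
  show "nsums S (\<lambda>n. rscale (l n) (\<tau> n x)) (weighted_series l x)" using S by (simp only: eq)
  show "weighted_series l x \<in> cset E" using t(1) by (simp add: eq nlim_def)
  show "nrm E (weighted_series l x) \<le> 2 * b * nrm E x" using t(2) geo(2) by (simp add: eq)
qed

lemmas X_series = component_series[OF _ _ \<tau>_X] and Y_series = component_series[OF _ _ \<tau>_Y]

lemma couple_components:
  "banach_space smul X" "bounded_inclusion X S" "banach_space smul Y" "bounded_inclusion Y S"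
  using XY sum_space_inclusion[OF couple_normed(1,2)] by (auto simp: banach_couple_def S_def)

lemma weighted_series_nsums:
  assumes l: "\<forall>n. \<bar>l n\<bar> \<le> b" and s: "s \<in> cset S"
  shows "nsums S (\<lambda>n. rscale (l n) (\<tau> n s)) (weighted_series l s)"
proof -
  obtain x y where xy: "x \<in> cset X" "y \<in> cset Y" "s = x + y"
    using s unfolding S_def by (rule sum_spaceE)
  have "x \<in> cset S" "y \<in> cset S" using xy couple_components by (auto simp: bounded_inclusion_def)
  then have eq: "rscale (l n) (\<tau> n s) = rscale (l n) (\<tau> n x) + rscale (l n) (\<tau> n y)" for n
    by (simp add: xy \<tau>_add scale_right_distrib)
  have "nsums S (\<lambda>n. rscale (l n) (\<tau> n s)) (weighted_series l x + weighted_series l y)"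
    unfolding eq sum.distrib
    by (rule nlim_add[OF couple_normed(3) X_series(1)[OF couple_components(1,2) xy(1) l]
        Y_series(1)[OF couple_components(3,4) xy(2) l]])
  then show ?thesis using weighted_series_eq by simp
qed

lemma weighted_series_add:
  assumes l: "\<forall>n. \<bar>l n\<bar> \<le> b" and s: "s \<in> cset S" and r: "r \<in> cset S"
  shows "weighted_series l (s + r) = weighted_series l s + weighted_series l r"
proof (rule weighted_series_eq)
  have "rscale (l n) (\<tau> n (s + r)) = rscale (l n) (\<tau> n s) + rscale (l n) (\<tau> n r)" for n
    by (simp add: \<tau>_add[OF s r] scale_right_distrib)
  then show "nsums S (\<lambda>n. rscale (l n) (\<tau> n (s + r))) (weighted_series l s + weighted_series l r)"
    using nlim_add[OF couple_normed(3) weighted_series_nsums[OF l s] weighted_series_nsums[OF l r]]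
    by (simp add: sum.distrib)
qed

lemma weighted_series_operator:
  assumes l: "\<forall>n. \<bar>l n\<bar> \<le> b"
  shows "weighted_series l \<in> couple_operators smul X Y"
proof -
  have "weighted_series l s \<in> cset S" if "s \<in> cset S" for s
    using weighted_series_nsums[OF l that] by (simp add: nlim_def)
  moreover have "weighted_series l (smul c s) = smul c (weighted_series l s)" if s: "s \<in> cset S" for c s
  proof (rule weighted_series_eq)
    have "rscale (l n) (\<tau> n (smul c s)) = smul c (rscale (l n) (\<tau> n s))" for n
      by (simp add: \<tau>_scale[OF s] mult.commute)
    then show "nsums S (\<lambda>n. rscale (l n) (\<tau> n (smul c s))) (smul c (weighted_series l s))"
      using nlim_scale[OF couple_normed(3) weighted_series_nsums[OF l s], of c]
      by (simp add: scale_sum_right)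
  qed
  moreover have "bounded_on X (weighted_series l)"
    using X_series(2,3)[OF couple_components(1,2) _ l] unfolding bounded_on_def by blast
  moreover have "bounded_on Y (weighted_series l)"
    using Y_series(2,3)[OF couple_components(3,4) _ l] unfolding bounded_on_def by blast
  ultimately show ?thesis
    using weighted_series_add[OF l] by (auto simp: couple_operators_def S_def)
qed

lemma weighted_series_norm:
  assumes l: "\<forall>n. \<bar>l n\<bar> \<le> b" and s: "s \<in> cset S"
  shows "nrm S (weighted_series l s) \<le> 2 * b * nrm S s"
proof -
  have b: "b \<ge> 0" using l[rule_format, of 0] by linarith
  have T: "weighted_series l s \<in> cset S" using weighted_series_nsums[OF l s] by (simp add: nlim_def)
  have nS: "nrm S t = split_norm X Y 1 1 t" if "t \<in> cset S" for t
    using that by (simp add: S_def nrm_sum_space)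
  have split: "nrm S (weighted_series l s) \<le> (2 * b) * nrm X x + (2 * b) * nrm Y y"
    if xy: "x \<in> cset X" "y \<in> cset Y" "s = x + y" for x y
  proof -
    have "x \<in> cset S" "y \<in> cset S" using xy couple_components by (auto simp: bounded_inclusion_def)
    then have eq: "weighted_series l s = weighted_series l x + weighted_series l y"
      by (simp add: xy weighted_series_add[OF l])
    note mx = X_series(2,3)[OF couple_components(1,2) xy(1) l]
    note my = Y_series(2,3)[OF couple_components(3,4) xy(2) l]
    have "nrm S (weighted_series l s) \<le> 1 * nrm X (weighted_series l x) + 1 * nrm Y (weighted_series l y)"
      unfolding nS[OF T] unfolding eq
      using split_norm_le[OF couple_normed(1,2) _ _ mx(1) my(1), of 1 1] by simp
    then show ?thesis using mx(2) my(2) by linarith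
  qed
  show ?thesis
  proof (cases "b = 0")
    case True
    obtain x y where "x \<in> cset X" "y \<in> cset Y" "s = x + y"
      using s unfolding S_def by (rule sum_spaceE)
    from split[OF this] True show ?thesis by simp
  next
    case False
    then have b: "b > 0" using b by simp
    have "nrm S (weighted_series l s) / (2 * b) \<le> split_norm X Y 1 1 s"
    proof (rule split_norm_greatest[OF couple_normed(1,2) s[unfolded S_def]])
      fix x y assume "x \<in> cset X" "y \<in> cset Y" "s = x + y"
      from split[OF this] show "nrm S (weighted_series l s) / (2 * b) \<le> 1 * nrm X x + 1 * nrm Y y"
        using b by (simp add: field_simps)
    qed
    then show ?thesis using b s by (simp add: S_def nrm_sum_space field_simps)
  qed
qed

text \<open>
All weighted sums of the \<open>\<tau> n\<close> are couple operators and so preserve \<open>Z\<close>.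
For fixed \<open>a\<close> the map from coefficient sequences to the weighted sum at \<open>a\<close> is
therefore bounded into \<open>Z\<close> by the closed graph theorem, and unit sequences show that the
norms of \<open>\<tau> n a\<close> are bounded in \<open>n\<close>. Zabreiko's lemma for the supremum
of these norms makes the bound uniform in \<open>a\<close>.
\<close>

lemma uniform_bound_of_series:
  assumes Z: "Z \<in> interpolation_spaces smul X Y"
  shows "\<exists>C\<ge>0. \<forall>n. \<forall>a\<in>cset Z. nrm Z (\<tau> n a) \<le> C * nrm Z a"
proof -
  have BZ: "banach_space smul Z" and nZ: "normed_space smul Z" and ZS: "bounded_inclusion Z S"
    and inv: "\<And>T z. T \<in> couple_operators smul X Y \<Longrightarrow> z \<in> cset Z \<Longrightarrow> T z \<in> cset Z"
    using Z embeds_iff_bounded_inclusion[of Z S] couple_normed(3) banach_imp_normed[of smul Z]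
    by (auto simp: interpolation_spaces_def intermediate_spaces_def S_def)
  have ZsubS: "\<And>a. a \<in> cset Z \<Longrightarrow> a \<in> cset S" using ZS by (auto simp: bounded_inclusion_def)
  have lb: "\<forall>n. \<bar>at_nat l n\<bar> \<le> norm l" for l :: "real \<Rightarrow>\<^sub>C real"
    using norm_bounded[of l "real _"] by simp
  have unit: "\<exists>l :: real \<Rightarrow>\<^sub>C real. norm l \<le> 1 \<and> (\<forall>a\<in>cset S. weighted_series (at_nat l) a = \<tau> n a)" for n
  proof -
    obtain l :: "real \<Rightarrow>\<^sub>C real" where l: "norm l \<le> 1" "\<And>m. at_nat l m = (if m = n then 1 else 0)"
      using bump_function by blast
    have "weighted_series (at_nat l) a = \<tau> n a" if a: "a \<in> cset S" for a
    proof (rule weighted_series_eq)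
      have sum: "(\<Sum>m<N. rscale (at_nat l m) (\<tau> m a)) = (if n < N then \<tau> n a else 0)" for N
        by (simp add: l if_distrib[of "\<lambda>r. smul (of_real r) _"] sum.delta cong: if_cong)
      have \<tau>S: "\<tau> n a \<in> cset S"
      proof -
        obtain x y where xy: "x \<in> cset X" "y \<in> cset Y" "a = x + y"
          using a unfolding S_def by (rule sum_spaceE)
        have "x \<in> cset S" "y \<in> cset S" "\<tau> n x \<in> cset S" "\<tau> n y \<in> cset S"
          using xy couple_components \<tau>_X \<tau>_Y by (auto simp: bounded_inclusion_def)
        then show ?thesis using xy \<tau>_add normed_add[OF couple_normed(3)] by simp
      qed
      have "\<forall>\<^sub>F N in sequentially. nrm S ((if n < N then \<tau> n a else 0) - \<tau> n a) = 0"
        using eventually_gt_at_top[of n] by eventually_elim (simp add: nrm_zero[OF couple_normed(3)])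
      then have "(\<lambda>N. nrm S ((if n < N then \<tau> n a else 0) - \<tau> n a)) \<longlonglongrightarrow> 0"
        by (rule tendsto_eventually)
      then show "nsums S (\<lambda>m. rscale (at_nat l m) (\<tau> m a)) (\<tau> n a)"
        unfolding nlim_def sum using \<tau>S normed_zero[OF couple_normed(3)] by auto
    qed
    then show ?thesis using l by blast
  qed
  have \<tau>Z: "\<tau> n a \<in> cset Z" if a: "a \<in> cset Z" for n a
  proof -
    obtain l :: "real \<Rightarrow>\<^sub>C real" where "weighted_series (at_nat l) a = \<tau> n a"
      using unit[of n] ZsubS[OF a] by blast
    then show ?thesis using inv[OF weighted_series_operator[OF lb[of l]] a] by simp
  qed
  have ptw: "\<exists>C\<ge>0. \<forall>n. nrm Z (\<tau> n a) \<le> C" if a: "a \<in> cset Z" for a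
  proof -
    \<comment> \<open>The sum depends linearly on the coefficients and is continuous into \<open>S\<close>.\<close>
    have "\<exists>C\<ge>0. \<forall>l\<in>cset bcont_space. nrm Z (weighted_series (at_nat l) a) \<le> C * nrm bcont_space l"
    proof (rule closed_graph[OF real_vector.vector_space_axioms vector_space_axioms banach_bcont BZ
          couple_normed(3) ZS, where D = "2 * nrm S a"])
      fix l :: "real \<Rightarrow>\<^sub>C real"
      show "weighted_series (at_nat l) a \<in> cset Z" using inv[OF weighted_series_operator[OF lb[of l]] a] .
      show "nrm S (weighted_series (at_nat l) a) \<le> 2 * nrm S a * nrm bcont_space l"
        using weighted_series_norm[OF lb[of l] ZsubS[OF a]] by (simp add: bcont_space_def mult_ac)
    next
      fix l m :: "real \<Rightarrow>\<^sub>C real"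
      show "weighted_series (at_nat (l + m)) a = weighted_series (at_nat l) a + weighted_series (at_nat m) a"
      proof (rule weighted_series_eq)
        have "rscale (at_nat (l + m) n) (\<tau> n a) = rscale (at_nat l n) (\<tau> n a) + rscale (at_nat m n) (\<tau> n a)" for n
          by (simp add: plus_bcontfun.rep_eq scale_left_distrib)
        then show "nsums S (\<lambda>n. rscale (at_nat (l + m) n) (\<tau> n a)) (weighted_series (at_nat l) a + weighted_series (at_nat m) a)"
          using nlim_add[OF couple_normed(3) weighted_series_nsums[OF lb[of l] ZsubS[OF a]]
            weighted_series_nsums[OF lb[of m] ZsubS[OF a]]] by (simp add: sum.distrib)
      qed
    next
      fix r :: real and l :: "real \<Rightarrow>\<^sub>C real"
      show "weighted_series (at_nat (of_real r *\<^sub>R l)) a = rscale r (weighted_series (at_nat l) a)"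
      proof (rule weighted_series_eq)
        have "rscale (at_nat (of_real r *\<^sub>R l) n) (\<tau> n a) = rscale r (rscale (at_nat l n) (\<tau> n a))" for n
          by (simp add: scaleR_bcontfun.rep_eq)
        then show "nsums S (\<lambda>n. rscale (at_nat (of_real r *\<^sub>R l) n) (\<tau> n a)) (rscale r (weighted_series (at_nat l) a))"
          using nlim_scale[OF couple_normed(3) weighted_series_nsums[OF lb[of l] ZsubS[OF a]], of "of_real r"]
          by (simp add: scale_sum_right)
      qed
    qed
    then obtain C where C: "C \<ge> 0" "\<And>l. nrm Z (weighted_series (at_nat l) a) \<le> C * norm l"
      by (auto simp: bcont_space_def)
    have "nrm Z (\<tau> n a) \<le> C" for n
    proof -
      obtain l :: "real \<Rightarrow>\<^sub>C real" where l: "norm l \<le> 1" "weighted_series (at_nat l) a = \<tau> n a"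
        using unit[of n] ZsubS[OF a] by blast
      have "C * norm l \<le> C * 1" using C(1) l(1) by (intro mult_left_mono)
      then show ?thesis using C(2)[of l] l(2) by simp
    qed
    then show ?thesis using C(1) by blast
  qed
  have \<tau>_bounded: "\<exists>C\<ge>0. \<forall>a\<in>cset Z. nrm Z (\<tau> n a) \<le> C * nrm Z a" for n
  proof -
    obtain D where D: "\<And>a. a \<in> cset Z \<Longrightarrow> nrm S a \<le> D * nrm Z a"
      using ZS unfolding bounded_inclusion_def by blast
    obtain l :: "real \<Rightarrow>\<^sub>C real" where l: "norm l \<le> 1" "\<And>a. a \<in> cset S \<Longrightarrow> weighted_series (at_nat l) a = \<tau> n a"
      using unit[of n] by blast
    have l1: "\<forall>m. \<bar>at_nat l m\<bar> \<le> 1" using lb[of l] l(1) order_trans by blast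
    show ?thesis
    proof (rule closed_graph[OF vector_space_axioms vector_space_axioms BZ BZ couple_normed(3) ZS,
          where D = "2 * D"])
      fix a assume a: "a \<in> cset Z"
      show "\<tau> n a \<in> cset Z" by (rule \<tau>Z[OF a])
      show "nrm S (\<tau> n a) \<le> 2 * D * nrm Z a"
        using weighted_series_norm[OF l1 ZsubS[OF a]] D[OF a] l(2)[OF ZsubS[OF a]] by simp
    qed (simp_all add: \<tau>_add \<tau>_scale ZsubS)
  qed
  define p where "p a = (SUP n. nrm Z (\<tau> n a))" for a
  have up: "nrm Z (\<tau> n a) \<le> p a" if "a \<in> cset Z" for n a
    unfolding p_def using ptw[OF that] by (intro cSUP_upper) (auto simp: bdd_above_def)
  have least: "p a \<le> m" if "\<And>n. nrm Z (\<tau> n a) \<le> m" for a m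
    unfolding p_def by (rule cSUP_least) (use that in auto)
  have p_nonneg: "0 \<le> p a" if "a \<in> cset Z" for a
    using up[OF that, of 0] nrm_nonneg[OF nZ, of "\<tau> 0 a"] by linarith
  have "\<exists>C\<ge>0. \<forall>a\<in>cset Z. p a \<le> C * nrm Z a"
  proof (rule zabreiko[OF BZ])
    fix x y assume xy: "x \<in> cset Z" "y \<in> cset Z"
    have "nrm Z (\<tau> n (x + y)) \<le> p x + p y" for n
      using nrm_triangle[OF nZ \<tau>Z[OF xy(1)] \<tau>Z[OF xy(2)], of n n] up[OF xy(1), of n] up[OF xy(2), of n]
        \<tau>_add[OF ZsubS[OF xy(1)] ZsubS[OF xy(2)], of n] by simp
    then show "p (x + y) \<le> p x + p y" by (rule least)
  next
    fix r x assume x: "x \<in> cset Z"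
    have eq: "nrm Z (\<tau> n (rscale r x)) = \<bar>r\<bar> * nrm Z (\<tau> n x)" for n r
      using \<tau>_scale[OF ZsubS[OF x], of n] nrm_scale[OF nZ \<tau>Z[OF x]] by simp
    have le: "p (rscale r x) \<le> \<bar>r\<bar> * p x" for r
      using up[OF x] by (intro least) (simp add: eq mult_left_mono)
    show "p (rscale r x) = \<bar>r\<bar> * p x"
    proof (cases "r = 0")
      case True
      then show ?thesis using le[of 0] p_nonneg[OF normed_zero[OF nZ]] by simp
    next
      case False
      have "nrm Z (\<tau> n x) \<le> p (rscale r x) / \<bar>r\<bar>" for n
        using up[OF normed_scale[OF nZ x, of "of_real r"], of n] False by (simp add: eq field_simps)
      then have "p x \<le> p (rscale r x) / \<bar>r\<bar>" by (rule least)
      then have "\<bar>r\<bar> * p x \<le> p (rscale r x)" using False by (simp add: field_simps)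
      then show ?thesis using le[of r] by linarith
    qed
  next
    fix g l assume g: "\<And>k. g k \<in> cset Z" and l: "nsums Z g l" and s: "summable (\<lambda>k. p (g k))"
    show "p l \<le> (\<Sum>k. p (g k))"
    proof (rule least)
      fix n
      obtain C where C: "C \<ge> 0" "\<And>a. a \<in> cset Z \<Longrightarrow> nrm Z (\<tau> n a) \<le> C * nrm Z a"
        using \<tau>_bounded[of n] by blast
      define G where "G K = (\<Sum>k<K. g k)" for K
      have G: "G K \<in> cset Z" for K unfolding G_def by (rule normed_sum[OF nZ g])
      have lZ: "l \<in> cset Z" and lim: "(\<lambda>K. nrm Z (G K - l)) \<longlonglongrightarrow> 0"
        using l by (auto simp: nlim_def G_def)
      have diff: "\<tau> n (G K) - \<tau> n l = \<tau> n (G K - l)" for K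
        using \<tau>_add[OF ZsubS[OF normed_diff[OF nZ G lZ]] ZsubS[OF lZ], of n K]
        unfolding diff_eq_eq diff_add_cancel .
      have "(\<lambda>K. nrm Z (\<tau> n (G K) - \<tau> n l)) \<longlonglongrightarrow> 0"
      proof (rule tendsto_sandwich[where f="\<lambda>_. 0" and h="\<lambda>K. C * nrm Z (G K - l)"])
        show "\<forall>\<^sub>F K in sequentially. nrm Z (\<tau> n (G K) - \<tau> n l) \<le> C * nrm Z (G K - l)"
          unfolding diff by (intro always_eventually allI C normed_diff[OF nZ] G lZ)
        show "(\<lambda>K. C * nrm Z (G K - l)) \<longlonglongrightarrow> 0" by (rule tendsto_mult_right_zero[OF lim])
      qed (auto simp: nrm_nonneg[OF nZ])
      then have "nlim Z (\<lambda>K. \<tau> n (G K)) (\<tau> n l)" using \<tau>Z G lZ by (auto simp: nlim_def)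
      moreover have "nrm Z (\<tau> n (G K)) \<le> (\<Sum>k. p (g k))" for K
      proof -
        have \<tau>0: "\<tau> n 0 = 0" using \<tau>_scale[OF ZsubS[OF lZ], of n 0] by simp
        have "\<tau> n (G K) = (\<Sum>k<K. \<tau> n (g k))"
        proof (induction K)
          case (Suc K)
          have "\<tau> n (G (Suc K)) = \<tau> n (G K) + \<tau> n (g K)"
            using \<tau>_add[OF ZsubS[OF G] ZsubS[OF g], of n K K] by (simp add: G_def)
          then show ?case using Suc by simp
        qed (simp add: G_def \<tau>0)
        then have "nrm Z (\<tau> n (G K)) \<le> (\<Sum>k<K. nrm Z (\<tau> n (g k)))"
          using nrm_sum_le[OF nZ, of "{..<K}" "\<lambda>k. \<tau> n (g k)"] \<tau>Z[OF g] by simp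
        also have "\<dots> \<le> (\<Sum>k<K. p (g k))" by (intro sum_mono up g)
        also have "\<dots> \<le> (\<Sum>k. p (g k))" using s p_nonneg g by (intro sum_le_suminf) auto
        finally show ?thesis .
      qed
      ultimately show "nrm Z (\<tau> n l) \<le> (\<Sum>k. p (g k))" by (rule nlim_nrm_le[OF nZ])
    qed
  qed (rule p_nonneg)
  then obtain C where C: "C \<ge> 0" "\<And>a. a \<in> cset Z \<Longrightarrow> p a \<le> C * nrm Z a" by blast
  have "nrm Z (\<tau> n a) \<le> C * nrm Z a" if "a \<in> cset Z" for n a
    using up[OF that, of n] C(2)[OF that] by linarith
  then show ?thesis using C(1) by blast
qed

end

end

section \<open>Rank one operators on a couple\<close>

context scalar_space
begin

text \<open>
If no constant sufficed, there would be operators \<open>T n\<close> with norms at most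
\<open>M n\<close> on the components that violate the bound with constant \<open>4 ^ n\<close>.
Scaled to norm \<open>(1/2) ^ n\<close>, they still have norm more than \<open>2 ^ n\<close> on
\<open>Z\<close>, contrary to the uniform bound for such a sequence.
\<close>

lemma interpolation_bound:
  assumes XY: "banach_couple smul X Y" and Z: "Z \<in> interpolation_spaces smul X Y"
  shows "\<exists>C>0. \<forall>T\<in>couple_operators smul X Y. \<forall>M\<ge>0.
    (\<forall>x\<in>cset X. nrm X (T x) \<le> M * nrm X x) \<and> (\<forall>y\<in>cset Y. nrm Y (T y) \<le> M * nrm Y y) \<longrightarrow>
    (\<forall>a\<in>cset Z. nrm Z (T a) \<le> C * M * nrm Z a)"
proof (rule ccontr)
  assume neg: "\<not> ?thesis"
  let ?S = "sum_space X Y"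
  have X: "normed_space smul X" and Y: "normed_space smul Y"
    using XY by (auto simp: banach_couple_def intro: banach_imp_normed)
  have nZ: "normed_space smul Z" and ZS: "cset Z \<subseteq> cset ?S"
    using Z banach_imp_normed by (auto simp: interpolation_spaces_def intermediate_spaces_def embeds_def)
  have "\<exists>T M a. T \<in> couple_operators smul X Y \<and> M \<ge> 0 \<and>
      (\<forall>x\<in>cset X. nrm X (T x) \<le> M * nrm X x) \<and> (\<forall>y\<in>cset Y. nrm Y (T y) \<le> M * nrm Y y) \<and>
      a \<in> cset Z \<and> 4 ^ n * M * nrm Z a < nrm Z (T a)" for n :: nat
  proof -
    have "(4::real) ^ n > 0" by simp
    with neg show ?thesis by (metis not_le)
  qed
  then obtain T M a where T: "\<And>n. T n \<in> couple_operators smul X Y" and M: "\<And>n. M n \<ge> 0"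
    and TX: "\<And>n x. x \<in> cset X \<Longrightarrow> nrm X (T n x) \<le> M n * nrm X x"
    and TY: "\<And>n y. y \<in> cset Y \<Longrightarrow> nrm Y (T n y) \<le> M n * nrm Y y"
    and a: "\<And>n. a n \<in> cset Z" and big: "\<And>n::nat. 4 ^ n * M n * nrm Z (a n) < nrm Z (T n (a n))"
    by metis
  have Tadd: "T n (x + y) = T n x + T n y" if "x \<in> cset ?S" "y \<in> cset ?S" for n x y
    using T[of n] that by (auto simp: couple_operators_def)
  have Tscale: "T n (smul c x) = smul c (T n x)" if "x \<in> cset ?S" for n c x
    using T[of n] that by (auto simp: couple_operators_def)
  have Tmem: "x \<in> cset X \<Longrightarrow> T n x \<in> cset X" "y \<in> cset Y \<Longrightarrow> T n y \<in> cset Y" for n x y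
    using T[of n] by (auto simp: couple_operators_def bounded_on_def)
  have Mpos: "M n > 0" for n
  proof (rule ccontr)
    assume "\<not> M n > 0"
    then have M0: "M n = 0" using M[of n] by simp
    obtain x y where xy: "x \<in> cset X" "y \<in> cset Y" "a n = x + y"
      using a[of n] ZS unfolding cset_sum_space by blast
    have "T n x = 0" using TX[OF xy(1), of n] nrm_pos[OF X Tmem(1)[OF xy(1)], of n] M0 by fastforce
    moreover have "T n y = 0" using TY[OF xy(2), of n] nrm_pos[OF Y Tmem(2)[OF xy(2)], of n] M0 by fastforce
    ultimately have "T n (a n) = 0"
      using Tadd[of x y n] xy subset_sum_space[OF X Y] by auto
    then show False using big[of n] M0 by (simp add: nrm_zero[OF nZ])
  qed
  define w where "w n = 1 / (2 ^ n * M n)" for n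
  have w: "w n > 0" for n using Mpos by (simp add: w_def)
  have wM: "w n * M n = (1/2) ^ n" for n using Mpos[of n] by (simp add: w_def power_divide)
  define \<tau> where "\<tau> n x = rscale (w n) (T n x)" for n x
  have "\<exists>C\<ge>0. \<forall>n. \<forall>a\<in>cset Z. nrm Z (\<tau> n a) \<le> C * nrm Z a"
  proof (rule uniform_bound_of_series[OF XY refl _ _ _ _ Z])
    fix n x y assume "x \<in> cset ?S" "y \<in> cset ?S"
    then show "\<tau> n (x + y) = \<tau> n x + \<tau> n y" by (simp add: \<tau>_def Tadd scale_right_distrib)
  next
    fix n c x assume "x \<in> cset ?S"
    then show "\<tau> n (smul c x) = smul c (\<tau> n x)" by (simp add: \<tau>_def Tscale mult.commute)
  next
    fix n x assume x: "x \<in> cset X"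
    have "nrm X (\<tau> n x) = w n * nrm X (T n x)"
      using w[of n] nrm_scale[OF X Tmem(1)[OF x]] by (simp add: \<tau>_def)
    also have "\<dots> \<le> w n * (M n * nrm X x)" using w[of n] TX[OF x] by (intro mult_left_mono) auto
    finally show "\<tau> n x \<in> cset X \<and> nrm X (\<tau> n x) \<le> (1/2) ^ n * nrm X x"
      using normed_scale[OF X Tmem(1)[OF x]] by (simp add: \<tau>_def mult.assoc[symmetric] wM)
  next
    fix n x assume x: "x \<in> cset Y"
    have "nrm Y (\<tau> n x) = w n * nrm Y (T n x)"
      using w[of n] nrm_scale[OF Y Tmem(2)[OF x]] by (simp add: \<tau>_def)
    also have "\<dots> \<le> w n * (M n * nrm Y x)" using w[of n] TY[OF x] by (intro mult_left_mono) auto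
    finally show "\<tau> n x \<in> cset Y \<and> nrm Y (\<tau> n x) \<le> (1/2) ^ n * nrm Y x"
      using normed_scale[OF Y Tmem(2)[OF x]] by (simp add: \<tau>_def mult.assoc[symmetric] wM)
  qed
  then obtain C where C: "C \<ge> 0" "\<And>n. nrm Z (\<tau> n (a n)) \<le> C * nrm Z (a n)" using a by blast
  have TZ: "T n (a n) \<in> cset Z" for n
    using Z T[of n] a[of n] by (auto simp: interpolation_spaces_def)
  have le: "2 ^ n \<le> C" for n :: nat
  proof -
    have "a n \<noteq> 0"
    proof
      assume "a n = 0"
      moreover have "T n 0 = 0" using Tscale[of "a n" n 0] a[of n] ZS by auto
      ultimately show False using big[of n] by (simp add: nrm_zero[OF nZ])
    qed
    then have pos: "nrm Z (a n) > 0" by (rule nrm_pos[OF nZ a])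
    have "w n * (4 ^ n * M n * nrm Z (a n)) \<le> w n * nrm Z (T n (a n))"
      using w[of n] big[of n] by (intro mult_left_mono) auto
    also have "\<dots> = nrm Z (\<tau> n (a n))"
      using w[of n] nrm_scale[OF nZ TZ] by (simp add: \<tau>_def)
    also have "w n * (4 ^ n * M n * nrm Z (a n)) = (w n * M n) * 4 ^ n * nrm Z (a n)" by (simp add: mult_ac)
    also have "(w n * M n) * 4 ^ n = 2 ^ n" by (simp add: wM flip: power_mult_distrib)
    finally have "2 ^ n * nrm Z (a n) \<le> C * nrm Z (a n)" using C(2)[of n] by linarith
    then show ?thesis using pos by simp
  qed
  obtain n where "C < 2 ^ n" using real_arch_pow[of 2 C] by auto
  then show False using le[of n] by simp
qed

lemma rank_one_operator:
  assumes f: "functional (cset (sum_space X Y)) f" and S: "subspace (cset (sum_space X Y))"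
    and z: "z \<in> cset (sum_space X Y)"
    and "bounded_on X (\<lambda>s. smul (f s) z)" "bounded_on Y (\<lambda>s. smul (f s) z)"
  shows "(\<lambda>s. smul (f s) z) \<in> couple_operators smul X Y"
  using assms by (auto simp: couple_operators_def functional_def scale_left_distrib intro: subspace_scale)

lemma rank_one_bounded:
  assumes E: "normed_space smul E" and z: "z \<in> cset E"
    and C: "C \<ge> 0" "\<And>x. x \<in> cset E \<Longrightarrow> norm (f x) \<le> C * nrm E x" and M: "C * nrm E z \<le> M"
  shows "\<And>x. x \<in> cset E \<Longrightarrow> nrm E (smul (f x) z) \<le> M * nrm E x"
    and "bounded_on E (\<lambda>s. smul (f s) z)"
proof -
  show *: "nrm E (smul (f x) z) \<le> M * nrm E x" if x: "x \<in> cset E" for x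
  proof -
    have "nrm E (smul (f x) z) = norm (f x) * nrm E z" by (rule nrm_scale[OF E z])
    also have "\<dots> \<le> (C * nrm E x) * nrm E z" using C(2)[OF x] nrm_nonneg[OF E] by (rule mult_right_mono)
    also have "\<dots> = (C * nrm E z) * nrm E x" by simp
    also have "\<dots> \<le> M * nrm E x" using M nrm_nonneg[OF E] by (rule mult_right_mono)
    finally show ?thesis .
  qed
  then show "bounded_on E (\<lambda>s. smul (f s) z)"
    unfolding bounded_on_def using normed_scale[OF E z] by blast
qed

text \<open>
The operator \<open>s \<mapsto> f(s) z\<close> has norm \<open>dual_norm E f * nrm E z\<close>
on each space \<open>E\<close> that contains \<open>z\<close>.
\<close>

lemma rank_one_estimate:
  assumes XY: "banach_couple smul X Y" and Z: "Z \<in> interpolation_spaces smul X Y"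
  shows "\<exists>C>0. \<forall>f z. dual X Y f \<longrightarrow> z \<in> cset X \<inter> cset Y \<longrightarrow>
    dual_norm Z f * nrm Z z \<le> C * max (dual_norm X f * nrm X z) (dual_norm Y f * nrm Y z)"
proof -
  have X: "normed_space smul X" and Y: "normed_space smul Y"
    using XY by (auto simp: banach_couple_def intro: banach_imp_normed)
  have nZ: "normed_space smul Z" and IZ: "cset X \<inter> cset Y \<subseteq> cset Z"
    using Z banach_imp_normed
    by (auto simp: interpolation_spaces_def intermediate_spaces_def embeds_def inter_space_def)
  obtain C where C: "C > 0" and bound: "\<And>T M. T \<in> couple_operators smul X Y \<Longrightarrow> M \<ge> 0 \<Longrightarrow>
    (\<forall>x\<in>cset X. nrm X (T x) \<le> M * nrm X x) \<and> (\<forall>y\<in>cset Y. nrm Y (T y) \<le> M * nrm Y y) \<Longrightarrow>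
    (\<forall>a\<in>cset Z. nrm Z (T a) \<le> C * M * nrm Z a)"
    using interpolation_bound[OF XY Z] by blast
  have "dual_norm Z f * nrm Z z \<le> C * max (dual_norm X f * nrm X z) (dual_norm Y f * nrm Y z)"
    if f: "dual X Y f" and z: "z \<in> cset X \<inter> cset Y" for f z
  proof (cases "z = 0")
    case True
    then show ?thesis by (simp add: nrm_zero[OF nZ] nrm_zero[OF X] nrm_zero[OF Y])
  next
    case False
    define M where "M = max (dual_norm X f * nrm X z) (dual_norm Y f * nrm Y z)"
    have fS: "functional (cset (sum_space X Y)) f" and fX: "bounded_functional X f" and fY: "bounded_functional Y f"
      using f by (auto simp: dual_def)
    note dX = dual_norm_nonneg[OF X fS subset_sum_space(1)[OF X Y] fX]
      dual_norm_bound[OF X fS subset_sum_space(1)[OF X Y] fX]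
    note dY = dual_norm_nonneg[OF Y fS subset_sum_space(2)[OF X Y] fY]
      dual_norm_bound[OF Y fS subset_sum_space(2)[OF X Y] fY]
    have zX: "z \<in> cset X" and zY: "z \<in> cset Y" and zZ: "z \<in> cset Z" using z IZ by auto
    have MX: "dual_norm X f * nrm X z \<le> M" and MY: "dual_norm Y f * nrm Y z \<le> M" by (auto simp: M_def)
    have M0: "M \<ge> 0" using dX(1) nrm_nonneg[OF X, of z] MX by (meson mult_nonneg_nonneg order_trans)
    have T: "(\<lambda>s. smul (f s) z) \<in> couple_operators smul X Y"
      using subset_sum_space(1)[OF X Y] zX
      by (intro rank_one_operator[OF fS subspace_sum_space[OF X Y]] rank_one_bounded(2)[OF X zX dX MX]
          rank_one_bounded(2)[OF Y zY dY MY]) auto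
    have "\<forall>a\<in>cset Z. nrm Z (smul (f a) z) \<le> C * M * nrm Z a"
      using bound[OF T M0] rank_one_bounded(1)[OF X zX dX MX] rank_one_bounded(1)[OF Y zY dY MY] by blast
    then have "norm (f a) \<le> (C * M / nrm Z z) * nrm Z a" if "a \<in> cset Z" for a
      using that nrm_pos[OF nZ zZ False] by (simp add: nrm_scale[OF nZ zZ] field_simps)
    then have "dual_norm Z f \<le> C * M / nrm Z z"
      using C M0 nrm_nonneg[OF nZ] by (intro dual_norm_le[OF nZ]) auto
    then show ?thesis using nrm_pos[OF nZ zZ False] by (simp add: M_def field_simps)
  qed
  then show ?thesis using C by blast
qed

text \<open>
The closure of a subspace \<open>A\<close> of \<open>X + Y\<close>, by the Hahn-Banach theorem. In
this form it depends only on the set \<open>X + Y\<close> and on its bounded functionals, which linked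
couples share.
\<close>

definition functional_closure :: "'a nspace \<Rightarrow> 'a nspace \<Rightarrow> 'a set \<Rightarrow> 'a set" where
  "functional_closure X Y A =
     {s \<in> cset (sum_space X Y). \<forall>f. dual X Y f \<and> (\<forall>a\<in>A. f a = 0) \<longrightarrow> f s = 0}"

definition dense_in :: "'a set \<Rightarrow> 'a nspace \<Rightarrow> bool" where
  "dense_in A E \<longleftrightarrow> A \<subseteq> cset E \<and> (\<forall>x\<in>cset E. \<forall>e>0. \<exists>z\<in>A. nrm E (x - z) < e)"

lemma functional_closure_commute: "functional_closure X Y A = functional_closure Y X A"
  by (simp add: functional_closure_def sum_space_commute[of X Y] dual_commute[of X Y])

lemma functional_closure_mono: "A \<subseteq> B \<Longrightarrow> functional_closure X Y A \<subseteq> functional_closure X Y B"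
  by (auto simp: functional_closure_def)

lemma functional_closure_superset:
  "A \<subseteq> cset (sum_space X Y) \<Longrightarrow> A \<subseteq> functional_closure X Y A"
  by (auto simp: functional_closure_def)

lemma functional_closure_sum:
  assumes X: "normed_space smul X" and Y: "normed_space smul Y"
    and V: "cset V \<subseteq> functional_closure X Y A" and W: "cset W \<subseteq> functional_closure X Y A"
  shows "cset (sum_space V W) \<subseteq> functional_closure X Y A"
proof
  fix s assume "s \<in> cset (sum_space V W)"
  then obtain v w where vw: "v \<in> cset V" "w \<in> cset W" "s = v + w" by (rule sum_spaceE)
  have v: "v \<in> functional_closure X Y A" and w: "w \<in> functional_closure X Y A" using vw V W by auto
  then have mem: "v \<in> cset (sum_space X Y)" "w \<in> cset (sum_space X Y)"
    by (auto simp: functional_closure_def)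
  have "f s = 0" if f: "dual X Y f" "\<forall>a\<in>A. f a = 0" for f
  proof -
    have "f v = 0" "f w = 0" using f v w by (auto simp: functional_closure_def)
    then show ?thesis using f(1) mem vw(3) by (simp add: dual_def functional_def)
  qed
  then show "s \<in> functional_closure X Y A"
    using subspace_add[OF subspace_sum_space[OF X Y] mem] by (auto simp: functional_closure_def vw(3))
qed

text \<open>
A functional that vanishes on \<open>Y\<close> may be combined with any vector of \<open>X\<close> to a
rank one couple operator. If it does not vanish on \<open>Z\<close>, the images of \<open>Z\<close>
under these operators exhaust \<open>X\<close>.
\<close>

lemma interpolation_dichotomy:
  assumes XY: "banach_couple smul X Y" and Z: "Z \<in> interpolation_spaces smul X Y"
  shows "cset X \<subseteq> cset Z \<or> cset Z \<subseteq> functional_closure X Y (cset Y)"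
proof (rule disjCI)
  assume "\<not> cset Z \<subseteq> functional_closure X Y (cset Y)"
  have X: "normed_space smul X" and Y: "normed_space smul Y"
    using XY by (auto simp: banach_couple_def intro: banach_imp_normed)
  have nZ: "normed_space smul Z" and ZS: "cset Z \<subseteq> cset (sum_space X Y)"
    using Z banach_imp_normed by (auto simp: interpolation_spaces_def intermediate_spaces_def embeds_def)
  obtain a f where a: "a \<in> cset Z" and f: "dual X Y f" and f0: "\<And>y. y \<in> cset Y \<Longrightarrow> f y = 0" and fa: "f a \<noteq> 0"
    using \<open>\<not> _\<close> ZS unfolding functional_closure_def by blast
  obtain C where C: "C \<ge> 0" "\<And>x. x \<in> cset X \<Longrightarrow> norm (f x) \<le> C * nrm X x"
    using f unfolding dual_def bounded_functional_def by blast
  show "cset X \<subseteq> cset Z"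
  proof
    fix x assume x: "x \<in> cset X"
    have "bounded_on Y (\<lambda>s. smul (f s) x)"
      unfolding bounded_on_def using f0 normed_zero[OF Y]
      by (auto simp: nrm_zero[OF Y] intro!: exI[of _ 0])
    then have "(\<lambda>s. smul (f s) x) \<in> couple_operators smul X Y"
      using f x subset_sum_space(1)[OF X Y] rank_one_bounded(2)[OF X x C order_refl]
      by (intro rank_one_operator subspace_sum_space[OF X Y]) (auto simp: dual_def)
    then have "smul (f a) x \<in> cset Z"
      using Z a by (force simp: interpolation_spaces_def)
    then have "smul (inverse (f a)) (smul (f a) x) \<in> cset Z" by (rule normed_scale[OF nZ])
    then show "x \<in> cset Z" using fa by simp
  qed
qed

text \<open>
A functional that attains the seminorm with weights 1 and 0 at \<open>x\<close> vanishes on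
\<open>Y\<close>, and for \<open>x \<in> X\<close> this seminorm is the distance from \<open>x\<close>
to \<open>X \<inter> Y\<close> in \<open>X\<close>.
\<close>

lemma dense_inter_of_functional_closure:
  assumes XY: "banach_couple smul X Y" and cl: "cset X \<subseteq> functional_closure X Y (cset Y)"
  shows "dense_in (cset X \<inter> cset Y) X"
  unfolding dense_in_def
proof (intro conjI ballI allI impI)
  have X: "normed_space smul X" and Y: "normed_space smul Y"
    using XY by (auto simp: banach_couple_def intro: banach_imp_normed)
  fix x and e :: real assume x: "x \<in> cset X" and e: "e > 0"
  show "\<exists>z\<in>cset X \<inter> cset Y. nrm X (x - z) < e"
  proof (rule ccontr)
    assume far: "\<not> ?thesis"
    have xS: "x \<in> cset (sum_space X Y)" using x subset_sum_space[OF X Y] by auto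
    have ge: "e \<le> split_norm X Y 1 0 x"
    proof (rule split_norm_greatest[OF X Y xS])
      fix x' y assume xy: "x' \<in> cset X" "y \<in> cset Y" "x = x' + y"
      have "y = x - x'" using xy by simp
      then have "y \<in> cset X \<inter> cset Y" using xy(2) normed_diff[OF X x xy(1)] by auto
      then have "e \<le> nrm X (x - y)" using far by force
      then show "e \<le> 1 * nrm X x' + 0 * nrm Y y" using xy by simp
    qed
    obtain f where f: "functional (cset (sum_space X Y)) f" "\<forall>x\<in>cset X. norm (f x) \<le> 1 * nrm X x"
      "\<forall>y\<in>cset Y. norm (f y) \<le> 0 * nrm Y y" "split_norm X Y 1 0 x \<le> norm (f x)"
      using split_functional[OF X Y _ _ xS, of 1 0] by auto
    have "dual X Y f"
      unfolding dual_def bounded_functional_def using f by (meson order_refl zero_le_one)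
    moreover have "\<forall>y\<in>cset Y. f y = 0" using f(3) by simp
    ultimately have "f x = 0" using cl x by (auto simp: functional_closure_def)
    then show False using f(4) ge e by simp
  qed
qed auto

lemma functional_closure_of_dense:
  assumes X: "normed_space smul X" and Y: "normed_space smul Y" and E: "normed_space smul E"
    and ES: "bounded_inclusion E (sum_space X Y)" and d: "dense_in A E"
  shows "cset E \<subseteq> functional_closure X Y A"
proof
  fix x assume x: "x \<in> cset E"
  have "f x = 0" if f: "dual X Y f" and f0: "\<forall>a\<in>A. f a = 0" for f
  proof (rule ccontr)
    assume fx: "f x \<noteq> 0"
    obtain C where C: "C \<ge> 0" "\<And>x. x \<in> cset E \<Longrightarrow> norm (f x) \<le> C * nrm E x"
      using dual_bounded[OF X Y f ES] unfolding bounded_functional_def by blast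
    have "norm (f x) / (C + 1) > 0" using fx C by simp
    then obtain z where z: "z \<in> A" "nrm E (x - z) < norm (f x) / (C + 1)"
      using d x unfolding dense_in_def by blast
    have zE: "z \<in> cset E" using z d by (auto simp: dense_in_def)
    have dE: "x - z \<in> cset E" by (rule normed_diff[OF E x zE])
    have "x - z \<in> cset (sum_space X Y)" "z \<in> cset (sum_space X Y)"
      using dE zE ES by (auto simp: bounded_inclusion_def)
    then have "f ((x - z) + z) = f (x - z) + f z"
      using f unfolding dual_def functional_def by blast
    then have "norm (f x) \<le> C * nrm E (x - z)" using C(2)[OF dE] z f0 by simp
    also have "\<dots> \<le> (C + 1) * nrm E (x - z)" using nrm_nonneg[OF E, of "x - z"] by (simp add: algebra_simps)
    also have "\<dots> < norm (f x)" using z C by (simp add: field_simps)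
    finally show False by simp
  qed
  then show "x \<in> functional_closure X Y A"
    using x ES by (auto simp: functional_closure_def bounded_inclusion_def)
qed

lemma dense_bound_imp_subset:
  assumes BE: "banach_space smul E" and F: "normed_space smul F" and S: "normed_space smul S"
    and ES: "bounded_inclusion E S" and FS: "bounded_inclusion F S"
    and d: "dense_in A F" and AE: "A \<subseteq> cset E" and C: "C \<ge> 0" "\<And>z. z \<in> A \<Longrightarrow> nrm E z \<le> C * nrm F z"
  shows "cset F \<subseteq> cset E"
proof (rule absorption[OF BE F S ES FS, of "2 * C"])
  fix y assume y: "y \<in> cset F"
  have E: "normed_space smul E" using BE by (rule banach_imp_normed)
  show "\<exists>x\<in>cset E. nrm E x \<le> 2 * C * nrm F y \<and> y - x \<in> cset F \<and> nrm F (y - x) \<le> nrm F y / 2"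
  proof (cases "y = 0")
    case True
    then show ?thesis using normed_zero[OF E] normed_zero[OF F] by (auto simp: nrm_zero[OF E] nrm_zero[OF F] intro!: bexI[of _ 0])
  next
    case False
    then have pos: "nrm F y / 2 > 0" using nrm_pos[OF F y] by simp
    obtain z where z: "z \<in> A" "nrm F (y - z) < nrm F y / 2"
      using d y pos unfolding dense_in_def by blast
    have zF: "z \<in> cset F" using z d by (auto simp: dense_in_def)
    have yz: "y - z \<in> cset F" by (rule normed_diff[OF F y zF])
    have "nrm F z \<le> nrm F y + nrm F (y - z)" using nrm_triangle_diff[OF F y yz] by simp
    then have "nrm F z \<le> 2 * nrm F y" using z pos by linarith
    then have "C * nrm F z \<le> C * (2 * nrm F y)" using C(1) by (rule mult_left_mono)
    then have "nrm E z \<le> 2 * C * nrm F y" using C(2)[OF z(1)] by simp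
    then show ?thesis using z yz AE by (intro bexI[of _ z]) auto
  qed
qed (use C in simp_all)

text \<open>
Since \<open>Y\<close> is not contained in \<open>X\<close>, the approximation step of the absorption
lemma fails for some \<open>y\<close>, for any given constant \<open>C\<close>. This failure says that
\<open>y\<close> has norm at most that given by the weights \<open>1 / C\<close> and 2. A functional
attaining this weighted norm at \<open>y\<close> has dual norm at most \<open>1 / C\<close> on
\<open>X\<close> and at least 1 on \<open>Y\<close>.
\<close>

lemma functional_ratio_unbounded:
  assumes XY: "banach_couple smul X Y" and ne: "\<not> cset Y \<subseteq> cset X" and R: "R \<ge> 0"
  shows "\<exists>f. dual X Y f \<and> R * dual_norm X f < dual_norm Y f"
proof -
  have BX: "banach_space smul X" and X: "normed_space smul X" and Y: "normed_space smul Y"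
    using XY by (auto simp: banach_couple_def intro: banach_imp_normed)
  define C where "C = R + 1"
  have C: "C > 0" using R by (simp add: C_def)
  obtain y where y: "y \<in> cset Y" and no: "\<And>x. x \<in> cset X \<Longrightarrow> nrm X x \<le> C * nrm Y y \<Longrightarrow> y - x \<in> cset Y \<Longrightarrow>
      \<not> nrm Y (y - x) \<le> nrm Y y / 2"
    using absorption[OF BX Y sum_space_normed[OF XY] sum_space_inclusion[OF X Y], of C] ne C by force
  have y0: "y \<noteq> 0"
  proof
    assume "y = 0"
    then show False using no[OF normed_zero[OF X]] normed_zero[OF Y] by (simp add: nrm_zero[OF X] nrm_zero[OF Y])
  qed
  have yS: "y \<in> cset (sum_space X Y)" using y subset_sum_space[OF X Y] by auto
  have ge: "nrm Y y \<le> split_norm X Y (1/C) 2 y"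
  proof (rule split_norm_greatest[OF X Y yS])
    fix x' y' assume xy: "x' \<in> cset X" "y' \<in> cset Y" "y = x' + y'"
    show "nrm Y y \<le> 1/C * nrm X x' + 2 * nrm Y y'"
    proof (rule ccontr)
      assume lt: "\<not> ?thesis"
      have nn: "0 \<le> 1/C * nrm X x'" "0 \<le> nrm Y y'" using C nrm_nonneg[OF X, of x'] nrm_nonneg[OF Y, of y'] by auto
      have "1/C * nrm X x' \<le> nrm Y y" using lt nn by linarith
      then have "nrm X x' \<le> C * nrm Y y" using C by (simp add: field_simps)
      moreover have "y - x' = y'" using xy by simp
      ultimately show False using no[OF xy(1)] xy(2) lt nn by auto
    qed
  qed
  obtain f where f: "functional (cset (sum_space X Y)) f" "\<forall>x\<in>cset X. norm (f x) \<le> 1/C * nrm X x"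
    "\<forall>y\<in>cset Y. norm (f y) \<le> 2 * nrm Y y" "split_norm X Y (1/C) 2 y \<le> norm (f y)"
    using split_functional[OF X Y _ _ yS, of "1/C" 2] C by auto
  have fX: "bounded_functional X f" and fY: "bounded_functional Y f"
    unfolding bounded_functional_def using f(2,3) C by (meson divide_nonneg_pos zero_le_one zero_le_numeral)+
  have "dual_norm X f \<le> 1/C" using f(2) C by (intro dual_norm_le[OF X]) auto
  then have "R * dual_norm X f \<le> R * (1/C)" using R by (rule mult_left_mono)
  also have "\<dots> < 1" using C by (simp add: C_def)
  also have "1 \<le> dual_norm Y f"
  proof -
    have "1 * nrm Y y \<le> dual_norm Y f * nrm Y y"
      using dual_norm_bound[OF Y f(1) subset_sum_space(2)[OF X Y] fY y] f(4) ge by linarith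
    then show ?thesis using nrm_pos[OF Y y y0] by (simp only: mult_le_cancel_right)
  qed
  finally show ?thesis using f(1) fX fY unfolding dual_def by blast
qed

lemma vector_ratio_unbounded:
  assumes XY: "banach_couple smul X Y" and ne: "\<not> cset Y \<subseteq> cset X" and R: "R \<ge> 0"
    and d: "dense_in (cset X \<inter> cset Y) Y"
  shows "\<exists>z\<in>cset X \<inter> cset Y. R * nrm Y z < nrm X z"
proof (rule ccontr)
  assume "\<not> ?thesis"
  then have le: "\<And>z. z \<in> cset X \<inter> cset Y \<Longrightarrow> nrm X z \<le> R * nrm Y z" by (meson not_le)
  have BX: "banach_space smul X" and X: "normed_space smul X" and Y: "normed_space smul Y"
    using XY by (auto simp: banach_couple_def intro: banach_imp_normed)
  have "cset Y \<subseteq> cset X"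
    by (rule dense_bound_imp_subset[OF BX Y sum_space_normed[OF XY] sum_space_inclusion[OF X Y] d _ R le]) auto
  then show False using ne by blast
qed

end

section \<open>Tropical matrices of rank two\<close>

text \<open>
Each of the two differences is a function of \<open>a - b\<close> alone, piecewise linear with slopes
0 and 1 or 0 and -1.
\<close>

lemma max_difference_lipschitz:
  fixes a1 a2 b1 b2 p q r s :: real
  shows "\<bar>(max (a1 + p) (b1 + q) - max (a1 + r) (b1 + s)) - (max (a2 + p) (b2 + q) - max (a2 + r) (b2 + s))\<bar>
    \<le> \<bar>(a1 - b1) - (a2 - b2)\<bar>"
  by (smt (verit))

text \<open>
For large \<open>a i - b i\<close> the entries in row \<open>i\<close> are
\<open>a i + c j\<close> and \<open>a' i + c' j\<close>, which compares \<open>c\<close> with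
\<open>c'\<close>. For very negative \<open>a i - b i\<close> they compare \<open>d\<close> with
\<open>d'\<close>. So \<open>d' - c'\<close> is unbounded together with \<open>d - c\<close>, and
columns with extreme differences compare \<open>a\<close> with \<open>a'\<close> and \<open>b\<close>
with \<open>b'\<close>.
\<close>

lemma tropical_rigidity_oriented:
  fixes a b a' b' :: "'i \<Rightarrow> real" and c d c' d' :: "'j \<Rightarrow> real"
  assumes M: "\<And>i j. i \<in> I \<Longrightarrow> j \<in> J \<Longrightarrow>
      \<bar>max (a i + c j) (b i + d j) - max (a' i + c' j) (b' i + d' j)\<bar> \<le> L"
    and up: "\<And>B. \<exists>i\<in>I. B < a i - b i \<and> B < a' i - b' i"
    and down: "\<And>B. \<exists>i\<in>I. a i - b i < B \<and> a' i - b' i < B"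
    and eup: "\<And>B. \<exists>j\<in>J. B < d j - c j" and edown: "\<And>B. \<exists>j\<in>J. d j - c j < B"
  shows "\<exists>K. \<forall>i\<in>I. \<bar>a' i - a i\<bar> \<le> K \<and> \<bar>b' i - b i\<bar> \<le> K"
proof -
  have c: "\<bar>(c' j - c' k) - (c j - c k)\<bar> \<le> 2 * L" and d: "\<bar>(d' j - d' k) - (d j - d k)\<bar> \<le> 2 * L"
    if jk: "j \<in> J" "k \<in> J" for j k
  proof -
    define B where "B = \<bar>d j - c j\<bar> + \<bar>d k - c k\<bar> + \<bar>d' j - c' j\<bar> + \<bar>d' k - c' k\<bar>"
    obtain i where i: "i \<in> I" "B < a i - b i" "B < a' i - b' i" using up by blast
    show "\<bar>(c' j - c' k) - (c j - c k)\<bar> \<le> 2 * L"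
      using M[OF i(1) jk(1)] M[OF i(1) jk(2)] i(2,3) unfolding B_def by (smt (verit))
    obtain i where i: "i \<in> I" "a i - b i < - B" "a' i - b' i < - B" using down by blast
    show "\<bar>(d' j - d' k) - (d j - d k)\<bar> \<le> 2 * L"
      using M[OF i(1) jk(1)] M[OF i(1) jk(2)] i(2,3) unfolding B_def by (smt (verit))
  qed
  obtain j0 where j0: "j0 \<in> J" using eup[of 0] by blast
  obtain i0 where i0: "i0 \<in> I" using up[of 0] by blast
  define D where "D = \<bar>d' j0 - c' j0\<bar> + \<bar>d j0 - c j0\<bar> + 4 * L"
  have near: "\<bar>(d' j - c' j) - (d j - c j)\<bar> \<le> D" if "j \<in> J" for j
    using c[OF that j0] d[OF that j0] unfolding D_def by (smt (verit))
  have "\<bar>(b' i - b' i0) - (b i - b i0)\<bar> \<le> 2 * L \<and> \<bar>(a' i - a' i0) - (a i - a i0)\<bar> \<le> 2 * L" if i: "i \<in> I" for i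
  proof
    define B where "B = \<bar>a i - b i\<bar> + \<bar>a i0 - b i0\<bar> + \<bar>a' i - b' i\<bar> + \<bar>a' i0 - b' i0\<bar> + \<bar>D\<bar>"
    obtain j where j: "j \<in> J" "B < d j - c j" using eup by blast
    show "\<bar>(b' i - b' i0) - (b i - b i0)\<bar> \<le> 2 * L"
      using M[OF i j(1)] M[OF i0 j(1)] j(2) near[OF j(1)] unfolding B_def by (smt (verit))
    obtain j where j: "j \<in> J" "d j - c j < - B" using edown by blast
    show "\<bar>(a' i - a' i0) - (a i - a i0)\<bar> \<le> 2 * L"
      using M[OF i j(1)] M[OF i0 j(1)] j(2) near[OF j(1)] unfolding B_def by (smt (verit))
  qed
  then have "\<bar>a' i - a i\<bar> \<le> 2 * L + \<bar>a' i0 - a i0\<bar> + \<bar>b' i0 - b i0\<bar> \<and>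
      \<bar>b' i - b i\<bar> \<le> 2 * L + \<bar>a' i0 - a i0\<bar> + \<bar>b' i0 - b i0\<bar>" if "i \<in> I" for i
    using that by fastforce
  then show ?thesis by blast
qed

text \<open>
Two columns with very negative and very large \<open>d - c\<close> recover \<open>a - b\<close>, and
this shows that distances between values of \<open>a' - b'\<close> are at least those between values
of \<open>a - b\<close>, up to a constant. Rows where \<open>a - b\<close> is large in absolute
value are thus rows where \<open>a' - b'\<close> is. Two columns \<open>j\<close>, \<open>k\<close>
with sufficiently different \<open>d - c\<close> tell apart rows with large and with very negative
\<open>a - b\<close>, whereas they cannot tell apart rows on which \<open>a' - b'\<close> is extreme
with the same sign. So \<open>a' - b'\<close> goes to infinity in opposite directions at the two ends,
and up to exchanging \<open>a'\<close> with \<open>b'\<close> the oriented case applies.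
\<close>

lemma tropical_rigidity:
  fixes a b a' b' :: "'i \<Rightarrow> real" and c d c' d' :: "'j \<Rightarrow> real"
  assumes M: "\<And>i j. i \<in> I \<Longrightarrow> j \<in> J \<Longrightarrow>
      \<bar>max (a i + c j) (b i + d j) - max (a' i + c' j) (b' i + d' j)\<bar> \<le> L"
    and up: "\<And>B. \<exists>i\<in>I. B < a i - b i" and down: "\<And>B. \<exists>i\<in>I. a i - b i < B"
    and eup: "\<And>B. \<exists>j\<in>J. B < d j - c j" and edown: "\<And>B. \<exists>j\<in>J. d j - c j < B"
  shows "(\<exists>K. \<forall>i\<in>I. \<bar>a' i - a i\<bar> \<le> K \<and> \<bar>b' i - b i\<bar> \<le> K) \<or>
    (\<exists>K. \<forall>i\<in>I. \<bar>a' i - b i\<bar> \<le> K \<and> \<bar>b' i - a i\<bar> \<le> K)"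
proof -
  define N where "N i j = max (a' i + c' j) (b' i + d' j)" for i j
  have MN: "\<bar>max (a i + c j) (b i + d j) - N i j\<bar> \<le> L" if "i \<in> I" "j \<in> J" for i j
    unfolding N_def by (rule M[OF that])
  \<comment> \<open>Columns \<open>p\<close> and \<open>m\<close> see only \<open>b\<close> and only \<open>a\<close>, respectively.\<close>
  have expand: "\<bar>(a i - b i) - (a k - b k)\<bar> - 4 * L \<le> \<bar>(a' i - b' i) - (a' k - b' k)\<bar>"
    if ik: "i \<in> I" "k \<in> I" for i k
  proof -
    define B where "B = \<bar>a i - b i\<bar> + \<bar>a k - b k\<bar>"
    obtain p where p: "p \<in> J" "B < d p - c p" using eup by blast
    obtain m where m: "m \<in> J" "d m - c m < - B" using edown by blast
    have "max (a i + c p) (b i + d p) = b i + d p" "max (a k + c p) (b k + d p) = b k + d p"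
      "max (a i + c m) (b i + d m) = a i + c m" "max (a k + c m) (b k + d m) = a k + c m"
    proof -
      have "a i - b i < d p - c p" "a k - b k < d p - c p" "d m - c m < a i - b i" "d m - c m < a k - b k"
        using p(2) m(2) unfolding B_def by linarith+
      then show "max (a i + c p) (b i + d p) = b i + d p" "max (a k + c p) (b k + d p) = b k + d p"
        "max (a i + c m) (b i + d m) = a i + c m" "max (a k + c m) (b k + d m) = a k + c m"
        by (simp_all add: max_def)
    qed
    then have "\<bar>b i + d p - N i p\<bar> \<le> L" "\<bar>b k + d p - N k p\<bar> \<le> L" "\<bar>a i + c m - N i m\<bar> \<le> L" "\<bar>a k + c m - N k m\<bar> \<le> L"
      using MN[OF ik(1) p(1)] MN[OF ik(2) p(1)] MN[OF ik(1) m(1)] MN[OF ik(2) m(1)] by simp_all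
    moreover have "\<bar>(N i p - N i m) - (N k p - N k m)\<bar> \<le> \<bar>(a' i - b' i) - (a' k - b' k)\<bar>"
      unfolding N_def by (rule max_difference_lipschitz)
    ultimately show ?thesis by linarith
  qed
  obtain i0 where i0: "i0 \<in> I" using up[of 0] by blast
  have far: "\<bar>a' i - b' i\<bar> > B" if "i \<in> I" "\<bar>a i - b i\<bar> > B + \<bar>a i0 - b i0\<bar> + \<bar>a' i0 - b' i0\<bar> + 4 * L" for i B
    using expand[OF that(1) i0] that(2) by linarith
  obtain j where j: "j \<in> J" using eup[of 0] by blast
  obtain k where k: "k \<in> J" "d j - c j + 4 * L < d k - c k" using eup by blast
  define B0 where "B0 = \<bar>d' j - c' j\<bar> + \<bar>d' k - c' k\<bar>"
  define U0 where "U0 = B0 + \<bar>a i0 - b i0\<bar> + \<bar>a' i0 - b' i0\<bar> + 4 * \<bar>L\<bar> + \<bar>d j - c j\<bar> + \<bar>d k - c k\<bar>"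
  have far0: "\<bar>a' i - b' i\<bar> > B0" if "i \<in> I" "\<bar>a i - b i\<bar> > U0" for i
    using far[of i B0] that unfolding U0_def by linarith
  have opposite: "(a' p - b' p > B0 \<and> a' m - b' m < - B0) \<or> (a' p - b' p < - B0 \<and> a' m - b' m > B0)"
    if p: "p \<in> I" "a p - b p > U0" and m: "m \<in> I" "a m - b m < - U0" for p m
  proof -
    have U: "\<bar>d j - c j\<bar> + \<bar>d k - c k\<bar> \<le> U0" by (simp add: U0_def B0_def)
    have "max (a p + c j) (b p + d j) = a p + c j" "max (a p + c k) (b p + d k) = a p + c k"
      "max (a m + c j) (b m + d j) = b m + d j" "max (a m + c k) (b m + d k) = b m + d k"
    proof -
      have "d j - c j < a p - b p" "d k - c k < a p - b p" "a m - b m < d j - c j" "a m - b m < d k - c k"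
        using p(2) m(2) U by linarith+
      then show "max (a p + c j) (b p + d j) = a p + c j" "max (a p + c k) (b p + d k) = a p + c k"
        "max (a m + c j) (b m + d j) = b m + d j" "max (a m + c k) (b m + d k) = b m + d k"
        by (simp_all add: max_def)
    qed
    then have "\<bar>a p + c j - N p j\<bar> \<le> L" "\<bar>a p + c k - N p k\<bar> \<le> L" "\<bar>b m + d j - N m j\<bar> \<le> L" "\<bar>b m + d k - N m k\<bar> \<le> L"
      using MN[OF p(1) j] MN[OF p(1) k(1)] MN[OF m(1) j] MN[OF m(1) k(1)] by simp_all
    then have gap: "N p k - N p j \<noteq> N m k - N m j" using k(2) by linarith
    have "U0 \<ge> 0" by (simp add: U0_def B0_def)
    then have "\<bar>a' p - b' p\<bar> > B0" "\<bar>a' m - b' m\<bar> > B0" using far0 p m by auto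
    moreover have plus: "N i k - N i j = c' k - c' j" if "a' i - b' i > B0" for i
    proof -
      have "d' j - c' j < a' i - b' i" "d' k - c' k < a' i - b' i" using that unfolding B0_def by linarith+
      then show ?thesis by (simp add: N_def max_def)
    qed
    moreover have minus: "N i k - N i j = d' k - d' j" if "a' i - b' i < - B0" for i
    proof -
      have "a' i - b' i < d' j - c' j" "a' i - b' i < d' k - c' k" using that unfolding B0_def by linarith+
      then show ?thesis by (simp add: N_def max_def)
    qed
    ultimately show ?thesis using gap plus[of p] plus[of m] minus[of p] minus[of m] by argo
  qed
  have U0: "U0 \<ge> 0" and B0: "B0 \<ge> 0" by (auto simp: U0_def B0_def)
  obtain p0 where p0: "p0 \<in> I" "a p0 - b p0 > U0" using up by blast
  obtain m0 where m0: "m0 \<in> I" "a m0 - b m0 < - U0" using down by blast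
  have "(\<forall>B. (\<exists>i\<in>I. B < a i - b i \<and> B < a' i - b' i) \<and> (\<exists>i\<in>I. a i - b i < B \<and> a' i - b' i < B)) \<or>
    (\<forall>B. (\<exists>i\<in>I. B < a i - b i \<and> B < b' i - a' i) \<and> (\<exists>i\<in>I. a i - b i < B \<and> b' i - a' i < B))"
  proof -
    have large: "\<exists>p\<in>I. a p - b p > U0 \<and> B < a p - b p \<and> B < \<bar>a' p - b' p\<bar>" for B
    proof -
      obtain p where p: "p \<in> I" "a p - b p > U0 + \<bar>B\<bar> + \<bar>a i0 - b i0\<bar> + \<bar>a' i0 - b' i0\<bar> + 4 * \<bar>L\<bar>" using up by blast
      then have "a p - b p > U0" "a p - b p > B" "\<bar>a p - b p\<bar> > B + \<bar>a i0 - b i0\<bar> + \<bar>a' i0 - b' i0\<bar> + 4 * L"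
        using U0 by linarith+
      then show ?thesis using far[OF p(1), of B] p(1) by blast
    qed
    have small: "\<exists>m\<in>I. a m - b m < - U0 \<and> a m - b m < B \<and> - B < \<bar>a' m - b' m\<bar>" for B
    proof -
      obtain m where m: "m \<in> I" "a m - b m < - (U0 + \<bar>B\<bar> + \<bar>a i0 - b i0\<bar> + \<bar>a' i0 - b' i0\<bar> + 4 * \<bar>L\<bar>)" using down by blast
      then have "a m - b m < - U0" "a m - b m < B" "\<bar>a m - b m\<bar> > - B + \<bar>a i0 - b i0\<bar> + \<bar>a' i0 - b' i0\<bar> + 4 * L"
        using U0 by linarith+
      then show ?thesis using far[OF m(1), of "- B"] m(1) by blast
    qed
    show ?thesis
    proof (cases "a' p0 - b' p0 > B0")
      case True
      have neg: "a' m - b' m < - B0" if "m \<in> I" "a m - b m < - U0" for m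
        using opposite[OF p0 that] True B0 by linarith
      have pos: "a' p - b' p > B0" if "p \<in> I" "a p - b p > U0" for p
        using opposite[OF that m0] neg[OF m0] B0 by linarith
      have "\<exists>i\<in>I. B < a i - b i \<and> B < a' i - b' i" for B
      proof -
        obtain p where p: "p \<in> I" "a p - b p > U0" "B < a p - b p" "B < \<bar>a' p - b' p\<bar>" using large by blast
        show ?thesis using p pos[OF p(1,2)] B0 by (intro bexI[of _ p] conjI) linarith+
      qed
      moreover have "\<exists>i\<in>I. a i - b i < B \<and> a' i - b' i < B" for B
      proof -
        obtain m where m: "m \<in> I" "a m - b m < - U0" "a m - b m < B" "- B < \<bar>a' m - b' m\<bar>" using small by blast
        show ?thesis using m neg[OF m(1,2)] B0 by (intro bexI[of _ m] conjI) linarith+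
      qed
      ultimately show ?thesis by blast
    next
      case False
      have pos: "a' m - b' m > B0" if "m \<in> I" "a m - b m < - U0" for m
        using opposite[OF p0 that] False B0 by linarith
      have neg: "a' p - b' p < - B0" if "p \<in> I" "a p - b p > U0" for p
        using opposite[OF that m0] pos[OF m0] B0 by linarith
      have "\<exists>i\<in>I. B < a i - b i \<and> B < b' i - a' i" for B
      proof -
        obtain p where p: "p \<in> I" "a p - b p > U0" "B < a p - b p" "B < \<bar>a' p - b' p\<bar>" using large by blast
        show ?thesis using p neg[OF p(1,2)] B0 by (intro bexI[of _ p] conjI) linarith+
      qed
      moreover have "\<exists>i\<in>I. a i - b i < B \<and> b' i - a' i < B" for B
      proof -
        obtain m where m: "m \<in> I" "a m - b m < - U0" "a m - b m < B" "- B < \<bar>a' m - b' m\<bar>" using small by blast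
        show ?thesis using m pos[OF m(1,2)] B0 by (intro bexI[of _ m] conjI) linarith+
      qed
      ultimately show ?thesis by blast
    qed
  qed
  then show ?thesis
  proof
    assume s: "\<forall>B. (\<exists>i\<in>I. B < a i - b i \<and> B < a' i - b' i) \<and> (\<exists>i\<in>I. a i - b i < B \<and> a' i - b' i < B)"
    have "\<exists>K. \<forall>i\<in>I. \<bar>a' i - a i\<bar> \<le> K \<and> \<bar>b' i - b i\<bar> \<le> K"
      by (rule tropical_rigidity_oriented[OF M _ _ eup edown]) (use s in auto)
    then show ?thesis by blast
  next
    assume s: "\<forall>B. (\<exists>i\<in>I. B < a i - b i \<and> B < b' i - a' i) \<and> (\<exists>i\<in>I. a i - b i < B \<and> b' i - a' i < B)"
    have "\<exists>K. \<forall>i\<in>I. \<bar>b' i - a i\<bar> \<le> K \<and> \<bar>a' i - b i\<bar> \<le> K"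
      by (rule tropical_rigidity_oriented[where c=c and d=d and c'=d' and d'=c' and J=J and L=L, OF _ _ _ eup edown])
        (use s M in \<open>auto simp: max.commute\<close>)
    then show ?thesis by blast
  qed
qed

section \<open>Couples that interpolate between each other\<close>

context scalar_space
begin

text \<open>
Equality of the two collections of interpolation spaces implies this relation, which is symmetric under
exchanging the couples or the components of either couple.
\<close>

definition linked :: "'a nspace \<Rightarrow> 'a nspace \<Rightarrow> 'a nspace \<Rightarrow> 'a nspace \<Rightarrow> bool" where
  "linked X Y V W \<longleftrightarrow> banach_couple smul X Y \<and> banach_couple smul V W \<and>
     {V, W} \<subseteq> interpolation_spaces smul X Y \<and> {X, Y} \<subseteq> interpolation_spaces smul V W"

lemma linked_swap:
  assumes "linked X Y V W"
  shows "linked V W X Y" "linked Y X V W" "linked X Y W V"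
  using assms banach_couple_commute interpolation_spaces_commute[of X Y] interpolation_spaces_commute[of V W]
  by (auto simp: linked_def)

lemma interpolation_space_facts:
  assumes XY: "banach_couple smul X Y" and V: "V \<in> interpolation_spaces smul X Y"
  shows "banach_space smul V" "bounded_inclusion V (sum_space X Y)" "cset X \<inter> cset Y \<subseteq> cset V"
  using V embeds_iff_bounded_inclusion[OF _ sum_space_normed[OF XY], of V] banach_imp_normed[of smul V]
  by (auto simp: interpolation_spaces_def intermediate_spaces_def embeds_def inter_space_def)

lemma linked_subset:
  assumes l: "linked X Y V W"
  shows "cset X \<inter> cset Y \<subseteq> cset V \<inter> cset W" "cset (sum_space V W) \<subseteq> cset (sum_space X Y)"
proof -
  have XY: "banach_couple smul X Y" and V: "V \<in> interpolation_spaces smul X Y"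
    and W: "W \<in> interpolation_spaces smul X Y" using l by (auto simp: linked_def)
  show "cset X \<inter> cset Y \<subseteq> cset V \<inter> cset W"
    using interpolation_space_facts(3)[OF XY V] interpolation_space_facts(3)[OF XY W] by blast
  have sub: "cset V \<subseteq> cset (sum_space X Y)" "cset W \<subseteq> cset (sum_space X Y)"
    using interpolation_space_facts(2)[OF XY V] interpolation_space_facts(2)[OF XY W]
    by (auto simp: bounded_inclusion_def)
  show "cset (sum_space V W) \<subseteq> cset (sum_space X Y)"
  proof
    fix z assume "z \<in> cset (sum_space V W)"
    then obtain v w where "v \<in> cset V" "w \<in> cset W" "z = v + w" by (rule sum_spaceE)
    then show "z \<in> cset (sum_space X Y)"
      using normed_add[OF sum_space_normed[OF XY]] sub by blast
  qed
qed

lemma linked_inter: "linked X Y V W \<Longrightarrow> cset V \<inter> cset W = cset X \<inter> cset Y"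
  using linked_subset(1)[of X Y V W] linked_subset(1)[of V W X Y] linked_swap(1) by blast

lemma linked_sum: "linked X Y V W \<Longrightarrow> cset (sum_space V W) = cset (sum_space X Y)"
  using linked_subset(2)[of X Y V W] linked_subset(2)[of V W X Y] linked_swap(1) by blast

lemma linked_spaces:
  assumes l: "linked X Y V W" and E: "E \<in> {X, Y, V, W}"
  shows "banach_space smul E" "normed_space smul E" "bounded_inclusion E (sum_space X Y)"
proof -
  have XY: "banach_couple smul X Y" and V: "V \<in> interpolation_spaces smul X Y"
    and W: "W \<in> interpolation_spaces smul X Y" using l by (auto simp: linked_def)
  have BX: "banach_space smul X" and BY: "banach_space smul Y" using XY by (auto simp: banach_couple_def)
  show B: "banach_space smul E"
    using E BX BY interpolation_space_facts(1)[OF XY V] interpolation_space_facts(1)[OF XY W] by auto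
  show "normed_space smul E" using B by (rule banach_imp_normed)
  show "bounded_inclusion E (sum_space X Y)"
    using E sum_space_inclusion[OF banach_imp_normed[OF BX] banach_imp_normed[OF BY]]
      interpolation_space_facts(2)[OF XY V] interpolation_space_facts(2)[OF XY W] by auto
qed

lemma linked_couple:
  "linked X Y V W \<Longrightarrow> banach_couple smul X Y" "linked X Y V W \<Longrightarrow> banach_couple smul V W"
  "linked X Y V W \<Longrightarrow> normed_space smul (sum_space X Y)"
  using sum_space_normed by (auto simp: linked_def)

lemma linked_dual:
  assumes l: "linked X Y V W"
  shows "dual V W f \<longleftrightarrow> dual X Y f"
proof -
  have *: "dual V W f" if l: "linked X Y V W" and f: "dual X Y f" for X Y V W
    using f dual_bounded[OF linked_spaces(2)[OF l] linked_spaces(2)[OF l] f linked_spaces(3)[OF l, of V]]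
      dual_bounded[OF linked_spaces(2)[OF l] linked_spaces(2)[OF l] f linked_spaces(3)[OF l, of W]]
    by (simp add: dual_def linked_sum[OF l])
  show ?thesis using *[OF l] *[OF linked_swap(1)[OF l]] by blast
qed

lemma linked_closure: "linked X Y V W \<Longrightarrow> functional_closure V W A = functional_closure X Y A"
  by (simp add: functional_closure_def linked_sum linked_dual)

lemma linked_subset_bound:
  assumes l: "linked X Y V W" and "E \<in> {X, Y, V, W}" "F \<in> {X, Y, V, W}" and sub: "cset E \<subseteq> cset F"
  shows "bounded_inclusion E F"
  using subset_imp_bounded_inclusion[OF linked_spaces(1)[OF l assms(2)] linked_spaces(1)[OF l assms(3)]
      linked_couple(3)[OF l] linked_spaces(3)[OF l assms(2)] linked_spaces(3)[OF l assms(3)] sub] .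

lemma linked_dense_bound_subset:
  assumes l: "linked X Y V W" and E: "E \<in> {X, Y, V, W}" and F: "F \<in> {X, Y, V, W}"
    and d: "dense_in (cset X \<inter> cset Y) F" and le: "\<And>z. z \<in> cset X \<inter> cset Y \<Longrightarrow> nrm E z \<le> C * nrm F z" and C: "C \<ge> 0"
  shows "cset F \<subseteq> cset E"
proof (rule dense_bound_imp_subset[OF linked_spaces(1)[OF l E] linked_spaces(2)[OF l F]
      linked_couple(3)[OF l] linked_spaces(3)[OF l E] linked_spaces(3)[OF l F] d _ C le])
  show "cset X \<inter> cset Y \<subseteq> cset E" using E linked_inter[OF l] by auto
qed

lemma linked_dual_norm:
  assumes l: "linked X Y V W" and E: "E \<in> {X, Y, V, W}" and f: "dual X Y f"
  shows "0 \<le> dual_norm E f" "\<And>x. x \<in> cset E \<Longrightarrow> norm (f x) \<le> dual_norm E f * nrm E x"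
proof -
  have b: "bounded_functional E f"
    by (rule dual_bounded[OF linked_spaces(2)[OF l] linked_spaces(2)[OF l] f linked_spaces(3)[OF l E]]) auto
  have S: "functional (cset (sum_space X Y)) f" using f by (simp add: dual_def)
  have sub: "cset E \<subseteq> cset (sum_space X Y)" using linked_spaces(3)[OF l E] by (simp add: bounded_inclusion_def)
  show "0 \<le> dual_norm E f" by (rule dual_norm_nonneg[OF linked_spaces(2)[OF l E] S sub b])
  show "norm (f x) \<le> dual_norm E f * nrm E x" if "x \<in> cset E" for x
    by (rule dual_norm_bound[OF linked_spaces(2)[OF l E] S sub b that])
qed

text \<open>
When \<open>dual_norm Y f\<close> is much larger than \<open>dual_norm X f\<close>, the estimates
for rank one operators only see \<open>Y\<close> and \<open>W\<close>: they give
\<open>dual_norm W f * nrm W z \<le> C * dual_norm Y f * nrm Y z\<close>, and the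
opposite inequality at a fixed vector \<open>z0\<close>. Dividing the two leaves a bound of
\<open>nrm W z\<close> by a multiple of \<open>nrm Y z\<close> in which \<open>f\<close> no longer
occurs.
\<close>

lemma common_component_subset:
  assumes l: "linked X Y V W" and VX: "cset V = cset X" and ne: "\<not> cset Y \<subseteq> cset X"
    and d: "dense_in (cset X \<inter> cset Y) Y"
  shows "cset Y \<subseteq> cset W"
proof -
  let ?I = "cset X \<inter> cset Y"
  have X: "normed_space smul X" and Y: "normed_space smul Y" and V: "normed_space smul V" and W: "normed_space smul W"
    using linked_spaces(2)[OF l] by auto
  obtain y where y: "y \<in> cset Y" "y \<noteq> 0" using ne normed_zero[OF X] by auto
  obtain z0 where z0: "z0 \<in> ?I" "nrm Y (y - z0) < nrm Y y"
    using d y nrm_pos[OF Y y] unfolding dense_in_def by blast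
  have "z0 \<noteq> 0" using z0(2) by auto
  then have p0: "nrm Y z0 > 0" using z0(1) by (intro nrm_pos[OF Y]) auto
  obtain C1 where C1: "C1 > 0" and K1: "\<And>f z. dual X Y f \<Longrightarrow> z \<in> ?I \<Longrightarrow>
      dual_norm W f * nrm W z \<le> C1 * max (dual_norm X f * nrm X z) (dual_norm Y f * nrm Y z)"
    using rank_one_estimate[of X Y W] l unfolding linked_def by blast
  obtain C2 where C2: "C2 > 0" and K2': "\<And>f z. dual V W f \<Longrightarrow> z \<in> cset V \<inter> cset W \<Longrightarrow>
      dual_norm Y f * nrm Y z \<le> C2 * max (dual_norm V f * nrm V z) (dual_norm W f * nrm W z)"
    using rank_one_estimate[of V W Y] l unfolding linked_def by blast
  have K2: "dual_norm Y f * nrm Y z0 \<le> C2 * max (dual_norm V f * nrm V z0) (dual_norm W f * nrm W z0)"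
    if "dual X Y f" for f
    using K2'[of f z0] that z0(1) linked_dual[OF l] linked_inter[OF l] by blast
  obtain C3 where C3: "C3 \<ge> 0" "\<And>x. x \<in> cset V \<Longrightarrow> nrm X x \<le> C3 * nrm V x"
    using linked_subset_bound[OF l, of V X] VX unfolding bounded_inclusion_def by auto
  have dV: "dual_norm V f \<le> C3 * dual_norm X f" if f: "dual X Y f" for f
  proof (rule dual_norm_le[OF V])
    note b = linked_dual_norm[OF l _ f, of X, simplified]
    show "0 \<le> C3 * dual_norm X f" using C3(1) b(1) by simp
    show "norm (f x) \<le> C3 * dual_norm X f * nrm V x" if x: "x \<in> cset V" for x
    proof -
      have "norm (f x) \<le> dual_norm X f * nrm X x" using b(2) x VX by simp
      also have "\<dots> \<le> dual_norm X f * (C3 * nrm V x)" using C3(2)[OF x] b(1) by (rule mult_left_mono)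
      finally show ?thesis by (simp add: mult_ac)
    qed
  qed
  define K where "K = C1 * C2 * nrm W z0 / nrm Y z0"
  have K0: "K \<ge> 0" using C1 C2 p0 nrm_nonneg[OF W] by (simp add: K_def)
  have "nrm W z \<le> K * nrm Y z" if z: "z \<in> ?I" for z
  proof (cases "z = 0")
    case True
    then show ?thesis by (simp add: nrm_zero[OF W] nrm_zero[OF Y])
  next
    case False
    have pz: "nrm Y z > 0" using z False by (intro nrm_pos[OF Y]) auto
    \<comment> \<open>The first summand makes \<open>Y\<close> dominate \<open>X\<close> at \<open>z\<close>, the second makes \<open>W\<close> dominate \<open>V\<close> at \<open>z0\<close>.\<close>
    define R where "R = nrm X z / nrm Y z + C2 * C3 * nrm V z0 / nrm Y z0"
    have r1: "nrm X z / nrm Y z \<ge> 0" and r2: "C2 * C3 * nrm V z0 / nrm Y z0 \<ge> 0"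
      using pz p0 C2 C3 nrm_nonneg[OF X] nrm_nonneg[OF V] by auto
    obtain f where f: "dual X Y f" "R * dual_norm X f < dual_norm Y f"
      using functional_ratio_unbounded[OF linked_couple(1)[OF l] ne, of R] r1 r2 unfolding R_def by auto
    have X0: "0 \<le> dual_norm X f" and W0: "0 \<le> dual_norm W f" and Y0: "0 \<le> dual_norm Y f"
      using linked_dual_norm(1)[OF l _ f(1)] by auto
    have "nrm X z / nrm Y z * dual_norm X f \<le> R * dual_norm X f"
      using r2 X0 by (intro mult_right_mono) (auto simp: R_def)
    then have "nrm X z / nrm Y z * dual_norm X f \<le> dual_norm Y f" using f(2) by linarith
    then have "dual_norm X f * nrm X z \<le> dual_norm Y f * nrm Y z" using pz by (simp add: field_simps)
    then have k1: "dual_norm W f * nrm W z \<le> C1 * (dual_norm Y f * nrm Y z)"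
      using K1[OF f(1) z] by (simp add: max_def split: if_splits)
    have "C2 * C3 * nrm V z0 / nrm Y z0 * dual_norm X f \<le> R * dual_norm X f"
      using r1 X0 by (intro mult_right_mono) (auto simp: R_def)
    then have "C2 * C3 * nrm V z0 / nrm Y z0 * dual_norm X f < dual_norm Y f" using f(2) by linarith
    then have "C2 * C3 * nrm V z0 * dual_norm X f < dual_norm Y f * nrm Y z0"
      using p0 by (simp add: field_simps)
    moreover have "C2 * (dual_norm V f * nrm V z0) \<le> C2 * ((C3 * dual_norm X f) * nrm V z0)"
      using C2 dV[OF f(1)] nrm_nonneg[OF V] by (intro mult_left_mono mult_right_mono) auto
    ultimately have lt: "C2 * (dual_norm V f * nrm V z0) < dual_norm Y f * nrm Y z0"
      by (simp add: mult_ac)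
    have k2: "dual_norm Y f * nrm Y z0 \<le> C2 * (dual_norm W f * nrm W z0)"
    proof (rule ccontr)
      assume "\<not> ?thesis"
      with lt have "C2 * max (dual_norm V f * nrm V z0) (dual_norm W f * nrm W z0) < dual_norm Y f * nrm Y z0"
        by (simp add: max_def)
      then show False using K2[OF f(1)] by linarith
    qed
    have "R \<ge> 0" using r1 r2 by (simp add: R_def)
    then have "0 \<le> R * dual_norm X f" using X0 by (rule mult_nonneg_nonneg)
    then have "dual_norm Y f > 0" using f(2) by linarith
    then have "0 < C2 * (dual_norm W f * nrm W z0)" using k2 p0 mult_pos_pos[of "dual_norm Y f" "nrm Y z0"] by linarith
    then have W1: "dual_norm W f > 0" using W0 by (cases "dual_norm W f = 0") auto
    have yy: "dual_norm Y f \<le> C2 * (dual_norm W f * nrm W z0) / nrm Y z0" using k2 p0 by (simp add: field_simps)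
    have "C1 * (dual_norm Y f * nrm Y z) \<le> C1 * ((C2 * (dual_norm W f * nrm W z0) / nrm Y z0) * nrm Y z)"
      using C1 pz yy by (intro mult_left_mono mult_right_mono) auto
    also have "\<dots> = dual_norm W f * (K * nrm Y z)" by (simp add: K_def)
    finally have "dual_norm W f * nrm W z \<le> dual_norm W f * (K * nrm Y z)" using k1 by linarith
    then show ?thesis using W1 by simp
  qed
  then show ?thesis by (intro linked_dense_bound_subset[OF l _ _ d _ K0, of W]) auto
qed

lemma common_component:
  assumes l: "linked X Y V W" and VX: "cset V = cset X"
    and dY: "dense_in (cset X \<inter> cset Y) Y" and dW: "dense_in (cset X \<inter> cset Y) W"
  shows "cset W = cset Y"
proof -
  have collapse: "cset W' = cset Y'" if l': "linked X' Y' V' W'" and V': "cset V' = cset X'" and sub: "cset Y' \<subseteq> cset X'"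
    for X' Y' V' W'
  proof -
    have "cset W' \<subseteq> cset (sum_space X' Y')"
      using linked_spaces(3)[OF l', of W'] by (simp add: bounded_inclusion_def)
    also have "\<dots> \<subseteq> cset X'"
      using sub normed_add[OF linked_spaces(2)[OF l', of X']] by (auto simp: cset_sum_space)
    finally show ?thesis using linked_inter[OF l'] V' sub by blast
  qed
  note l' = linked_swap(1)[OF l]
  show ?thesis
  proof (cases "cset Y \<subseteq> cset X \<or> cset W \<subseteq> cset V")
    case True
    then show ?thesis using collapse[OF l VX] collapse[OF l' VX[symmetric]] by auto
  next
    case False
    have "cset Y \<subseteq> cset W" using common_component_subset[OF l VX _ dY] False by blast
    moreover have "cset W \<subseteq> cset Y"
      using common_component_subset[OF l' VX[symmetric]] dW False unfolding linked_inter[OF l] by blast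
    ultimately show ?thesis by blast
  qed
qed

text \<open>
If \<open>Y\<close> is also not in the closure of \<open>X\<close>, one of \<open>V\<close>,
\<open>W\<close> contains \<open>Y\<close>. It cannot be \<open>V\<close>: then \<open>V\<close> would
be the whole sum and \<open>W\<close> the intersection, and the dichotomy for \<open>(V, W)\<close>
puts \<open>X\<close> into the closure of \<open>Y\<close> or \<open>Y\<close> into \<open>X\<close>. So
\<open>W\<close> contains \<open>Y\<close>, and the modular law applies. If \<open>Y\<close> is in the
closure of \<open>X\<close>, then \<open>X\<close>, and with it \<open>V\<close>, is dense in the sum.
Therefore \<open>V\<close> is not in the closure of \<open>W\<close>, as otherwise
\<open>X \<inter> Y\<close> would be dense in the sum. The dichotomy for \<open>(V, W)\<close> then
yields \<open>V = X\<close>, and \<open>common_component\<close> identifies the other component.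
\<close>

lemma nondense_component_included:
  assumes l: "linked X Y V W" and nd: "\<not> cset X \<subseteq> functional_closure X Y (cset Y)" and XV: "cset X \<subseteq> cset V"
  shows "cset X = cset V \<and> cset Y = cset W"
proof -
  let ?cl = "functional_closure X Y" and ?S = "cset (sum_space X Y)" and ?I = "cset X \<inter> cset Y"
  note l' = linked_swap(1)[OF l]
  have XY: "banach_couple smul X Y" and VW: "banach_couple smul V W" using l by (auto simp: linked_def)
  have X: "normed_space smul X" and Y: "normed_space smul Y" and V: "normed_space smul V" and W: "normed_space smul W"
    using linked_spaces(2)[OF l] by auto
  have S: "cset X \<subseteq> ?S" "cset Y \<subseteq> ?S" "cset V \<subseteq> ?S" "cset W \<subseteq> ?S"
    using linked_spaces(3)[OF l] by (auto simp: bounded_inclusion_def)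
  have I: "cset V \<inter> cset W = ?I" by (rule linked_inter[OF l])
  have clVW: "functional_closure V W A = ?cl A" for A by (rule linked_closure[OF l])
  have cl_sum: "?S \<subseteq> ?cl A" if "cset V \<subseteq> ?cl A" "cset W \<subseteq> ?cl A" for A
    using functional_closure_sum[OF X Y that] linked_sum[OF l] by simp
  have clY: "?cl ?I \<subseteq> ?cl (cset Y)" by (rule functional_closure_mono) auto
  have modular: "cset V \<subseteq> cset X" if YW: "cset Y \<subseteq> cset W"
  proof
    fix v assume v: "v \<in> cset V"
    then have "v \<in> cset (sum_space X Y)" using S(3) by blast
    then obtain x y where xy: "x \<in> cset X" "y \<in> cset Y" "v = x + y" by (rule sum_spaceE)
    have "y = v - x" using xy by simp
    then have "y \<in> cset V" using normed_diff[OF V v] xy(1) XV by auto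
    then have "y \<in> cset X" using I xy(2) YW by auto
    then show "v \<in> cset X" using xy normed_add[OF X] by simp
  qed
  show ?thesis
  proof (cases "cset Y \<subseteq> ?cl (cset X)")
    case False
    have "cset Y \<subseteq> cset V \<or> cset V \<subseteq> functional_closure Y X (cset X)"
      "cset Y \<subseteq> cset W \<or> cset W \<subseteq> functional_closure Y X (cset X)"
      using linked_swap(2)[OF l] interpolation_dichotomy[of Y X V] interpolation_dichotomy[of Y X W]
      unfolding linked_def by blast+
    then have "(cset Y \<subseteq> cset V \<or> cset V \<subseteq> ?cl (cset X)) \<and> (cset Y \<subseteq> cset W \<or> cset W \<subseteq> ?cl (cset X))"
      by (simp add: functional_closure_commute[of Y X])
    then have "cset Y \<subseteq> cset V \<or> cset Y \<subseteq> cset W" using cl_sum[of "cset X"] False S(2) by blast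
    then show ?thesis
    proof
      assume YW: "cset Y \<subseteq> cset W"
      have VX: "cset V \<subseteq> cset X" by (rule modular[OF YW])
      have "cset W \<subseteq> cset Y"
      proof
        fix w assume w: "w \<in> cset W"
        then have "w \<in> cset (sum_space X Y)" using S(4) by blast
        then obtain x y where xy: "x \<in> cset X" "y \<in> cset Y" "w = x + y" by (rule sum_spaceE)
        have "x = w - y" using xy by simp
        then have "x \<in> cset W" using normed_diff[OF W w] xy(2) YW by auto
        then have "x \<in> cset Y" using I xy(1) XV by auto
        then show "w \<in> cset Y" using xy normed_add[OF Y] by simp
      qed
      then show ?thesis using VX XV YW by blast
    next
      assume YV: "cset Y \<subseteq> cset V"
      have "?S \<subseteq> cset V" using XV YV normed_add[OF V] by (auto simp: cset_sum_space)
      then have WI: "cset W = ?I" using I S(4) by blast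
      have "cset V \<subseteq> cset X \<or> cset X \<subseteq> ?cl (cset W)"
        using interpolation_dichotomy[OF VW, of X] l by (simp add: linked_def clVW)
      then show ?thesis
      proof
        assume "cset V \<subseteq> cset X"
        then have "cset Y \<subseteq> ?cl (cset X)" using YV functional_closure_superset[OF S(1)] by blast
        then show ?thesis using False by blast
      next
        assume "cset X \<subseteq> ?cl (cset W)"
        then have "cset X \<subseteq> ?cl (cset Y)" using clY unfolding WI by (rule subset_trans)
        then show ?thesis using nd by contradiction
      qed
    qed
  next
    case True
    have Xcl: "cset X \<subseteq> ?cl (cset X)" by (rule functional_closure_superset[OF S(1)])
    have Scl: "?S \<subseteq> ?cl (cset X)" by (rule functional_closure_sum[OF X Y Xcl True])
    have WclV: "cset W \<subseteq> ?cl (cset V)" using S(4) Scl functional_closure_mono[OF XV] by blast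
    have dW: "dense_in ?I W"
      using dense_inter_of_functional_closure[of W V] banach_couple_commute[OF VW] WclV I
      by (simp add: functional_closure_commute[of W V] clVW Int_commute)
    have dY: "dense_in ?I Y"
      using dense_inter_of_functional_closure[of Y X] banach_couple_commute[OF XY] True
      by (simp add: functional_closure_commute[of Y X] Int_commute)
    have notVW: "\<not> cset V \<subseteq> ?cl (cset W)"
    proof
      assume "cset V \<subseteq> ?cl (cset W)"
      then have dV: "dense_in ?I V"
        using dense_inter_of_functional_closure[OF VW] I by (simp add: clVW)
      have "cset V \<subseteq> ?cl ?I" "cset W \<subseteq> ?cl ?I"
        using functional_closure_of_dense[OF X Y V _ dV] functional_closure_of_dense[OF X Y W _ dW]
          linked_spaces(3)[OF l] by auto
      then have "?S \<subseteq> ?cl ?I" by (rule cl_sum)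
      then show False using nd clY S(1) by blast
    qed
    have dich: "cset V \<subseteq> cset Z \<or> cset Z \<subseteq> ?cl (cset W)" if "Z \<in> {X, Y}" for Z
      using interpolation_dichotomy[OF VW, of Z] l that by (auto simp: linked_def clVW)
    have "\<not> (cset X \<subseteq> ?cl (cset W) \<and> cset Y \<subseteq> ?cl (cset W))"
      using functional_closure_sum[OF X Y, of X "cset W" Y] notVW S(3) by blast
    then have "cset V \<subseteq> cset X \<or> cset V \<subseteq> cset Y" using dich[of X] dich[of Y] by blast
    moreover have "\<not> cset V \<subseteq> cset Y"
      using XV nd functional_closure_superset[OF S(2)] by blast
    ultimately have VX: "cset V = cset X" using XV by blast
    show ?thesis using common_component[OF l VX dY dW] VX by simp
  qed
qed

lemma nondense_component:
  assumes l: "linked X Y V W" and nd: "\<not> cset X \<subseteq> functional_closure X Y (cset Y)"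
  shows "(cset X = cset V \<and> cset Y = cset W) \<or> (cset X = cset W \<and> cset Y = cset V)"
proof -
  have X: "normed_space smul X" and Y: "normed_space smul Y" using linked_spaces(2)[OF l] by auto
  have XY: "banach_couple smul X Y" using l by (simp add: linked_def)
  have "cset X \<subseteq> cset Z \<or> cset Z \<subseteq> functional_closure X Y (cset Y)" if "Z \<in> {V, W}" for Z
    using interpolation_dichotomy[OF XY, of Z] l that by (auto simp: linked_def)
  moreover have "\<not> (cset V \<subseteq> functional_closure X Y (cset Y) \<and> cset W \<subseteq> functional_closure X Y (cset Y))"
    using functional_closure_sum[OF X Y, of V "cset Y" W] nd linked_sum[OF l] subset_sum_space(1)[OF X Y] by blast
  ultimately consider "cset X \<subseteq> cset V" | "cset X \<subseteq> cset W" by blast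
  then show ?thesis
    using nondense_component_included[OF l nd] nondense_component_included[OF linked_swap(3)[OF l] nd] by cases blast+
qed

lemma dual_norm_pos:
  assumes l: "linked X Y V W" and E: "E \<in> {X, Y, V, W}" and f: "dual X Y f"
    and nz: "s \<in> cset (sum_space X Y)" "f s \<noteq> 0"
    and dX: "dense_in (cset X \<inter> cset Y) X" and dY: "dense_in (cset X \<inter> cset Y) Y"
  shows "0 < dual_norm E f"
proof (rule ccontr)
  assume "\<not> 0 < dual_norm E f"
  then have 0: "dual_norm E f = 0" using linked_dual_norm(1)[OF l E f] by linarith
  have "cset X \<inter> cset Y \<subseteq> cset E" using E linked_inter[OF l] by auto
  then have f0: "\<forall>a\<in>cset X \<inter> cset Y. f a = 0"
    using linked_dual_norm(2)[OF l E f] 0 by fastforce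
  have X: "normed_space smul X" and Y: "normed_space smul Y" using linked_spaces(2)[OF l] by auto
  have "cset (sum_space X Y) \<subseteq> functional_closure X Y (cset X \<inter> cset Y)"
    using functional_closure_of_dense[OF X Y X _ dX] functional_closure_of_dense[OF X Y Y _ dY] linked_spaces(3)[OF l]
    by (intro functional_closure_sum[OF X Y]) auto
  then show False using nz f f0 by (auto simp: functional_closure_def)
qed

lemma ln_max: "0 < x \<Longrightarrow> 0 < y \<Longrightarrow> ln (max x y) = max (ln x) (ln y)" for x y :: real
  by (auto simp: max_def)

text \<open>
In logarithms the rank one estimates compare two tropical matrices with rows \<open>z\<close> and
columns \<open>f\<close>. The rows have unbounded differences because \<open>X \<inter> Y\<close> is
dense in \<open>X\<close> and in \<open>Y\<close>, the columns because of the Hahn-Banach theorem.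
\<close>

lemma dense_components:
  assumes l: "linked X Y V W"
    and dX: "dense_in (cset X \<inter> cset Y) X" and dY: "dense_in (cset X \<inter> cset Y) Y"
    and dV: "dense_in (cset X \<inter> cset Y) V" and dW: "dense_in (cset X \<inter> cset Y) W"
    and XY: "\<not> cset X \<subseteq> cset Y" and YX: "\<not> cset Y \<subseteq> cset X"
  shows "(cset X = cset V \<and> cset Y = cset W) \<or> (cset X = cset W \<and> cset Y = cset V)"
proof -
  define I where "I = cset X \<inter> cset Y - {0}"
  define J where "J = {f. dual X Y f \<and> (\<exists>s\<in>cset (sum_space X Y). f s \<noteq> 0)}"
  have cXY: "banach_couple smul X Y" and cYX: "banach_couple smul Y X"
    using l banach_couple_commute by (auto simp: linked_def)
  have nrm_I: "nrm E z > 0" if "z \<in> I" "E \<in> {X, Y, V, W}" for z E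
    using that linked_inter[OF l] by (intro nrm_pos[OF linked_spaces(2)[OF l that(2)]]) (auto simp: I_def)
  have dual_J: "dual_norm E f > 0" if "f \<in> J" "E \<in> {X, Y, V, W}" for f E
    using that dual_norm_pos[OF l _ _ _ _ dX dY] unfolding J_def by blast
  have J_I: "f \<in> J" if f: "dual X Y f" and lt: "a * dual_norm E f < dual_norm F f"
    and EF: "E \<in> {X, Y}" "F \<in> {X, Y}" and a: "a \<ge> 0" for f a E F
  proof (rule ccontr)
    assume "f \<notin> J"
    then have z: "f s = 0" if "s \<in> cset (sum_space X Y)" for s using f that by (auto simp: J_def)
    have F: "F \<in> {X, Y, V, W}" "E \<in> {X, Y, V, W}" using EF by auto
    have "f x = 0" if "x \<in> cset F" for x
      using z linked_spaces(3)[OF l F(1)] that by (auto simp: bounded_inclusion_def)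
    then have "dual_norm F f \<le> 0" by (intro dual_norm_le[OF linked_spaces(2)[OF l F(1)]]) auto
    then show False using lt a mult_nonneg_nonneg[OF a linked_dual_norm(1)[OF l F(2) f]] by linarith
  qed
  have estimate: "\<exists>C>0. \<forall>f\<in>J. \<forall>z\<in>I. dual_norm E f * nrm E z \<le> C * max (dual_norm A f * nrm A z) (dual_norm B f * nrm B z)"
    if "(A, B, E) \<in> {(X, Y, V), (X, Y, W), (V, W, X), (V, W, Y)}" for A B E
  proof -
    have "banach_couple smul A B" "E \<in> interpolation_spaces smul A B"
      using that l by (auto simp: linked_def)
    from rank_one_estimate[OF this] obtain C where C: "C > 0" "\<And>f z. dual A B f \<Longrightarrow> z \<in> cset A \<inter> cset B \<Longrightarrow>
      dual_norm E f * nrm E z \<le> C * max (dual_norm A f * nrm A z) (dual_norm B f * nrm B z)" by blast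
    have "dual A B f" if "f \<in> J" for f
      using that \<open>(A, B, E) \<in> _\<close> linked_dual[OF l] by (auto simp: J_def)
    moreover have "z \<in> cset A \<inter> cset B" if "z \<in> I" for z
      using that \<open>(A, B, E) \<in> _\<close> linked_inter[OF l] by (auto simp: I_def)
    ultimately show ?thesis using C by blast
  qed
  define m where "m A B f z = max (dual_norm A f * nrm A z) (dual_norm B f * nrm B z)"
    for A B :: "'a nspace" and f :: "'a \<Rightarrow> 'k" and z
  obtain C1 C2 C3 C4 where C: "C1 > 0" "C2 > 0" "C3 > 0" "C4 > 0"
    and e1: "\<And>f z. f \<in> J \<Longrightarrow> z \<in> I \<Longrightarrow> dual_norm V f * nrm V z \<le> C1 * m X Y f z"
    and e2: "\<And>f z. f \<in> J \<Longrightarrow> z \<in> I \<Longrightarrow> dual_norm W f * nrm W z \<le> C2 * m X Y f z"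
    and e3: "\<And>f z. f \<in> J \<Longrightarrow> z \<in> I \<Longrightarrow> dual_norm X f * nrm X z \<le> C3 * m V W f z"
    and e4: "\<And>f z. f \<in> J \<Longrightarrow> z \<in> I \<Longrightarrow> dual_norm Y f * nrm Y z \<le> C4 * m V W f z"
    using estimate[of X Y V] estimate[of X Y W] estimate[of V W X] estimate[of V W Y]
    unfolding m_def by auto
  define D where "D = 1 + C1 + C2 + C3 + C4"
  have D: "D > 0" using C by (simp add: D_def)
  have mpos: "m A B f z > 0" if "f \<in> J" "z \<in> I" "A \<in> {X, Y, V, W}" "B \<in> {X, Y, V, W}" for A B f z
    using dual_J[OF that(1,3)] nrm_I[OF that(2,3)] by (simp add: m_def less_max_iff_disj)
  have lnm: "ln (m A B f z) = max (ln (nrm A z) + ln (dual_norm A f)) (ln (nrm B z) + ln (dual_norm B f))"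
    if "f \<in> J" "z \<in> I" "A \<in> {X, Y, V, W}" "B \<in> {X, Y, V, W}" for A B f z
    using dual_J[OF that(1,3)] nrm_I[OF that(2,3)] dual_J[OF that(1,4)] nrm_I[OF that(2,4)]
    by (simp add: m_def ln_max ln_mult add.commute)
  have compare: "\<bar>ln (m X Y f z) - ln (m V W f z)\<bar> \<le> ln D" if f: "f \<in> J" and z: "z \<in> I" for f z
  proof -
    have p: "m X Y f z > 0" "m V W f z > 0" using mpos[OF f z] by auto
    have b1: "C1 * m X Y f z \<le> D * m X Y f z" "C2 * m X Y f z \<le> D * m X Y f z"
      "C3 * m V W f z \<le> D * m V W f z" "C4 * m V W f z \<le> D * m V W f z"
      using p C by (auto intro!: mult_right_mono simp: D_def)
    have "m V W f z \<le> D * m X Y f z"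
      using e1[OF f z] e2[OF f z] b1 unfolding m_def[of V W] by linarith
    then have "ln (m V W f z) \<le> ln (D * m X Y f z)" using p D by simp
    then have g1: "ln (m V W f z) \<le> ln D + ln (m X Y f z)" using p D by (simp add: ln_mult)
    have "m X Y f z \<le> D * m V W f z"
      using e3[OF f z] e4[OF f z] b1 unfolding m_def[of X Y] by linarith
    then have "ln (m X Y f z) \<le> ln (D * m V W f z)" using p D by simp
    then have "ln (m X Y f z) \<le> ln D + ln (m V W f z)" using p D by (simp add: ln_mult)
    then show ?thesis using g1 by linarith
  qed
  have gap: "B < ln a - ln b" if "exp B * b < a" "0 < b" for a b B :: real
  proof -
    have "0 < exp B * b" using that by simp
    then have "ln (exp B * b) < ln a" using that by (subst ln_less_cancel_iff) linarith+
    then show ?thesis using that by (simp add: ln_mult)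
  qed
  have "(\<exists>K. \<forall>z\<in>I. \<bar>ln (nrm V z) - ln (nrm X z)\<bar> \<le> K \<and> \<bar>ln (nrm W z) - ln (nrm Y z)\<bar> \<le> K) \<or>
    (\<exists>K. \<forall>z\<in>I. \<bar>ln (nrm V z) - ln (nrm Y z)\<bar> \<le> K \<and> \<bar>ln (nrm W z) - ln (nrm X z)\<bar> \<le> K)"
  proof (rule tropical_rigidity[where c="\<lambda>f. ln (dual_norm X f)" and d="\<lambda>f. ln (dual_norm Y f)"
        and c'="\<lambda>f. ln (dual_norm V f)" and d'="\<lambda>f. ln (dual_norm W f)" and J=J and L="ln D"])
    fix z f assume z: "z \<in> I" and f: "f \<in> J"
    show "\<bar>max (ln (nrm X z) + ln (dual_norm X f)) (ln (nrm Y z) + ln (dual_norm Y f)) -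
        max (ln (nrm V z) + ln (dual_norm V f)) (ln (nrm W z) + ln (dual_norm W f))\<bar> \<le> ln D"
      using compare[OF f z] lnm[OF f z, of X Y] lnm[OF f z, of V W] by simp
  next
    fix B :: real
    obtain z where z: "z \<in> cset X \<inter> cset Y" "exp B * nrm Y z < nrm X z"
      using vector_ratio_unbounded[OF cXY YX _ dY, of "exp B"] by auto
    have "z \<in> I" using z nrm_zero[OF linked_spaces(2)[OF l]] by (auto simp: I_def)
    then show "\<exists>z\<in>I. B < ln (nrm X z) - ln (nrm Y z)" using gap[OF z(2)] nrm_I[of z Y] by blast
    obtain z where z: "z \<in> cset X \<inter> cset Y" "exp (- B) * nrm X z < nrm Y z"
      using vector_ratio_unbounded[OF cYX XY, of "exp (- B)"] dX by (auto simp: Int_commute)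
    have zI: "z \<in> I" using z nrm_zero[OF linked_spaces(2)[OF l]] by (auto simp: I_def)
    have "- B < ln (nrm Y z) - ln (nrm X z)" using gap[OF z(2)] nrm_I[OF zI, of X] by blast
    then show "\<exists>z\<in>I. ln (nrm X z) - ln (nrm Y z) < B" using zI by (intro bexI[of _ z]) auto
    obtain f where f: "dual X Y f" "exp B * dual_norm X f < dual_norm Y f"
      using functional_ratio_unbounded[OF cXY YX, of "exp B"] by auto
    have fJ: "f \<in> J" by (rule J_I[OF f]) auto
    then show "\<exists>f\<in>J. B < ln (dual_norm Y f) - ln (dual_norm X f)" using gap[OF f(2)] dual_J[OF fJ, of X] by blast
    obtain f where f: "dual X Y f" "exp (- B) * dual_norm Y f < dual_norm X f"
      using functional_ratio_unbounded[OF cYX XY, of "exp (- B)"] by (auto simp: dual_commute[of Y X])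
    have fJ: "f \<in> J" by (rule J_I[OF f]) auto
    have "- B < ln (dual_norm X f) - ln (dual_norm Y f)" using gap[OF f(2)] dual_J[OF fJ, of Y] by blast
    then show "\<exists>f\<in>J. ln (dual_norm Y f) - ln (dual_norm X f) < B" using fJ by (intro bexI[of _ f]) auto
  qed
  moreover have same: "cset F = cset E" if EF: "E \<in> {X, Y, V, W}" "F \<in> {X, Y, V, W}"
    and d: "dense_in (cset X \<inter> cset Y) E" "dense_in (cset X \<inter> cset Y) F"
    and K: "\<And>z. z \<in> I \<Longrightarrow> \<bar>ln (nrm F z) - ln (nrm E z)\<bar> \<le> K" for E F K
  proof -
    have le: "nrm F z \<le> exp K * nrm E z" "nrm E z \<le> exp K * nrm F z" if z: "z \<in> cset X \<inter> cset Y" for z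
    proof -
      have "nrm F z \<le> exp K * nrm E z \<and> nrm E z \<le> exp K * nrm F z"
      proof (cases "z = 0")
        case True
        then show ?thesis using nrm_zero[OF linked_spaces(2)[OF l]] EF by auto
      next
        case False
        then have zI: "z \<in> I" using z by (simp add: I_def)
        have p: "nrm E z > 0" "nrm F z > 0" using nrm_I[OF zI] EF by auto
        have "ln (nrm F z) \<le> ln (exp K * nrm E z)" "ln (nrm E z) \<le> ln (exp K * nrm F z)"
          using K[OF zI] p by (auto simp: ln_mult)
        then show ?thesis using p by simp
      qed
      then show "nrm F z \<le> exp K * nrm E z" "nrm E z \<le> exp K * nrm F z" by auto
    qed
    show ?thesis
      using linked_dense_bound_subset[OF l EF(1,2) d(2) le(2)] linked_dense_bound_subset[OF l EF(2,1) d(1) le(1)]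
      by auto
  qed
  ultimately show ?thesis
  proof (elim disjE exE)
    fix K assume K: "\<forall>z\<in>I. \<bar>ln (nrm V z) - ln (nrm X z)\<bar> \<le> K \<and> \<bar>ln (nrm W z) - ln (nrm Y z)\<bar> \<le> K"
    have "cset V = cset X" by (rule same[OF _ _ dX dV, of K]) (use K in auto)
    moreover have "cset W = cset Y" by (rule same[OF _ _ dY dW, of K]) (use K in auto)
    ultimately show ?thesis by simp
  next
    fix K assume K: "\<forall>z\<in>I. \<bar>ln (nrm V z) - ln (nrm Y z)\<bar> \<le> K \<and> \<bar>ln (nrm W z) - ln (nrm X z)\<bar> \<le> K"
    have "cset V = cset Y" by (rule same[OF _ _ dY dV, of K]) (use K in auto)
    moreover have "cset W = cset X" by (rule same[OF _ _ dX dW, of K]) (use K in auto)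
    ultimately show ?thesis by simp
  qed
qed

lemma nested_components:
  assumes l: "linked X Y V W" and XY: "cset X \<subseteq> cset Y" and VW: "cset V \<subseteq> cset W"
  shows "cset X = cset V \<and> cset Y = cset W"
proof -
  have sum: "cset (sum_space A B) = cset B" if "normed_space smul A" "normed_space smul B" "cset A \<subseteq> cset B" for A B
    using that subset_sum_space(2)[OF that(1,2)] normed_add[OF that(2)] by (auto simp: cset_sum_space)
  have "cset Y = cset W"
    using linked_sum[OF l] sum[of X Y] sum[of V W] linked_spaces(2)[OF l] XY VW by auto
  moreover have "cset X = cset V" using linked_inter[OF l] XY VW by blast
  ultimately show ?thesis by simp
qed

text \<open>
When all four spaces are dense in the common sum, only nested couples escape the rigidity argument. Two
nested couples both consist of the common intersection and the common sum. If just one couple is nested,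
rigidity applied to the other one settles the matter.
\<close>

lemma linked_components:
  assumes l: "linked X Y V W"
  shows "(cset X = cset V \<and> cset Y = cset W) \<or> (cset X = cset W \<and> cset Y = cset V)"
proof -
  note l' = linked_swap(1)[OF l]
  have cXY: "banach_couple smul X Y" and cYX: "banach_couple smul Y X"
    and cVW: "banach_couple smul V W" and cWV: "banach_couple smul W V"
    using l banach_couple_commute by (auto simp: linked_def)
  consider "\<not> cset X \<subseteq> functional_closure X Y (cset Y)" | "\<not> cset Y \<subseteq> functional_closure Y X (cset X)"
    | "\<not> cset V \<subseteq> functional_closure V W (cset W)" | "\<not> cset W \<subseteq> functional_closure W V (cset V)"
    | "cset X \<subseteq> functional_closure X Y (cset Y)" "cset Y \<subseteq> functional_closure Y X (cset X)"
      "cset V \<subseteq> functional_closure V W (cset W)" "cset W \<subseteq> functional_closure W V (cset V)" by blast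
  then show ?thesis
  proof cases
    case 1
    then show ?thesis using nondense_component[OF l] by blast
  next
    case 2
    then show ?thesis using nondense_component[OF linked_swap(2)[OF l]] by blast
  next
    case 3
    then show ?thesis using nondense_component[OF l'] by blast
  next
    case 4
    then show ?thesis using nondense_component[OF linked_swap(2)[OF l']] by blast
  next
    case 5
    have dX: "dense_in (cset X \<inter> cset Y) X" by (rule dense_inter_of_functional_closure[OF cXY 5(1)])
    have dY: "dense_in (cset X \<inter> cset Y) Y"
      using dense_inter_of_functional_closure[OF cYX 5(2)] by (simp add: Int_commute)
    have dV: "dense_in (cset X \<inter> cset Y) V"
      using dense_inter_of_functional_closure[OF cVW 5(3)] by (simp add: linked_inter[OF l])
    have dW: "dense_in (cset X \<inter> cset Y) W"
      using dense_inter_of_functional_closure[OF cWV 5(4)] linked_inter[OF l] by (simp add: Int_commute)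
    have I: "cset V \<inter> cset W = cset X \<inter> cset Y" by (rule linked_inter[OF l])
    show ?thesis
    proof (cases "cset X \<subseteq> cset Y \<or> cset Y \<subseteq> cset X")
      case False
      then show ?thesis using dense_components[OF l dX dY dV dW] by blast
    next
      case nested: True
      show ?thesis
      proof (cases "cset V \<subseteq> cset W \<or> cset W \<subseteq> cset V")
        case False
        then show ?thesis using dense_components[OF l', unfolded I, OF dV dW dX dY] by blast
      next
        case True
        then show ?thesis
          using nested nested_components[OF l] nested_components[OF linked_swap(2)[OF l]]
            nested_components[OF linked_swap(3)[OF l]] nested_components[OF linked_swap(3)[OF linked_swap(2)[OF l]]]
          by blast
      qed
    qed
  qed
qed

lemma equiv_spaces_of_inclusions:
  assumes F: "normed_space smul F" and EF: "bounded_inclusion E F" and FE: "bounded_inclusion F E"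
    and E: "normed_space smul E"
  shows "E \<simeq> F"
proof -
  obtain C where C: "C \<ge> 0" "\<And>x. x \<in> cset E \<Longrightarrow> nrm F x \<le> C * nrm E x"
    using EF unfolding bounded_inclusion_def by blast
  obtain D where D: "D \<ge> 0" "\<And>x. x \<in> cset F \<Longrightarrow> nrm E x \<le> D * nrm F x"
    using FE unfolding bounded_inclusion_def by blast
  have eq: "cset E = cset F" using EF FE by (auto simp: bounded_inclusion_def)
  have "1 / (D + 1) * nrm E x \<le> nrm F x \<and> nrm F x \<le> (C + 1) * nrm E x" if x: "x \<in> cset E" for x
  proof
    have n: "0 \<le> nrm E x" "0 \<le> nrm F x" using nrm_nonneg E F by auto
    show "nrm F x \<le> (C + 1) * nrm E x" using C(2)[OF x] n by (simp add: algebra_simps)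
    have "nrm E x \<le> (D + 1) * nrm F x" using D(2)[of x] x eq n by (simp add: algebra_simps)
    then show "1 / (D + 1) * nrm E x \<le> nrm F x" using D(1) by (simp add: field_simps)
  qed
  moreover have "1 / (D + 1) > 0" "C + 1 > 0" using C D by auto
  ultimately show ?thesis unfolding equiv_spaces_def using eq by blast
qed

end

theorem corollary2p9:
  fixes smul :: "'k::real_or_complex \<Rightarrow> 'a::ab_group_add \<Rightarrow> 'a"
    and X Y V W :: "'a nspace"
  assumes "vector_space smul"
    and "banach_couple smul X Y"
    and "banach_couple smul V W"
    and "interpolation_spaces smul X Y = interpolation_spaces smul V W"
  shows "(X \<simeq> V \<and> Y \<simeq> W) \<or> (X \<simeq> W \<and> Y \<simeq> V)"
proof -
  interpret scalar_space smul by (rule scalar_space.intro) (rule assms(1))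
  have "X \<in> interpolation_spaces smul X Y" "Y \<in> interpolation_spaces smul X Y"
    "V \<in> interpolation_spaces smul V W" "W \<in> interpolation_spaces smul V W"
    using couple_endpoint_interpolation[OF assms(2)] couple_endpoint_interpolation[OF assms(3)]
      couple_endpoint_interpolation[OF banach_couple_commute[OF assms(2)]]
      couple_endpoint_interpolation[OF banach_couple_commute[OF assms(3)]]
    by (simp_all add: interpolation_spaces_commute[of Y X] interpolation_spaces_commute[of W V])
  then have l: "linked X Y V W" using assms(2-4) by (simp add: linked_def)
  have equiv: "E \<simeq> F" if "E \<in> {X, Y, V, W}" "F \<in> {X, Y, V, W}" "cset E = cset F" for E F
    using equiv_spaces_of_inclusions[OF linked_spaces(2)[OF l that(2)] linked_subset_bound[OF l that(1,2)]
      linked_subset_bound[OF l that(2,1)] linked_spaces(2)[OF l that(1)]] that(3) by simp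
  show ?thesis using linked_components[OF l] equiv by auto
qed

end
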